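(* Let $EA_c$ and $EA_{fg}$ denote the classes of all countable elementary amenable groups and of all finitely generated elementary amenable groups, respectively. Let $\mathrm c(G)$ denote the elementary class of an elementary amenable group $G$, and let $\omega_1$ be the first uncountable ordinal. Then $$\{\mathrm c(G)\mid G\in EA_c\}=\{\alpha+1\mid\alpha<\omega_1\}\cup\{0\}$$ and $$\{\mathrm c(G)\mid G\in EA_{fg}\}=\{\alpha+2\mid\alpha<\omega_1\}\cup\{0,1\}.$$
   Context: The class $EA$ of elementary amenable groups is the smallest class of groups containing all finite and all abelian groups and closed under taking subgroups, quotients, extensions, and direct (i.e. directed) unions. Define classes $EG_\alpha$ for ordinals $\alpha$ by transfinite induction: $EG_0$ is the class of all finite groups and all abelian groups; if $\alpha$ is a (non-zero) limit ordinal, $EG_\alpha=\bigcup_{\beta<\alpha}EG_\beta$; if $\alpha$ is a successor ordinal, $EG_\alpha$ is the class of groups that can be obtained from groups in $EG_{\alpha-1}$ by applying once the operation of taking an extension (of a group from $EG_{\alpha-1}$ by a group from $EG_{\alpha-1}$) or a direct union (of groups from $EG_{\alpha-1}$). One has $EA=\bigcup_\alpha EG_\alpha$ over all ordinals. The elementary class $\mathrm c(G)$ of $G\in EA$ is the smallest ordinal $\alpha$ such that $G\in EG_\alpha$. *)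

theory Defs
  imports
    "HOL-Algebra.Algebra"
    "HOL-Library.Countable_Set"
    "HOL-Library.Infinite_Typeclass"
begin

section \<open>Ordinals\<close>

text \<open>
  An element of \<open>'b ordinal\<close> is the order type of a well-order on some subset of \<open>'b\<close>
  (well-orders as in \<open>Main\<close>, that is reflexive relations on their field). So \<open>'b ordinal\<close>
  consists of exactly the ordinals of cardinality at most that of \<open>'b\<close>; for infinite \<open>'b\<close>
  these are the ordinals below the successor cardinal of \<open>'b\<close>.
\<close>

quotient_type 'b ordinal = "'b rel" / partial: "\<lambda>r s. (r, s) \<in> ordIso"
proof (rule part_equivpI)
  show "\<exists>r :: 'b rel. (r, r) \<in> ordIso"
    by (rule exI[of _ "{}"]) (simp add: ordIso_reflexive)
  show "symp (\<lambda>r s :: 'b rel. (r, s) \<in> ordIso)"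
    by (auto intro: sympI ordIso_symmetric)
  show "transp (\<lambda>r s :: 'b rel. (r, s) \<in> ordIso)"
    by (auto intro: transpI ordIso_transitive)
qed

instantiation ordinal :: (type) wellorder
begin

lift_definition less_eq_ordinal :: "'a ordinal \<Rightarrow> 'a ordinal \<Rightarrow> bool"
  is "\<lambda>r s. (r, s) \<in> ordLeq"
  by (meson ordIso_symmetric ordIso_ordLeq_trans ordLeq_ordIso_trans)

lift_definition less_ordinal :: "'a ordinal \<Rightarrow> 'a ordinal \<Rightarrow> bool"
  is "\<lambda>r s. (r, s) \<in> ordLess"
  by (meson ordIso_symmetric ordIso_ordLess_trans ordLess_ordIso_trans)

instance
proof
  fix x y z :: "'a ordinal"
  show "x < y \<longleftrightarrow> x \<le> y \<and> \<not> y \<le> x"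
    by transfer (auto simp: ordLess_imp_ordLeq not_ordLess_ordLeq
        dest: ordIso_Well_order_simp intro: not_ordLeq_iff_ordLess[THEN iffD1])
  show "x \<le> x"
    by transfer (simp add: ordIso_iff_ordLeq)
  show "x \<le> y \<Longrightarrow> y \<le> z \<Longrightarrow> x \<le> z"
    by transfer (rule ordLeq_transitive)
  show "x \<le> y \<Longrightarrow> y \<le> x \<Longrightarrow> x = y"
    by transfer (simp add: ordIso_iff_ordLeq)
  show "x \<le> y \<or> y \<le> x"
    by transfer (auto dest!: ordIso_Well_order_simp intro: ordLeq_total[THEN disjE])
next
  fix P :: "'a ordinal \<Rightarrow> bool" and x :: "'a ordinal"
  assume step: "\<And>x. (\<And>y. y < x \<Longrightarrow> P y) \<Longrightarrow> P x"
  have rep: "\<exists>r. y = abs_ordinal r \<and> Well_order r" for y :: "'a ordinal"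
    by (induction y rule: ordinal.abs_induct) (blast dest: ordIso_Well_order_simp)
  have "Well_order r \<longrightarrow> P (abs_ordinal r)" for r :: "'a rel"
    using wf_ordLess
  proof (induction r rule: wf_induct_rule)
    case (less r)
    show ?case
    proof
      assume r: "Well_order r"
      show "P (abs_ordinal r)"
      proof (rule step)
        fix y assume y: "y < abs_ordinal r"
        obtain s where s: "y = abs_ordinal s" "Well_order s" using rep by blast
        have "(s, r) \<in> ordLess"
          using y s r by (simp add: less_ordinal.abs_eq ordIso_reflexive)
        then show "P y" using less s by simp
      qed
    qed
  qed
  then show "P x" using rep[of x] by blast
qed

end

instantiation ordinal :: (type) zero
begin

lift_definition zero_ordinal :: "'a ordinal" is "{}"
  by (simp add: ordIso_reflexive)

instance ..

end

text \<open>
  The successor \<open>\<alpha> + 1\<close>. The type \<open>'b ordinal\<close> has no greatest element when \<open>'b\<close> is infinite,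
  which is the only case in which this operation is used below.
\<close>

definition osucc :: "'b ordinal \<Rightarrow> 'b ordinal" where
  "osucc \<alpha> = (LEAST \<beta>. \<alpha> < \<beta>)"

definition limit_ordinal :: "'b ordinal \<Rightarrow> bool" where
  "limit_ordinal \<alpha> \<longleftrightarrow> \<alpha> \<noteq> 0 \<and> (\<forall>\<beta>. \<alpha> \<noteq> osucc \<beta>)"

text \<open>
  As in the von Neumann picture, an ordinal is (un)countable if its set of predecessors is.
  An uncountable ordinal exists in \<open>'b ordinal\<close> whenever \<open>'b\<close> is uncountable.
\<close>

definition omega1 :: "'b ordinal" where
  "omega1 = (LEAST \<alpha>. uncountable {\<beta>. \<beta> < \<alpha>})"


section \<open>Elementary amenable groups\<close>

text \<open>
  \<open>G\<close> is an extension of (an isomorphic copy of) \<open>A\<close> by \<open>B\<close>. Isomorphic copies are needed because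
  the elements of a quotient of \<open>G\<close> are sets of elements of \<open>G\<close>. Up to isomorphism every quotient
  of a group on \<open>'a\<close> has its carrier in \<open>'a\<close> again, so that classes of groups on \<open>'a\<close> can be used
  as a universe closed under subgroups and quotients.
\<close>

definition extension_of :: "'a monoid \<Rightarrow> 'a monoid \<Rightarrow> 'a monoid \<Rightarrow> bool" where
  "extension_of G A B \<longleftrightarrow> (\<exists>N. N \<lhd> G \<and> G\<lparr>carrier := N\<rparr> \<cong> A \<and> G Mod N \<cong> B)"

definition directed_union_of :: "'a monoid \<Rightarrow> 'a set set \<Rightarrow> bool" where
  "directed_union_of G \<H> \<longleftrightarrow>
     group G \<and> \<H> \<noteq> {} \<and> (\<forall>H\<in>\<H>. subgroup H G) \<and>
     (\<forall>H\<in>\<H>. \<forall>K\<in>\<H>. \<exists>L\<in>\<H>. H \<subseteq> L \<and> K \<subseteq> L) \<and>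
     carrier G = \<Union>\<H>"

inductive elementary_amenable :: "'a monoid \<Rightarrow> bool" where
  finite: "group G \<Longrightarrow> finite (carrier G) \<Longrightarrow> elementary_amenable G"
| abelian: "comm_group G \<Longrightarrow> elementary_amenable G"
| subgroup: "elementary_amenable G \<Longrightarrow> subgroup H G \<Longrightarrow> elementary_amenable (G\<lparr>carrier := H\<rparr>)"
| quotient: "elementary_amenable G \<Longrightarrow> N \<lhd> G \<Longrightarrow> group Q \<Longrightarrow> G Mod N \<cong> Q
    \<Longrightarrow> elementary_amenable Q"
| extension: "elementary_amenable A \<Longrightarrow> elementary_amenable B \<Longrightarrow> extension_of G A B
    \<Longrightarrow> elementary_amenable G"
| directed_union: "directed_union_of G \<H>
    \<Longrightarrow> (\<And>H. H \<in> \<H> \<Longrightarrow> elementary_amenable (G\<lparr>carrier := H\<rparr>))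
    \<Longrightarrow> elementary_amenable G"

text \<open>
  \<open>EG \<alpha> G\<close> says that \<open>G\<close> belongs to the class \<open>EG\<^sub>\<alpha>\<close>. Zero, limits and successors
  being mutually exclusive, the rules are the three clauses of the transfinite recursion.
\<close>

inductive EG :: "'b ordinal \<Rightarrow> 'a monoid \<Rightarrow> bool" where
  zero_finite: "group G \<Longrightarrow> finite (carrier G) \<Longrightarrow> EG 0 G"
| zero_abelian: "comm_group G \<Longrightarrow> EG 0 G"
| limit: "limit_ordinal \<alpha> \<Longrightarrow> \<beta> < \<alpha> \<Longrightarrow> EG \<beta> G \<Longrightarrow> EG \<alpha> G"
| succ_extension: "EG \<beta> A \<Longrightarrow> EG \<beta> B \<Longrightarrow> extension_of G A B \<Longrightarrow> EG (osucc \<beta>) G"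
| succ_directed_union: "directed_union_of G \<H>
    \<Longrightarrow> (\<And>H. H \<in> \<H> \<Longrightarrow> EG \<beta> (G\<lparr>carrier := H\<rparr>)) \<Longrightarrow> EG (osucc \<beta>) G"

text \<open>
  The ordinals on \<open>'a set\<close> suffice to measure every elementary amenable group on an infinite
  type \<open>'a\<close>: the classes of groups on \<open>'a\<close> become stationary before the successor cardinal of
  \<open>'a set\<close>. They also include the first uncountable ordinal.
\<close>

definition elementary_class :: "'a monoid \<Rightarrow> 'a set ordinal" where
  "elementary_class G = (LEAST \<alpha>. EG \<alpha> G)"

definition finitely_generated :: "'a monoid \<Rightarrow> bool" where
  "finitely_generated G \<longleftrightarrow>
     (\<exists>S. finite S \<and> S \<subseteq> carrier G \<and> generate G S = carrier G)"

definition EA_c :: "'a monoid set" where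
  "EA_c = {G. elementary_amenable G \<and> countable (carrier G)}"

definition EA_fg :: "'a monoid set" where
  "EA_fg = {G. elementary_amenable G \<and> finitely_generated G}"

end

theory Submission
  imports Defs
begin

text \<open>
  A class is never a limit ordinal, and a finitely generated group in \<open>EG\<^sub>\<lambda>\<^sub>+\<^sub>1\<close> with \<open>\<lambda>\<close> a limit
  is already in \<open>EG\<^sub>\<lambda>\<close>: a directed union is attained, and both parts of an extension lie in a
  common \<open>EG\<^sub>\<beta>\<close> with \<open>\<beta> < \<lambda>\<close>. Classes of countable groups are countable, since a countable group
  has only countably many finitely generated subgroups.

  Finitely generated groups \<open>P\<^sub>\<alpha>\<close> of class \<open>\<alpha> + 1\<close> are constructed for every countable non-limit
  \<open>\<alpha>\<close>, starting from \<open>\<int> wr \<int>\<close>. At a successor, \<open>P\<^sub>\<alpha>\<^sub>+\<^sub>1 = P\<^sub>\<alpha> wr P\<^sub>\<alpha>\<close>: a normal subgroup of it either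
  lies in the base, and then the quotient maps onto \<open>P\<^sub>\<alpha>\<close>, or it contains commutators that make a
  subgroup of it map onto a coordinate \<open>P\<^sub>\<alpha>\<close>. For a limit \<open>\<lambda>\<close>, let \<open>K\<close> be the restricted sum of
  the earlier groups. As in the Neumann embedding theorem, the unrestricted wreath product of \<open>K\<close>
  and \<open>\<int>\<close> has a two-generator subgroup \<open>T\<close> that contains a copy of \<open>K'\<close> and for which \<open>T''\<close>
  lies in a restricted power of \<open>K\<close>, which belongs to \<open>EG\<^sub>\<lambda>\<^sub>+\<^sub>1\<close>. A countable group of class
  \<open>\<alpha> + 1\<close> is the kernel or the quotient of an extension realising the class of \<open>P\<^sub>\<alpha>\<^sub>+\<^sub>1\<close>.
\<close>

section \<open>Ordinals\<close>

text \<open>The obstacle is the upper bound. Each step of the hierarchy allows one extension or one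
  directed union, whereas the base of a wreath product is an infinite sum, and a bound on one
  summand gives no direct bound on that sum. So upper bounds are carried by all groups that embed
  into restricted sums of copies. This also bridges the types: wreath products and sums live on
  function types, and only groups that fit on \<open>'a\<close> are compared with the classes.

  At a limit \<mu> the embedding is deliberately lossy on both sides. Below, only derived subgroups
  of the summands have to be found inside T; this loses one step of the hierarchy, which cannot
  matter under a limit. Above, the infinite supports in T disappear only after commutators of base
  elements are taken, so the restricted sum controls just the second derived subgroup. The remaining
  quotient is metabelian and has class at most 1, so a single extension goes from \<mu> + 1 to \<mu>
  + 2. Finite generation supplies the matching lower bound, since it excludes class \<mu> +
  1.\<close>

instance set :: (infinite) infinite
  by intro_classes (metis Pow_UNIV finite_Pow_iff infinite_UNIV)

lemma ordinal_rep:
  obtains r where "\<alpha> = abs_ordinal r" "Well_order r"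
  by (induction \<alpha> rule: ordinal.abs_induct) (blast dest: ordIso_Well_order_simp)

lemma abs_ordinal_less_iff:
  "Well_order r \<Longrightarrow> Well_order s \<Longrightarrow> abs_ordinal r < abs_ordinal s \<longleftrightarrow> (r, s) \<in> ordLess"
  by (simp add: less_ordinal.abs_eq ordIso_reflexive)

lemma abs_ordinal_eq: "(r, s) \<in> ordIso \<Longrightarrow> abs_ordinal r = abs_ordinal s"
  by (rule Quotient3_rel_abs[OF Quotient3_ordinal])

lemma ordinal_zero_le: "(0 :: 'b ordinal) \<le> \<alpha>"
proof -
  obtain r where r: "\<alpha> = abs_ordinal r" "Well_order r" by (rule ordinal_rep)
  have "({} :: 'b rel, r) \<in> ordLeq"
    unfolding ordLeq_def embed_def using r(2) by simp
  then show ?thesis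
    unfolding r(1) zero_ordinal_def using r(2)
    by (simp add: less_eq_ordinal.abs_eq ordIso_reflexive)
qed

text \<open>The field is first moved off a point \<open>x\<close>, which is then put on top.\<close>

lemma ordinal_no_top:
  fixes \<alpha> :: "'b::infinite ordinal"
  shows "\<exists>\<beta>. \<alpha> < \<beta>"
proof -
  obtain r where r: "\<alpha> = abs_ordinal r" "Well_order r" by (rule ordinal_rep)
  define x :: 'b where "x = undefined"
  obtain f :: "'b \<Rightarrow> 'b" where f: "bij_betw f UNIV (UNIV - {x})"
    using infinite_imp_bij_betw[OF infinite_UNIV[where 'a='b], of x] by blast
  have inj: "inj_on f (Field r)" and nx: "x \<notin> range f"
    using f by (auto simp: bij_betw_def inj_on_def)
  define s where "s = dir_image r f"
  have s: "Well_order s" "(r, s) \<in> ordIso" and xs: "x \<notin> Field s"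
    using Well_order_dir_image[OF r(2) inj] dir_image_ordIso[OF r(2) inj] nx
    by (auto simp: s_def dir_image_Field)
  define t where "t = s \<union> (insert x (Field s)) \<times> {x}"
  have Ft: "Field t = insert x (Field s)" by (auto simp: t_def Field_def)
  have lin: "Linear_order s" and wfs: "wf (s - Id)" using s(1) by (auto simp: well_order_on_def)
  have lt: "Linear_order t"
    unfolding linear_order_on_def partial_order_on_def preorder_on_def Ft
  proof (intro conjI)
    show "t \<subseteq> insert x (Field s) \<times> insert x (Field s)"
      unfolding t_def Field_def by auto
    show "refl_on (insert x (Field s)) t"
      using lin unfolding linear_order_on_def partial_order_on_def preorder_on_def refl_on_def t_def
      by auto
    show "trans t"
      using lin xs unfolding linear_order_on_def partial_order_on_def preorder_on_def t_def
      by (auto simp: trans_def Field_def)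
    show "antisym t"
      using lin xs unfolding linear_order_on_def partial_order_on_def t_def
      by (auto simp: antisym_def Field_def)
    show "total_on (insert x (Field s)) t"
      using lin unfolding linear_order_on_def total_on_def t_def by auto
  qed
  have "wf (t - Id)"
  proof -
    have "wf (s - Id \<union> Field s \<times> {x})"
    proof (rule wf_Un[OF wfs])
      show "wf (Field s \<times> {x})"
      proof (rule wfI_min)
        fix a and Q :: "'b set" assume "a \<in> Q"
        then show "\<exists>z\<in>Q. \<forall>y. (y, z) \<in> Field s \<times> {x} \<longrightarrow> y \<notin> Q"
          using xs by (cases "Q = {x}") auto
      qed
      show "Domain (s - Id) \<inter> Range (Field s \<times> {x}) = {}"
        using xs by (auto simp: Field_def)
    qed
    moreover have "t - Id \<subseteq> s - Id \<union> Field s \<times> {x}" by (auto simp: t_def)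
    ultimately show ?thesis by (rule wf_subset)
  qed
  with lt have t: "Well_order t" by (simp add: well_order_on_def)
  have "underS t x = Field s"
    using xs by (auto simp: underS_def t_def Field_def)
  then have "Restr t (underS t x) = s"
    using xs by (auto simp: t_def Field_def)
  then have "(s, t) \<in> ordLess"
    using underS_Restr_ordLess[OF t, of x] Ft by auto
  then have "abs_ordinal s < abs_ordinal t" using s t by (simp add: abs_ordinal_less_iff)
  then show ?thesis using r abs_ordinal_eq[OF s(2)] by auto
qed

lemma osucc_gt: "(\<alpha> :: 'b::infinite ordinal) < osucc \<alpha>"
  unfolding osucc_def using ordinal_no_top by (rule LeastI_ex)

lemma osucc_le: "\<alpha> < \<beta> \<Longrightarrow> osucc \<alpha> \<le> \<beta>"
  unfolding osucc_def by (rule Least_le)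

lemma less_osucc_iff: "(\<beta> :: 'b::infinite ordinal) < osucc \<alpha> \<longleftrightarrow> \<beta> \<le> \<alpha>"
  by (meson linorder_not_less osucc_gt osucc_le order.strict_trans2 order.strict_trans1 not_le)

lemma osucc_inject [simp]: "osucc (\<alpha> :: 'b::infinite ordinal) = osucc \<beta> \<longleftrightarrow> \<alpha> = \<beta>"
  by (metis less_osucc_iff order_antisym order_refl)

lemma osucc_mono: "\<alpha> \<le> \<beta> \<Longrightarrow> osucc \<alpha> \<le> osucc (\<beta> :: 'b::infinite ordinal)"
  by (meson le_less_trans osucc_gt osucc_le)

lemma osucc_neq_zero [simp]: "osucc (\<alpha> :: 'b::infinite ordinal) \<noteq> 0" "0 \<noteq> osucc (\<alpha> :: 'b ordinal)"
  using osucc_gt[of \<alpha>] ordinal_zero_le[of \<alpha>] by (auto simp: not_less[symmetric])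

lemma limit_ordinal_osucc [simp]: "\<not> limit_ordinal (osucc \<alpha>)" "\<not> limit_ordinal 0"
  by (auto simp: limit_ordinal_def)

lemma ordinal_cases [case_names zero succ limit]:
  obtains "\<alpha> = 0" | \<beta> where "\<alpha> = osucc \<beta>" | "limit_ordinal \<alpha>"
  unfolding limit_ordinal_def by blast

lemma limit_osucc_less:
  "limit_ordinal \<alpha> \<Longrightarrow> \<beta> < \<alpha> \<Longrightarrow> osucc \<beta> < \<alpha>"
  using osucc_le[of \<beta> \<alpha>] by (auto simp: limit_ordinal_def less_le)

lemma limit_pos: "limit_ordinal \<alpha> \<Longrightarrow> 0 < \<alpha>"
  using ordinal_zero_le[of \<alpha>] by (auto simp: limit_ordinal_def less_le)

section \<open>The first uncountable ordinal\<close>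

text \<open>Each point of a well-order on all of \<open>'a set\<close> gives the ordinal of the
  segment below it. Different points give different ordinals, so the ordinals below the whole order
  are at least as many as the sets, hence uncountably many by Cantor.\<close>

lemma uncountable_ordinal: "\<exists>\<alpha> :: 'a::infinite set ordinal. uncountable {\<beta>. \<beta> < \<alpha>}"
proof -
  have unc: "uncountable (UNIV :: 'a set set)"
  proof
    assume "countable (UNIV :: 'a set set)"
    then obtain h :: "'a set \<Rightarrow> nat" where h: "inj h" by (auto simp: countable_def)
    obtain g :: "nat \<Rightarrow> 'a" where g: "inj g"
      \<comment> \<open>Through an infinite sequence in \<open>'a\<close>, a countable power set
        would inject into \<open>'a\<close> itself.\<close>
      using infinite_countable_subset[OF infinite_UNIV[where 'a='a]] by blast
    define k where "k A = g (h A)" for A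
    have "inj k" using g h by (auto simp: k_def inj_on_def)
    then have "range (inv_into UNIV k) = Pow UNIV" by (simp add: inj_imp_surj_inv)
    then show False using Cantors_theorem[of "UNIV :: 'a set"] by blast
  qed
  obtain r :: "'a set rel" where "well_order_on UNIV r" using well_order_on by blast
  then have r: "Well_order r" "Field r = UNIV" using well_order_on_Well_order by auto
  define F where "F a = abs_ordinal (Restr r (Order_Relation.underS r a))" for a
  have wo: "Well_order (Restr r A)" for A using r(1) by (rule Well_order_Restr)
  interpret wo: wo_rel r using r(1) by (simp add: wo_rel_def)
  have less: "F a < abs_ordinal r" for a
    unfolding F_def using underS_Restr_ordLess[OF r(1)] r wo by (simp add: abs_ordinal_less_iff)
  have "inj F"
  proof (rule injI, rule ccontr)
    fix a b assume ab: "F a = F b" "a \<noteq> b"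
    have *: "F a < F b" if "a \<in> Order_Relation.underS r b" for a b
    proof -
      have "Order_Relation.underS r a \<subset> Order_Relation.underS r b"
        using that wo.TRANS wo.ANTISYM
        unfolding Order_Relation.underS_def trans_def antisym_def by blast
      then have "(Restr r (Order_Relation.underS r a), Restr r (Order_Relation.underS r b)) \<in> ordLess"
        using ofilter_subset_ordLess[OF r(1)] wo.underS_ofilter by blast
      then show ?thesis unfolding F_def using wo by (simp add: abs_ordinal_less_iff)
    qed
    have "a \<in> Order_Relation.underS r b \<or> b \<in> Order_Relation.underS r a"
      using wo.TOTAL ab r(2) by (auto simp: Order_Relation.underS_def total_on_def)
    with * ab show False by (metis less_irrefl)
  qed
  then have "uncountable (range F)" using unc countable_image_inj_eq by blast
  moreover have "range F \<subseteq> {\<beta>. \<beta> < abs_ordinal r}" using less by auto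
  ultimately show ?thesis using countable_subset by blast
qed

lemma uncountable_omega1: "uncountable {\<beta>. \<beta> < (omega1 :: 'a::infinite set ordinal)}"
  unfolding omega1_def using uncountable_ordinal by (rule LeastI_ex)

lemma less_omega1_iff: "(\<alpha> :: 'a::infinite set ordinal) < omega1 \<longleftrightarrow> countable {\<beta>. \<beta> < \<alpha>}"
proof
  show "\<alpha> < omega1 \<Longrightarrow> countable {\<beta>. \<beta> < \<alpha>}"
    unfolding omega1_def using not_less_Least by blast
  show "countable {\<beta>. \<beta> < \<alpha>} \<Longrightarrow> \<alpha> < omega1"
  proof (rule ccontr)
    assume "countable {\<beta>. \<beta> < \<alpha>}" "\<not> \<alpha> < omega1"
    moreover from this have "{\<beta>. \<beta> < omega1} \<subseteq> {\<beta>. \<beta> < \<alpha>}" by auto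
    ultimately show False using uncountable_omega1 countable_subset by blast
  qed
qed

lemma countable_atMost_ordinal:
  assumes "(\<alpha> :: 'a::infinite set ordinal) < omega1"
  shows "countable {\<beta>. \<beta> \<le> \<alpha>}"
proof -
  have "{\<beta>. \<beta> \<le> \<alpha>} = insert \<alpha> {\<beta>. \<beta> < \<alpha>}" by auto
  then show ?thesis using assms less_omega1_iff by auto
qed

lemma osucc_less_omega1: "(\<alpha> :: 'a::infinite set ordinal) < omega1 \<Longrightarrow> osucc \<alpha> < omega1"
  using countable_atMost_ordinal by (simp add: less_omega1_iff[of "osucc \<alpha>"] less_osucc_iff)

lemma zero_less_omega1: "(0 :: 'a::infinite set ordinal) < omega1"
proof -
  have "{\<beta>. \<beta> < (0 :: 'a set ordinal)} = {}" using ordinal_zero_le by (auto simp: not_less[symmetric])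
  then show ?thesis by (simp add: less_omega1_iff)
qed

text \<open>Regularity of \<open>omega1\<close>: countably many countable initial segments cannot
  cover the uncountable one below \<open>omega1\<close>, and any ordinal left uncovered is a
  bound.\<close>

lemma countable_bounded_omega1:
  fixes S :: "'a::infinite set ordinal set"
  assumes "countable S" "\<And>\<alpha>. \<alpha> \<in> S \<Longrightarrow> \<alpha> < omega1"
  obtains \<gamma> where "\<gamma> < omega1" "\<And>\<alpha>. \<alpha> \<in> S \<Longrightarrow> \<alpha> \<le> \<gamma>"
proof -
  have "countable (\<Union>\<alpha>\<in>S. {\<beta>. \<beta> \<le> \<alpha>})" using assms countable_atMost_ordinal by blast
  then have "\<not> {\<beta>. \<beta> < omega1} \<subseteq> (\<Union>\<alpha>\<in>S. {\<beta>. \<beta> \<le> \<alpha>})"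
    using uncountable_omega1 countable_subset by blast
  then obtain \<gamma> where "\<gamma> < omega1" "\<forall>\<alpha>\<in>S. \<not> \<gamma> \<le> \<alpha>" by auto
  then show ?thesis using that[of \<gamma>] by (auto simp: not_le less_imp_le)
qed

section \<open>Homomorphisms\<close>

lemma monD: "h \<in> mon G H \<Longrightarrow> h \<in> hom G H \<and> inj_on h (carrier G)"
  by (simp add: mon_def)

lemma epiD: "h \<in> epi G H \<Longrightarrow> h \<in> hom G H \<and> h ` carrier G = carrier H"
  by (simp add: epi_def)

lemma group_homI: "group G \<Longrightarrow> group H \<Longrightarrow> h \<in> hom G H \<Longrightarrow> group_hom G H h"
  by (simp add: group_hom_def group_hom_axioms_def)

lemma hom_carrier_update:
  assumes "h \<in> hom G H" "A \<subseteq> carrier G" "h ` A \<subseteq> B"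
  shows "h \<in> hom (G\<lparr>carrier := A\<rparr>) (H\<lparr>carrier := B\<rparr>)"
  using assms by (auto simp: hom_def subset_iff image_subset_iff Pi_iff)

lemma hom_restrict_domain:
  "h \<in> hom G H \<Longrightarrow> A \<subseteq> carrier G \<Longrightarrow> h \<in> hom (G\<lparr>carrier := A\<rparr>) H"
  by (auto simp: hom_def)

lemma mon_restrict:
  assumes "h \<in> mon G H" "A \<subseteq> carrier G" "h ` A \<subseteq> B"
  shows "h \<in> mon (G\<lparr>carrier := A\<rparr>) (H\<lparr>carrier := B\<rparr>)"
  using assms hom_carrier_update[of h G H A B] by (auto simp: mon_def intro: inj_on_subset)

lemma id_mon_subgroup: "subgroup A G \<Longrightarrow> (\<lambda>x. x) \<in> mon (G\<lparr>carrier := A\<rparr>) G"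
  by (auto simp: mon_def hom_def dest: subgroup.subset)

lemma epi_restrict_image:
  assumes "h \<in> hom G H" "A \<subseteq> carrier G"
  shows "h \<in> epi (G\<lparr>carrier := A\<rparr>) (H\<lparr>carrier := h ` A\<rparr>)"
  using hom_carrier_update[OF assms, of "h ` A"] by (simp add: epi_def)

lemma mon_compose: "h \<in> mon G H \<Longrightarrow> k \<in> mon H K \<Longrightarrow> k \<circ> h \<in> mon G K"
  unfolding mon_def
  by (auto intro!: hom_compose comp_inj_on intro: inj_on_subset dest: hom_carrier)

lemma epi_compose: "h \<in> epi G H \<Longrightarrow> k \<in> epi H K \<Longrightarrow> k \<circ> h \<in> epi G K"
proof -
  assume "h \<in> epi G H" "k \<in> epi H K"
  moreover have "(k \<circ> h) ` carrier G = k ` (h ` carrier G)" by (rule image_comp[symmetric])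
  ultimately show ?thesis unfolding epi_def using hom_compose[of h G H k K] by simp
qed

lemma iso_mon: "h \<in> iso G H \<Longrightarrow> h \<in> mon G H"
  and iso_epi: "h \<in> iso G H \<Longrightarrow> h \<in> epi G H"
  by (auto simp: iso_iff_mon_epi)

lemma mon_comm_group:
  assumes "group C" "comm_group G" "h \<in> mon C G"
  shows "comm_group C"
proof (rule group.group_comm_groupI[OF assms(1)])
  interpret C: group C by fact
  interpret G: comm_group G by fact
  have h: "h \<in> hom C G" "inj_on h (carrier C)" using monD[OF assms(3)] by auto
  fix x y assume xy: "x \<in> carrier C" "y \<in> carrier C"
  then have "h (x \<otimes>\<^bsub>C\<^esub> y) = h (y \<otimes>\<^bsub>C\<^esub> x)"
    using h by (simp add: hom_mult hom_in_carrier G.m_comm)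
  then show "x \<otimes>\<^bsub>C\<^esub> y = y \<otimes>\<^bsub>C\<^esub> x" using h(2) xy by (simp add: inj_on_eq_iff)
qed

lemma epi_comm_group:
  assumes "group Q" "comm_group G" "h \<in> epi G Q"
  shows "comm_group Q"
proof (rule group.group_comm_groupI[OF assms(1)])
  interpret G: comm_group G by fact
  have h: "h \<in> hom G Q" "h ` carrier G = carrier Q" using epiD[OF assms(3)] by auto
  fix x y assume "x \<in> carrier Q" "y \<in> carrier Q"
  then obtain a b where "x = h a" "y = h b" "a \<in> carrier G" "b \<in> carrier G"
    using h(2) by blast
  then show "x \<otimes>\<^bsub>Q\<^esub> y = y \<otimes>\<^bsub>Q\<^esub> x"
    using h(1) by (metis G.m_comm hom_mult)
qed

section \<open>Copies, quotients and extensions\<close>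

text \<open>Transport of structure. It brings quotients, whose elements are cosets, and countable
  groups built on other types back to the type on which the classes are formed.\<close>

lemma group_copy:
  fixes G :: "'c monoid" and f :: "'c \<Rightarrow> 'd"
  assumes "group G" "inj_on f (carrier G)"
  obtains G' :: "'d monoid" where "group G'" "f \<in> iso G G'"
proof -
  interpret group G by fact
  define G' where "G' = \<lparr>carrier = f ` carrier G,
    monoid.mult = \<lambda>x y. f (inv_into (carrier G) f x \<otimes>\<^bsub>G\<^esub> inv_into (carrier G) f y), one = f \<one>\<^bsub>G\<^esub>\<rparr>"
  have h: "f \<in> hom G G'"
    using assms(2) by (auto simp: hom_def G'_def)
  have "group (G'\<lparr>carrier := f ` carrier G, one := f \<one>\<^bsub>G\<^esub>\<rparr>)"
    by (rule hom_imp_img_group[OF h])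
  moreover have "G'\<lparr>carrier := f ` carrier G, one := f \<one>\<^bsub>G\<^esub>\<rparr> = G'" by (simp add: G'_def)
  ultimately have "group G'" by simp
  moreover have "f \<in> iso G G'"
    using h assms(2) by (simp add: iso_def bij_betw_def G'_def)
  ultimately show ?thesis using that by blast
qed

lemma hom_factor:
  assumes "group G" "group B" "group C" "p \<in> epi G B" "r \<in> hom G C"
    "kernel G B p \<subseteq> kernel G C r"
  obtains s where "s \<in> hom B C" "\<And>x. x \<in> carrier G \<Longrightarrow> s (p x) = r x"
proof -
  interpret p: group_hom G B p using assms epiD group_homI by blast
  interpret r: group_hom G C r using assms group_homI by blast
  have im: "p ` carrier G = carrier B" using assms epiD by blast
  define s where "s b = r (inv_into (carrier G) p b)" for b
  have eq: "r x = r y" if "x \<in> carrier G" "y \<in> carrier G" "p x = p y" for x y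
  proof -
    have "x \<otimes>\<^bsub>G\<^esub> inv\<^bsub>G\<^esub> y \<in> kernel G B p" using that by (simp add: kernel_def)
    then have "x \<otimes>\<^bsub>G\<^esub> inv\<^bsub>G\<^esub> y \<in> kernel G C r" using assms(6) by blast
    then have "r x \<otimes>\<^bsub>C\<^esub> inv\<^bsub>C\<^esub> r y = \<one>\<^bsub>C\<^esub>" using that by (simp add: kernel_def)
    then show ?thesis
      using that r.H.inv_equality[of "r x" "inv\<^bsub>C\<^esub> r y"] by simp
  qed
  have s: "s (p x) = r x" if "x \<in> carrier G" for x
  proof -
    have "p x \<in> p ` carrier G" using that by blast
    then show ?thesis unfolding s_def
      using eq[of "inv_into (carrier G) p (p x)" x] that by (simp add: inv_into_into f_inv_into_f)
  qed
  have "s \<in> hom B C"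
  proof (rule homI)
    fix x y assume "x \<in> carrier B" "y \<in> carrier B"
    then obtain a b where ab: "a \<in> carrier G" "b \<in> carrier G" "x = p a" "y = p b" using im by blast
    show "s x \<in> carrier C" using ab s by simp
    show "s (x \<otimes>\<^bsub>B\<^esub> y) = s x \<otimes>\<^bsub>C\<^esub> s y"
      using ab s s[of "a \<otimes>\<^bsub>G\<^esub> b"] by simp
  qed
  then show ?thesis using that s by blast
qed

lemma (in group_hom) normal_image:
  assumes "N \<lhd> G" "h ` carrier G = carrier H"
  shows "h ` N \<lhd> H"
proof -
  have N: "subgroup N G" using assms(1) normal_imp_subgroup by blast
  show ?thesis
    unfolding H.normal_inv_iff
  proof (intro conjI ballI)
    show "subgroup (h ` N) H" using N subgroup_img_is_subgroup by blast
    fix x y assume "x \<in> carrier H" "y \<in> h ` N"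
    then obtain g n where gn: "g \<in> carrier G" "x = h g" "n \<in> N" "y = h n"
      using assms(2) by blast
    then have "n \<in> carrier G" using N subgroup.subset by blast
    moreover have "g \<otimes> n \<otimes> inv g \<in> N" using gn assms(1) by (simp add: G.normal_inv_iff)
    ultimately show "x \<otimes>\<^bsub>H\<^esub> y \<otimes>\<^bsub>H\<^esub> inv\<^bsub>H\<^esub> x \<in> h ` N"
      using gn by (intro image_eqI[of _ _ "g \<otimes> n \<otimes> inv g"]) auto
  qed
qed

lemma (in group_hom) subgroup_preimage:
  assumes "subgroup A H"
  shows "subgroup {x \<in> carrier G. h x \<in> A} G"
proof -
  interpret A: subgroup A H by fact
  show ?thesis by unfold_locales auto
qed

lemma iso_inverse:
  assumes "group G" "f \<in> iso G H"
  obtains g where "g \<in> iso H G" "\<And>x. x \<in> carrier G \<Longrightarrow> g (f x) = x"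
  using group.iso_set_sym[OF assms] assms(2) that[of "inv_into (carrier G) f"]
  by (auto simp: iso_def bij_betw_def)

lemma coset_epi:
  assumes "N \<lhd> G" "group B" "f \<in> iso (G Mod N) B"
  shows "f \<circ> (\<lambda>a. N #>\<^bsub>G\<^esub> a) \<in> epi G B" "kernel G B (f \<circ> (\<lambda>a. N #>\<^bsub>G\<^esub> a)) = N"
proof -
  interpret N: normal N G by fact
  have Q: "group (G Mod N)" by (rule N.factorgroup_is_group)
  let ?p = "f \<circ> (\<lambda>a. N #>\<^bsub>G\<^esub> a)"
  have e: "(\<lambda>a. N #>\<^bsub>G\<^esub> a) \<in> epi G (G Mod N)"
    using N.r_coset_hom_Mod by (simp add: epi_def carrier_FactGroup)
  show "?p \<in> epi G B" by (rule epi_compose[OF e iso_epi[OF assms(3)]])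
  have f1: "f N = \<one>\<^bsub>B\<^esub>"
    using group_hom.hom_one[OF group_homI[OF Q assms(2)]] assms(3) by (simp add: iso_def)
  have inj: "inj_on f (carrier (G Mod N))" using assms(3) by (simp add: iso_def bij_betw_def)
  have "?p a = \<one>\<^bsub>B\<^esub> \<longleftrightarrow> a \<in> N" if a: "a \<in> carrier G" for a
  proof -
    have "N #>\<^bsub>G\<^esub> a \<in> carrier (G Mod N)" using e a by (auto simp: epi_def hom_def)
    moreover have "N \<in> carrier (G Mod N)"
      using Q group.is_monoid monoid.one_closed one_FactGroup by metis
    ultimately have "?p a = \<one>\<^bsub>B\<^esub> \<longleftrightarrow> N #>\<^bsub>G\<^esub> a = N"
      unfolding o_def f1[symmetric] using inj by (simp add: inj_on_eq_iff)
    also have "\<dots> \<longleftrightarrow> a \<in> N"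
      using N.coset_join1[OF _ a N.subgroup_axioms] N.rcos_const[OF N.is_group, of a] by blast
    finally show ?thesis .
  qed
  then show "kernel G B ?p = N" using N.subset by (auto simp: kernel_def)
qed

text \<open>Choosing coset representatives keeps the quotient inside the type of the group.\<close>

lemma quotient_copy:
  fixes G :: "'a monoid"
  assumes "N \<lhd> G"
  obtains B :: "'a monoid" and c where "group B" "c \<in> epi G B" "kernel G B c = N"
proof -
  interpret N: normal N G by fact
  have Q: "group (G Mod N)" by (rule N.factorgroup_is_group)
  define rep :: "'a set \<Rightarrow> 'a" where "rep = (\<lambda>Y. SOME y. y \<in> Y)"
  have rep: "rep V \<in> V" if "V \<in> carrier (G Mod N)" for V
  proof -
    have "V \<noteq> {}" using that N.rcosets_non_empty by (auto simp: FactGroup_def)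
    then show ?thesis unfolding rep_def using some_in_eq by blast
  qed
  have "inj_on rep (carrier (G Mod N))"
  proof (rule inj_onI)
    fix V Y assume XY: "V \<in> carrier (G Mod N)" "Y \<in> carrier (G Mod N)" "rep V = rep Y"
    then have "rep V \<in> V \<inter> Y" using rep by (metis IntI)
    then show "V = Y"
      using XY N.rcos_disjoint[OF N.subgroup_axioms]
      by (auto simp: FactGroup_def pairwise_def disjnt_def)
  qed
  then obtain B :: "'a monoid" where B: "group B" "rep \<in> iso (G Mod N) B" by (rule group_copy[OF Q])
  from that[OF B(1) coset_epi[OF assms B]] show ?thesis .
qed

lemma extension_ofI:
  assumes "group G" "group B" "p \<in> epi G B"
  shows "extension_of G (G\<lparr>carrier := kernel G B p\<rparr>) B"
proof -
  interpret group_hom G B p using assms epiD group_homI by blast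
  show ?thesis unfolding extension_of_def
    using normal_kernel FactGroup_iso epiD[OF assms(3)] iso_set_refl is_isoI by blast
qed

text \<open>An isomorphism preserves products only. The assumption \<open>group B\<close> makes the
  unit recorded in \<open>B\<close> the image of the normal subgroup, which is then the kernel of
  \<open>p\<close>.\<close>

lemma extension_ofE:
  assumes "extension_of G A B" "group B"
  obtains p i where "group G" "p \<in> epi G B" "i \<in> iso (G\<lparr>carrier := kernel G B p\<rparr>) A"
proof -
  obtain N i f where N: "N \<lhd> G" "i \<in> iso (G\<lparr>carrier := N\<rparr>) A" "f \<in> iso (G Mod N) B"
    using assms unfolding extension_of_def is_iso_def by blast
  then have "group G" using normal_imp_subgroup by (meson normal_def)
  from that[OF this coset_epi(1)[OF N(1) assms(2) N(3)]] N(2)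
    coset_epi(2)[OF N(1) assms(2) N(3)] show ?thesis by simp
qed

section \<open>The classes \<open>EG\<^sub>\<alpha>\<close>\<close>

lemma EG_group: "EG \<alpha> G \<Longrightarrow> group G"
proof (induction rule: EG.induct)
  case (succ_extension \<beta> A B G)
  then show ?case by (meson extension_ofE)
qed (auto simp: comm_group_def directed_union_of_def)

lemma EG_elementary_amenable: "EG \<alpha> G \<Longrightarrow> elementary_amenable G"
  by (induction rule: EG.induct) (auto intro: elementary_amenable.intros)

lemma extension_EG:
  fixes G B :: "'a monoid"
  assumes "group G" "p \<in> epi G B" "EG \<beta> (G\<lparr>carrier := kernel G B p\<rparr>)" "EG \<beta> B"
  shows "EG (osucc \<beta>) G"
  using EG.succ_extension[OF assms(3,4)] extension_ofI[OF assms(1) EG_group[OF assms(4)]] assms(2) by blast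

lemma EG_osucc: "EG \<alpha> G \<Longrightarrow> EG (osucc \<alpha>) G"
proof (rule EG.succ_directed_union[of G "{carrier G}"])
  assume G: "EG \<alpha> G"
  then show "directed_union_of G {carrier G}"
    by (simp add: EG_group directed_union_of_def group.subgroup_self)
  show "EG \<alpha> (G\<lparr>carrier := H\<rparr>)" if "H \<in> {carrier G}" for H using that G by simp
qed

lemma EG_mono:
  fixes \<alpha> \<beta> :: "'b::infinite ordinal"
  shows "EG \<beta> G \<Longrightarrow> \<beta> \<le> \<alpha> \<Longrightarrow> EG \<alpha> G"
proof (induction \<alpha> rule: less_induct)
  case (less \<alpha>)
  show ?case
  proof (cases "\<beta> = \<alpha>")
    case False
    then have lt: "\<beta> < \<alpha>" using less by simp
    show ?thesis
    proof (cases \<alpha> rule: ordinal_cases)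
      case zero
      then show ?thesis using lt ordinal_zero_le[of \<beta>] by simp
    next
      case (succ \<gamma>)
      then show ?thesis
        using less lt osucc_gt[of \<gamma>] EG_osucc[of \<gamma> G] by (simp add: less_osucc_iff)
    next
      case limit
      then show ?thesis using EG.limit lt less by blast
    qed
  qed (use less in simp)
qed

lemma EG_zero_iff: "EG (0 :: 'b::infinite ordinal) G \<longleftrightarrow> group G \<and> (finite (carrier G) \<or> comm_group G)"
  by (subst EG.simps) (auto simp: comm_group_def)

lemma EG_limitD: "EG \<alpha> G \<Longrightarrow> limit_ordinal (\<alpha> :: 'b::infinite ordinal) \<Longrightarrow> \<exists>\<beta><\<alpha>. EG \<beta> G"
  by (erule EG.cases) auto

lemma EG_osuccE:
  assumes "EG (osucc (\<alpha> :: 'b::infinite ordinal)) G"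
  obtains (extension) A B where "EG \<alpha> A" "EG \<alpha> B" "extension_of G A B"
  | (union) \<H> where "directed_union_of G \<H>" "\<And>H. H \<in> \<H> \<Longrightarrow> EG \<alpha> (G\<lparr>carrier := H\<rparr>)"
  using assms by (cases rule: EG.cases) auto

section \<open>Closure of the classes under subgroups and quotients\<close>

text \<open>Both operations pull back along \<open>h\<close>: the kernel and the image of
  \<open>p \<circ> h\<close> embed in \<open>A\<close> and \<open>B\<close>, and a directed family
  pulls back to its preimages. Monomorphisms rather than inclusions keep the induction going,
  because \<open>A\<close> is only isomorphic to the kernel.\<close>

lemma EG_mon:
  fixes G C :: "'a monoid" and \<alpha> :: "'b::infinite ordinal"
  assumes "EG \<alpha> G" "group C" "h \<in> mon C G"
  shows "EG \<alpha> C"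
  using assms
proof (induction arbitrary: C h rule: EG.induct)
  case (zero_finite G)
  then show ?case
    by (intro EG.zero_finite) (auto simp: mon_def dest!: hom_carrier intro: inj_on_finite)
next
  case (zero_abelian G)
  then show ?case by (blast intro: EG.zero_abelian mon_comm_group)
next
  case (limit \<alpha> \<beta> G)
  then show ?case by (meson EG.limit)
next
  case (succ_extension \<beta> A B G)
  have B: "group B" using succ_extension(2) by (rule EG_group)
  have G: "group G" using succ_extension(3) B by (rule extension_ofE)
  obtain p i where pi: "p \<in> epi G B" "i \<in> iso (G\<lparr>carrier := kernel G B p\<rparr>) A"
    using extension_ofE[OF succ_extension(3) B] by metis
  interpret C: group C by (rule succ_extension.prems(1))
  have h: "h \<in> hom C G" using monD[OF succ_extension.prems(2)] by blast
  define q where "q = p \<circ> h"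
  have q: "q \<in> hom C B" unfolding q_def using h epiD[OF pi(1)] by (auto intro: hom_compose)
  interpret q: group_hom C B q using q B by (simp add: group_homI)
  define B0 where "B0 = B\<lparr>carrier := q ` carrier C\<rparr>"
  have sub: "subgroup (q ` carrier C) B" by (rule q.img_is_subgroup)
  have "group B0" unfolding B0_def using sub B by (rule subgroup.subgroup_is_group)
  then have B0: "EG \<beta> B0"
    using succ_extension.IH(2)[of B0] id_mon_subgroup[OF sub] unfolding B0_def by blast
  have qe: "q \<in> epi C B0"
    using epi_restrict_image[OF q order_refl] by (simp add: B0_def)
  define K where "K = kernel C B0 q"
  have Ks: "subgroup K C"
    using q.subgroup_kernel by (simp add: K_def kernel_def B0_def)
  have "h \<in> mon (C\<lparr>carrier := K\<rparr>) (G\<lparr>carrier := kernel G B p\<rparr>)"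
    by (rule mon_restrict) (use succ_extension.prems(2) h in \<open>auto simp: K_def kernel_def B0_def q_def hom_in_carrier\<close>)
  from mon_compose[OF this iso_mon[OF pi(2)]]
  have "EG \<beta> (C\<lparr>carrier := K\<rparr>)"
    using succ_extension.IH(1) subgroup.subgroup_is_group[OF Ks C.is_group] by blast
  then show ?case
    using extension_EG[OF C.is_group qe _ B0] unfolding K_def by blast
next
  case (succ_directed_union G \<H> \<beta>)
  note du = succ_directed_union(1)[unfolded directed_union_of_def]
  interpret h: group_hom C G h
    by (rule group_homI[OF succ_directed_union.prems(1) conjunct1[OF du]])
      (rule conjunct1[OF monD[OF succ_directed_union.prems(2)]])
  define pre where "pre H = {x \<in> carrier C. h x \<in> H}" for H
  have sub: "subgroup (pre H) C" if "H \<in> \<H>" for H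
    unfolding pre_def using du that by (intro h.subgroup_preimage) blast
  have "directed_union_of C (pre ` \<H>)"
    unfolding directed_union_of_def
  proof (intro conjI ballI)
    fix H K assume "H \<in> pre ` \<H>" "K \<in> pre ` \<H>"
    then obtain H' K' where "H' \<in> \<H>" "K' \<in> \<H>" "H = pre H'" "K = pre K'" by blast
    moreover from this obtain L where "L \<in> \<H>" "H' \<subseteq> L" "K' \<subseteq> L" using du by meson
    moreover have "pre H' \<subseteq> pre L \<and> pre K' \<subseteq> pre L"
      using \<open>H' \<subseteq> L\<close> \<open>K' \<subseteq> L\<close> by (auto simp: pre_def)
    ultimately show "\<exists>L\<in>pre ` \<H>. H \<subseteq> L \<and> K \<subseteq> L" by blast
  next
    have "h x \<in> \<Union>\<H>" if "x \<in> carrier C" for x using that du h.hom_closed by blast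
    then show "carrier C = \<Union> (pre ` \<H>)" by (auto simp: pre_def)
  qed (use du sub in auto)
  moreover have "EG \<beta> (C\<lparr>carrier := K\<rparr>)" if K: "K \<in> pre ` \<H>" for K
  proof -
    obtain H where H: "H \<in> \<H>" "K = pre H" using K by blast
    have "h \<in> mon (C\<lparr>carrier := K\<rparr>) (G\<lparr>carrier := H\<rparr>)"
      by (rule mon_restrict) (use succ_directed_union.prems(2) H in \<open>auto simp: pre_def\<close>)
    then show ?thesis
      using succ_directed_union.IH H subgroup.subgroup_is_group[OF sub[OF H(1)]] by blast
  qed
  ultimately show ?case by (rule EG.succ_directed_union)
qed

lemma EG_subgroup:
  fixes \<alpha> :: "'b::infinite ordinal"
  shows "EG \<alpha> G \<Longrightarrow> subgroup H G \<Longrightarrow> EG \<alpha> (G\<lparr>carrier := H\<rparr>)"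
  using EG_mon[of \<alpha> G "G\<lparr>carrier := H\<rparr>"] EG_group id_mon_subgroup subgroup.subgroup_is_group by blast

text \<open>In an extension with kernel \<open>N\<close>, the image of \<open>N\<close> under
  \<open>r\<close> is normal in \<open>Q\<close> and is a quotient of \<open>A\<close>, while
  \<open>Q\<close> modulo this image is a quotient of \<open>B\<close>. Directed families are pushed
  forward.\<close>

lemma EG_epi:
  fixes G Q :: "'a monoid" and \<alpha> :: "'b::infinite ordinal"
  assumes "EG \<alpha> G" "group Q" "r \<in> epi G Q"
  shows "EG \<alpha> Q"
  using assms
proof (induction arbitrary: Q r rule: EG.induct)
  case (zero_finite G)
  then show ?case by (metis EG.zero_finite epiD finite_imageI)
next
  case (zero_abelian G)
  then show ?case by (blast intro: EG.zero_abelian epi_comm_group)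
next
  case (limit \<alpha> \<beta> G)
  then show ?case by (meson EG.limit)
next
  case (succ_extension \<beta> A B G)
  have B: "group B" using succ_extension(2) by (rule EG_group)
  have G: "group G" using succ_extension(3) B by (rule extension_ofE)
  obtain p i where pi: "p \<in> epi G B" "i \<in> iso (G\<lparr>carrier := kernel G B p\<rparr>) A"
    using extension_ofE[OF succ_extension(3) B] by metis
  define N where "N = kernel G B p"
  interpret p: group_hom G B p using G B epiD[OF pi(1)] by (simp add: group_homI)
  interpret r: group_hom G Q r
    by (rule group_homI[OF G succ_extension.prems(1)]) (rule conjunct1[OF epiD[OF succ_extension.prems(2)]])
  have N: "N \<lhd> G" "subgroup N G" using p.normal_kernel p.subgroup_kernel by (simp_all add: N_def)
  have rs: "r ` carrier G = carrier Q" using epiD[OF succ_extension.prems(2)] by blast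
  have M: "r ` N \<lhd> Q" "subgroup (r ` N) Q"
    using r.normal_image[OF N(1) rs] normal_imp_subgroup by blast+
  obtain C :: "'a monoid" and c where C: "group C" "c \<in> epi Q C" "kernel Q C c = r ` N"
    using quotient_copy[OF M(1)] by metis
  have cr: "c \<circ> r \<in> epi G C" by (rule epi_compose[OF succ_extension.prems(2) C(2)])
  \<comment> \<open>Since \<open>c\<close> kills the image of \<open>N\<close>, the map
    \<open>c \<circ> r\<close> factors through \<open>p\<close>, which exhibits \<open>C\<close> as
    a quotient of \<open>B\<close>.\<close>
  have "kernel G B p \<subseteq> kernel G C (c \<circ> r)"
    using C(3) by (fastforce simp: kernel_def N_def)
  then obtain s where s: "s \<in> hom B C" "\<And>x. x \<in> carrier G \<Longrightarrow> s (p x) = (c \<circ> r) x"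
    using hom_factor[OF G B C(1) pi(1), of "c \<circ> r"] epiD[OF cr] by metis
  have "s ` carrier B = s ` p ` carrier G" using epiD[OF pi(1)] by simp
  also have "\<dots> = (c \<circ> r) ` carrier G" using s(2) by (auto simp: image_iff)
  finally have "s \<in> epi B C" using s(1) epiD[OF cr] by (simp add: epi_def)
  then have EC: "EG \<beta> C" using succ_extension.IH(2) C(1) by blast
  have re: "r \<in> epi (G\<lparr>carrier := N\<rparr>) (Q\<lparr>carrier := r ` N\<rparr>)"
    by (rule epi_restrict_image[OF r.homh subgroup.subset[OF N(2)]])
  obtain j where j: "j \<in> iso A (G\<lparr>carrier := N\<rparr>)"
    using iso_inverse[OF subgroup.subgroup_is_group[OF N(2) G] pi(2)[folded N_def]] .
  have "r \<circ> j \<in> epi A (Q\<lparr>carrier := r ` N\<rparr>)" by (rule epi_compose[OF iso_epi[OF j] re])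
  then have "EG \<beta> (Q\<lparr>carrier := kernel Q C c\<rparr>)"
    unfolding C(3)
    by (rule succ_extension.IH(1)[OF subgroup.subgroup_is_group[OF M(2) succ_extension.prems(1)]])
  then show ?case using extension_EG[OF succ_extension.prems(1) C(2) _ EC] by blast
next
  case (succ_directed_union G \<H> \<beta>)
  note du = succ_directed_union(1)[unfolded directed_union_of_def]
  interpret r: group_hom G Q r
    by (rule group_homI[OF conjunct1[OF du] succ_directed_union.prems(1)])
      (rule conjunct1[OF epiD[OF succ_directed_union.prems(2)]])
  have sub: "subgroup (r ` H) Q" if "H \<in> \<H>" for H
    using that du r.subgroup_img_is_subgroup by blast
  have "directed_union_of Q ((`) r ` \<H>)"
    unfolding directed_union_of_def
  proof (intro conjI ballI)
    fix H K assume "H \<in> (`) r ` \<H>" "K \<in> (`) r ` \<H>"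
    then obtain H' K' where *: "H' \<in> \<H>" "K' \<in> \<H>" "H = r ` H'" "K = r ` K'" by blast
    then obtain L where "L \<in> \<H>" "H' \<subseteq> L" "K' \<subseteq> L" using du by meson
    then show "\<exists>L\<in>(`) r ` \<H>. H \<subseteq> L \<and> K \<subseteq> L" using * by blast
  next
    have "carrier Q = r ` \<Union>\<H>" using du epiD[OF succ_directed_union.prems(2)] by metis
    then show "carrier Q = \<Union> ((`) r ` \<H>)" by blast
  qed (use du sub succ_directed_union.prems(1) in auto)
  moreover have "EG \<beta> (Q\<lparr>carrier := K\<rparr>)" if K: "K \<in> (`) r ` \<H>" for K
  proof -
    obtain H where H: "H \<in> \<H>" "K = r ` H" using K by blast
    then have "r \<in> epi (G\<lparr>carrier := H\<rparr>) (Q\<lparr>carrier := K\<rparr>)"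
      using du r.homh H by (metis epi_restrict_image subgroup.subset)
    then show ?thesis
      unfolding H(2)
      by (rule succ_directed_union.IH[OF H(1) subgroup.subgroup_is_group[OF sub[OF H(1)]
        succ_directed_union.prems(1)]])
  qed
  ultimately show ?case by (rule EG.succ_directed_union)
qed

lemma extension_EG_max:
  fixes G B :: "'a monoid" and \<beta> \<gamma> :: "'b::infinite ordinal"
  assumes "group G" "p \<in> epi G B" "EG \<beta> (G\<lparr>carrier := kernel G B p\<rparr>)" "EG \<gamma> B"
  shows "EG (osucc (max \<beta> \<gamma>)) G"
  by (rule extension_EG[OF assms(1,2) EG_mono[OF assms(3)] EG_mono[OF assms(4)]]) simp_all

text \<open>
  Closure under subgroups makes the finitely generated subgroups of \<open>G\<close> a canonical directed
  family, small enough to keep suprema below \<open>\<omega>\<^sub>1\<close>.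
\<close>

lemma directed_union_of_finitely_generated:
  assumes "group G"
  shows "directed_union_of G {generate G S |S. finite S \<and> S \<subseteq> carrier G}"
proof -
  interpret group G by fact
  show ?thesis
    unfolding directed_union_of_def
  proof (intro conjI ballI)
    fix H K
    assume "H \<in> {generate G S |S. finite S \<and> S \<subseteq> carrier G}"
      "K \<in> {generate G S |S. finite S \<and> S \<subseteq> carrier G}"
    then obtain S T where "H = generate G S" "K = generate G T" "finite S" "finite T"
      "S \<subseteq> carrier G" "T \<subseteq> carrier G" by blast
    then show "\<exists>L\<in>{generate G S |S. finite S \<and> S \<subseteq> carrier G}. H \<subseteq> L \<and> K \<subseteq> L"
      by (intro bexI[of _ "generate G (S \<union> T)"]) (auto intro!: mono_generate exI[of _ "S \<union> T"] dest: subsetD[OF mono_generate, rotated])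
  next
    have "x \<in> generate G {x}" for x by (rule generate.incl) simp
    then show "carrier G = \<Union> {generate G S |S. finite S \<and> S \<subseteq> carrier G}"
      using generate_incl by (auto intro!: exI[of _ "{_}"])
  qed (auto simp: generate_is_subgroup)
qed

lemma countable_generate:
  assumes "countable S"
  shows "countable (generate G S)"
proof -
  \<comment> \<open>Stage \<open>n\<close> holds the products of nesting depth at most
    \<open>n\<close>. The stages increase, so any two factors already occur in a common
    stage.\<close>
  define f where "f = rec_nat (insert \<one>\<^bsub>G\<^esub> (S \<union> m_inv G ` S))
    (\<lambda>_ A. A \<union> (\<lambda>(x, y). x \<otimes>\<^bsub>G\<^esub> y) ` (A \<times> A))"
  have f0: "f 0 = insert \<one>\<^bsub>G\<^esub> (S \<union> m_inv G ` S)"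
    and fS: "f (Suc n) = f n \<union> (\<lambda>(x, y). x \<otimes>\<^bsub>G\<^esub> y) ` (f n \<times> f n)" for n
    by (simp_all add: f_def)
  have "countable (f n)" for n
    by (induction n) (use assms in \<open>auto simp: f0 fS\<close>)
  then have c: "countable (\<Union>n. f n)" by blast
  have mono: "f m \<subseteq> f n" if "m \<le> n" for m n
    using that by (rule lift_Suc_mono_le[of f, rotated]) (simp add: fS)
  have "generate G S \<subseteq> (\<Union>n. f n)"
  proof
    fix x assume "x \<in> generate G S"
    then show "x \<in> (\<Union>n. f n)"
    proof induction
      case (eng x y)
      then obtain m n where "x \<in> f m" "y \<in> f n" by blast
      then have "x \<in> f (max m n)" "y \<in> f (max m n)" using mono by (meson max.cobounded1 max.cobounded2 subsetD)+
      then have "x \<otimes>\<^bsub>G\<^esub> y \<in> f (Suc (max m n))" unfolding fS by blast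
      then show ?case by blast
    qed (auto intro!: exI[of _ 0] simp: f0)
  qed
  with c show ?thesis by (rule countable_subset[rotated])
qed

section \<open>Countable elementary amenable groups\<close>

lemma directed_union_finite_subset:
  assumes "directed_union_of G \<H>" "finite S" "S \<subseteq> carrier G"
  shows "\<exists>H\<in>\<H>. S \<subseteq> H"
  using assms(2,3)
proof (induction S rule: finite_induct)
  case empty
  then show ?case using assms(1) by (auto simp: directed_union_of_def)
next
  case (insert x S)
  then obtain H where H: "H \<in> \<H>" "S \<subseteq> H" by auto
  obtain K where K: "K \<in> \<H>" "x \<in> K" using insert.prems assms(1) by (auto simp: directed_union_of_def)
  obtain L where "L \<in> \<H>" "H \<subseteq> L" "K \<subseteq> L"
    using assms(1) H(1) K(1) unfolding directed_union_of_def by meson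
  then show ?case using H K by blast
qed

lemma elementary_amenable_group: "elementary_amenable G \<Longrightarrow> group G"
proof (induction rule: elementary_amenable.induct)
  case (extension A B G)
  then show ?case by (meson extension_ofE)
qed (auto simp: comm_group_def directed_union_of_def dest: subgroup.subgroup_is_group)

text \<open>The rules may pass through uncountable groups before reaching a countable one, so the
  induction speaks of every countable \<open>C\<close> that embeds in \<open>G\<close>. This makes
  the subgroup rule immediate; the extension rule is split as in \<open>EG_mon\<close>.\<close>

lemma countable_EG:
  fixes G C :: "'a::infinite monoid"
  assumes "elementary_amenable G" "group C" "countable (carrier C)" "h \<in> mon C G"
  shows "\<exists>\<alpha> < (omega1 :: 'a set ordinal). EG \<alpha> C"
  using assms
proof (induction arbitrary: C h rule: elementary_amenable.induct)
  case (finite G)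
  then have "EG (0 :: 'a set ordinal) C" by (meson EG_mon EG.zero_finite)
  then show ?case using zero_less_omega1 by blast
next
  case (abelian G)
  then have "EG (0 :: 'a set ordinal) C" by (meson EG_mon EG.zero_abelian)
  then show ?case using zero_less_omega1 by blast
next
  case (subgroup G H)
  have "(\<lambda>x. x) \<circ> h \<in> mon C G"
    by (rule mon_compose[OF subgroup.prems(3) id_mon_subgroup[OF subgroup.hyps(2)]])
  then show ?case using subgroup.IH subgroup.prems(1,2) by blast
next
  case (quotient G N Q)
  obtain f where f: "f \<in> iso (G Mod N) Q" using quotient.hyps(4) by (auto simp: is_iso_def)
  obtain p where p: "p \<in> epi G Q" using coset_epi(1)[OF quotient.hyps(2,3) f] by blast
  have G: "group G" using quotient.hyps(2) by (simp add: normal_def)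
  interpret p: group_hom G Q p by (rule group_homI[OF G quotient.hyps(3) conjunct1[OF epiD[OF p]]])
  interpret h: group_hom C Q h
    by (rule group_homI[OF quotient.prems(1) quotient.hyps(3) conjunct1[OF monD[OF quotient.prems(3)]]])
  have sur: "p ` carrier G = carrier Q" using epiD[OF p] by blast
  \<comment> \<open>One preimage for each element keeps the generated subgroup \<open>D\<close>
    countable. Since the image of \<open>C\<close> is a subgroup, the image of \<open>D\<close> is
    exactly that subgroup.\<close>
  define S where "S = inv_into (carrier G) p ` h ` carrier C"
  have hC: "h ` carrier C \<subseteq> carrier Q" by auto
  have pS: "p ` S = h ` carrier C"
    unfolding S_def using image_inv_into_cancel[OF sur hC] .
  have SG: "S \<subseteq> carrier G"
    unfolding S_def using hC sur by (auto intro!: inv_into_into)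
  define D where "D = generate G S"
  have D: "subgroup D G" unfolding D_def by (rule p.G.generate_is_subgroup[OF SG])
  have "countable S" unfolding S_def using quotient.prems(2) by simp
  then have "countable D" unfolding D_def by (rule countable_generate)
  then obtain \<alpha> where \<alpha>: "\<alpha> < (omega1 :: 'a set ordinal)" "EG \<alpha> (G\<lparr>carrier := D\<rparr>)"
    using quotient.IH[OF subgroup.subgroup_is_group[OF D G] _ id_mon_subgroup[OF D]] by auto
  have hs: "subgroup (h ` carrier C) Q" by (rule h.img_is_subgroup)
  have "p ` D = generate Q (h ` carrier C)"
    unfolding D_def using p.generate_img[OF SG] pS by simp
  also have "\<dots> = h ` carrier C"
    by (rule equalityI[OF p.H.generate_subgroup_incl[OF order_refl hs]]) (auto intro: generate.incl)
  finally have pD: "p ` D = h ` carrier C" .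
  have "p \<in> epi (G\<lparr>carrier := D\<rparr>) (Q\<lparr>carrier := h ` carrier C\<rparr>)"
    using epi_restrict_image[OF p.homh subgroup.subset[OF D]] unfolding pD .
  then have EQ: "EG \<alpha> (Q\<lparr>carrier := h ` carrier C\<rparr>)"
    using EG_epi[OF \<alpha>(2) subgroup.subgroup_is_group[OF hs quotient.hyps(3)]] by blast
  have "h \<in> mon C (Q\<lparr>carrier := h ` carrier C\<rparr>)"
    using mon_restrict[OF quotient.prems(3) order_refl order_refl] by simp
  then have "EG \<alpha> C" by (rule EG_mon[OF EQ quotient.prems(1)])
  then show ?case using \<alpha>(1) by blast
next
  case (extension A B G)
  have B: "group B" using extension.hyps(2) by (rule elementary_amenable_group)
  obtain p i where G: "group G" and pi: "p \<in> epi G B" "i \<in> iso (G\<lparr>carrier := kernel G B p\<rparr>) A"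
    using extension_ofE[OF extension.hyps(3) B] by metis
  interpret C: group C by (rule extension.prems(1))
  have h: "h \<in> hom C G" using monD[OF extension.prems(3)] by blast
  define q where "q = p \<circ> h"
  have q: "q \<in> hom C B" unfolding q_def using h epiD[OF pi(1)] by (auto intro: hom_compose)
  interpret q: group_hom C B q using q B by (simp add: group_homI)
  define B0 where "B0 = B\<lparr>carrier := q ` carrier C\<rparr>"
  have sub: "subgroup (q ` carrier C) B" by (rule q.img_is_subgroup)
  have gB0: "group B0" unfolding B0_def using sub B by (rule subgroup.subgroup_is_group)
  have "countable (carrier B0)" using extension.prems(2) by (simp add: B0_def)
  then obtain \<beta> where B0: "\<beta> < (omega1 :: 'a set ordinal)" "EG \<beta> B0"
    using extension.IH(2)[OF gB0] id_mon_subgroup[OF sub] unfolding B0_def by blast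
  have qe: "q \<in> epi C B0"
    using epi_restrict_image[OF q order_refl] by (simp add: B0_def)
  define K where "K = kernel C B0 q"
  have Ks: "subgroup K C"
    using q.subgroup_kernel by (simp add: K_def kernel_def B0_def)
  have "h \<in> mon (C\<lparr>carrier := K\<rparr>) (G\<lparr>carrier := kernel G B p\<rparr>)"
    by (rule mon_restrict) (use extension.prems(3) h in \<open>auto simp: K_def kernel_def B0_def q_def hom_in_carrier\<close>)
  from mon_compose[OF this iso_mon[OF pi(2)]]
  have "i \<circ> h \<in> mon (C\<lparr>carrier := K\<rparr>) A" .
  moreover have "countable K"
    using extension.prems(2) subgroup.subset[OF Ks] countable_subset by blast
  ultimately obtain \<alpha> where \<alpha>: "\<alpha> < (omega1 :: 'a set ordinal)" "EG \<alpha> (C\<lparr>carrier := K\<rparr>)"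
    using extension.IH(1)[OF subgroup.subgroup_is_group[OF Ks C.is_group]] by auto
  have "EG (osucc (max \<alpha> \<beta>)) C"
    using extension_EG_max[OF C.is_group qe _ B0(2)] \<alpha>(2) unfolding K_def by blast
  moreover have "osucc (max \<alpha> \<beta>) < omega1" using \<alpha>(1) B0(1) by (intro osucc_less_omega1) simp
  ultimately show ?case by blast
next
  case (directed_union G \<H>)
  interpret C: group C by (rule directed_union.prems(1))
  have G: "group G" using directed_union.hyps(1) by (simp add: directed_union_of_def)
  interpret h: group_hom C G h
    by (rule group_homI[OF C.is_group G conjunct1[OF monD[OF directed_union.prems(3)]]])
  define \<F> where "\<F> = {S. finite S \<and> S \<subseteq> carrier C}"
  have "countable \<F>"
    using countable_Collect_finite_subset[OF directed_union.prems(2)] by (simp add: \<F>_def conj_commute)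
  have "\<exists>\<alpha> < (omega1 :: 'a set ordinal). EG \<alpha> (C\<lparr>carrier := generate C S\<rparr>)" if S: "S \<in> \<F>" for S
  proof -
    have S': "finite S" "S \<subseteq> carrier C" using S by (auto simp: \<F>_def)
    then have "h ` S \<subseteq> carrier G" by auto
    \<comment> \<open>A single \<open>H\<close> contains the image of the finite set and hence of
      the subgroup it generates, so the induction hypothesis for \<open>H\<close> applies to that
      subgroup.\<close>
    then obtain H where H: "H \<in> \<H>" "h ` S \<subseteq> H"
      using directed_union_finite_subset[OF directed_union.hyps(1), of "h ` S"] S'(1) by blast
    have sH: "subgroup H G" using H(1) directed_union.hyps(1) by (simp add: directed_union_of_def)
    have D: "subgroup (generate C S) C" by (rule C.generate_is_subgroup[OF S'(2)])
    have "h ` generate C S \<subseteq> H"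
      using h.generate_img[OF S'(2)] h.H.generate_subgroup_incl[OF H(2) sH] by simp
    then have "h \<in> mon (C\<lparr>carrier := generate C S\<rparr>) (G\<lparr>carrier := H\<rparr>)"
      by (rule mon_restrict[OF directed_union.prems(3) subgroup.subset[OF D]])
    moreover have "countable (generate C S)" by (intro countable_generate countable_finite S'(1))
    ultimately show ?thesis
      using directed_union.IH[OF H(1) subgroup.subgroup_is_group[OF D C.is_group]] by auto
  qed
  then obtain a where a: "\<And>S. S \<in> \<F> \<Longrightarrow> a S < (omega1 :: 'a set ordinal)"
      "\<And>S. S \<in> \<F> \<Longrightarrow> EG (a S) (C\<lparr>carrier := generate C S\<rparr>)" by metis
  obtain \<gamma> where \<gamma>: "\<gamma> < (omega1 :: 'a set ordinal)" "\<And>\<alpha>. \<alpha> \<in> a ` \<F> \<Longrightarrow> \<alpha> \<le> \<gamma>"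
    using countable_bounded_omega1[of "a ` \<F>"] \<open>countable \<F>\<close> a(1) by auto
  have "EG (osucc \<gamma>) C"
  proof (rule EG.succ_directed_union[OF directed_union_of_finitely_generated[OF C.is_group]])
    fix H assume "H \<in> {generate C S |S. finite S \<and> S \<subseteq> carrier C}"
    then obtain S where S: "S \<in> \<F>" "H = generate C S" by (auto simp: \<F>_def)
    then show "EG \<gamma> (C\<lparr>carrier := H\<rparr>)" using EG_mono[OF a(2)] \<gamma>(2) by blast
  qed
  then show ?case using \<gamma>(1) osucc_less_omega1 by blast
qed

lemma finitely_generated_countable:
  "finitely_generated G \<Longrightarrow> countable (carrier G)"
  unfolding finitely_generated_def by (metis countable_finite countable_generate)

section \<open>Finitely generated groups in successor classes\<close>

text \<open>A finite generating set lies in one member of a directed union, and that member is then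
  the whole group. So a finitely generated group that is new at a successor step comes from an
  extension.\<close>

lemma EG_osucc_fg:
  fixes \<alpha> :: "'b::infinite ordinal"
  assumes "EG (osucc \<alpha>) G" "finitely_generated G"
  shows "EG \<alpha> G \<or> (\<exists>A B. EG \<alpha> A \<and> EG \<alpha> B \<and> extension_of G A B)"
  using assms(1)
proof (cases rule: EG_osuccE)
  case (union \<H>)
  obtain S where S: "finite S" "S \<subseteq> carrier G" "generate G S = carrier G"
    using assms(2) by (auto simp: finitely_generated_def)
  then obtain H where H: "H \<in> \<H>" "S \<subseteq> H"
    using directed_union_finite_subset[OF union(1)] by blast
  have "group G" "subgroup H G" using H union(1) by (auto simp: directed_union_of_def)
  then have "H = carrier G"
    using S(3) group.generate_subgroup_incl[OF _ H(2)] subgroup.subset by blast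
  then show ?thesis using union(2)[OF H(1)] by simp
qed blast

text \<open>Needed again in \<open>sum_embeds_limit\<close>, where it keeps finite sums inside a
  limit class.\<close>

lemma extension_EG_limit:
  fixes \<alpha> :: "'b::infinite ordinal"
  assumes "limit_ordinal \<alpha>" "EG \<alpha> A" "EG \<alpha> B" "extension_of G A B"
  shows "EG \<alpha> G"
proof -
  obtain \<beta> \<gamma> where bc: "\<beta> < \<alpha>" "EG \<beta> A" "\<gamma> < \<alpha>" "EG \<gamma> B"
    using assms EG_limitD by metis
  then have "EG (osucc (max \<beta> \<gamma>)) G"
    using EG.succ_extension[OF EG_mono[OF bc(2)] EG_mono[OF bc(4)] assms(4), of "max \<beta> \<gamma>"] by simp
  moreover have "osucc (max \<beta> \<gamma>) < \<alpha>" using limit_osucc_less[OF assms(1)] bc by simp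
  ultimately show ?thesis using EG.limit assms(1) by blast
qed

lemma EG_osucc_limit_fg:
  fixes \<alpha> :: "'b::infinite ordinal"
  assumes "limit_ordinal \<alpha>" "EG (osucc \<alpha>) G" "finitely_generated G"
  shows "EG \<alpha> G"
  using EG_osucc_fg[OF assms(2,3)] extension_EG_limit[OF assms(1)] by blast

section \<open>Metabelian quotients\<close>

lemma comm_groupI_commutators:
  assumes "group G"
    "\<And>x y. x \<in> carrier G \<Longrightarrow> y \<in> carrier G \<Longrightarrow>
      x \<otimes>\<^bsub>G\<^esub> y \<otimes>\<^bsub>G\<^esub> inv\<^bsub>G\<^esub> x \<otimes>\<^bsub>G\<^esub> inv\<^bsub>G\<^esub> y = \<one>\<^bsub>G\<^esub>"
  shows "comm_group G"
proof (rule group.group_comm_groupI[OF assms(1)])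
  interpret group G by fact
  fix x y assume xy: "x \<in> carrier G" "y \<in> carrier G"
  have "x \<otimes>\<^bsub>G\<^esub> y \<otimes>\<^bsub>G\<^esub> inv\<^bsub>G\<^esub> (y \<otimes>\<^bsub>G\<^esub> x) = \<one>\<^bsub>G\<^esub>"
    using assms(2)[OF xy] xy by (simp add: inv_mult_group m_assoc)
  then show "x \<otimes>\<^bsub>G\<^esub> y = y \<otimes>\<^bsub>G\<^esub> x"
    using xy inv_equality[of "x \<otimes>\<^bsub>G\<^esub> y" "inv\<^bsub>G\<^esub> (y \<otimes>\<^bsub>G\<^esub> x)"] by simp
qed

lemma commutator_in_derived:
  "x \<in> H \<Longrightarrow> y \<in> H \<Longrightarrow> x \<otimes>\<^bsub>G\<^esub> y \<otimes>\<^bsub>G\<^esub> inv\<^bsub>G\<^esub> x \<otimes>\<^bsub>G\<^esub> inv\<^bsub>G\<^esub> y \<in> derived G H"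
  unfolding derived_def by (rule generate.incl) blast

text \<open>The quotient by the derived subgroup is abelian and so lies in every class; only the
  kernel has to be bounded.\<close>

lemma EG_derived:
  fixes G :: "'a monoid" and \<beta> :: "'b::infinite ordinal"
  assumes "group G" "EG \<beta> (G\<lparr>carrier := derived G (carrier G)\<rparr>)"
  shows "EG (osucc \<beta>) G"
proof -
  interpret group G by fact
  have N: "derived G (carrier G) \<lhd> G" by (rule derived_is_normal[OF normal_self])
  obtain B :: "'a monoid" and c where B: "group B" "c \<in> epi G B" "kernel G B c = derived G (carrier G)"
    using quotient_copy[OF N] by metis
  interpret c: group_hom G B c by (rule group_homI[OF is_group B(1) conjunct1[OF epiD[OF B(2)]]])
  have "comm_group B"
  proof (rule comm_groupI_commutators[OF B(1)])
    fix x y assume "x \<in> carrier B" "y \<in> carrier B"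
    then obtain a b where ab: "a \<in> carrier G" "b \<in> carrier G" "x = c a" "y = c b"
      using epiD[OF B(2)] by blast
    have "a \<otimes>\<^bsub>G\<^esub> b \<otimes>\<^bsub>G\<^esub> inv\<^bsub>G\<^esub> a \<otimes>\<^bsub>G\<^esub> inv\<^bsub>G\<^esub> b \<in> kernel G B c"
      unfolding B(3) using ab by (intro commutator_in_derived)
    then show "x \<otimes>\<^bsub>B\<^esub> y \<otimes>\<^bsub>B\<^esub> inv\<^bsub>B\<^esub> x \<otimes>\<^bsub>B\<^esub> inv\<^bsub>B\<^esub> y = \<one>\<^bsub>B\<^esub>"
      using ab by (simp add: kernel_def)
  qed
  then have "EG \<beta> B" using EG_mono[OF EG.zero_abelian ordinal_zero_le] by blast
  then show ?thesis using extension_EG[OF is_group B(2)] assms(2) B(3) by simp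
qed

text \<open>The quotient is metabelian, hence in \<open>EG (osucc 0)\<close> by
  \<open>EG_derived\<close>; this is the source of the bound
  \<open>osucc 0 \<le> \<beta>\<close>.\<close>

lemma EG_derived2:
  fixes G :: "'a monoid" and \<beta> :: "'b::infinite ordinal"
  assumes "group G" "EG \<beta> (G\<lparr>carrier := derived G (derived G (carrier G))\<rparr>)" "osucc 0 \<le> \<beta>"
  shows "EG (osucc \<beta>) G"
proof -
  interpret group G by fact
  let ?N = "derived G (derived G (carrier G))"
  have N: "?N \<lhd> G" by (intro derived_is_normal normal_self)
  obtain B :: "'a monoid" and c where B: "group B" "c \<in> epi G B" "kernel G B c = ?N"
    using quotient_copy[OF N] by metis
  interpret c: group_hom G B c by (rule group_homI[OF is_group B(1) conjunct1[OF epiD[OF B(2)]]])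
  have D: "derived B (carrier B) = c ` derived G (carrier G)"
    using c.derived_img[of "carrier G"] epiD[OF B(2)] by simp
  have Ds: "subgroup (derived B (carrier B)) B" by (rule c.H.derived_is_subgroup) simp
  have "comm_group (B\<lparr>carrier := derived B (carrier B)\<rparr>)"
  proof (rule group.group_comm_groupI[OF subgroup.subgroup_is_group[OF Ds B(1)]], simp)
    fix x y assume "x \<in> derived B (carrier B)" "y \<in> derived B (carrier B)"
    then obtain a b where ab: "a \<in> derived G (carrier G)" "b \<in> derived G (carrier G)" "x = c a" "y = c b"
      unfolding D by blast
    have ab': "a \<in> carrier G" "b \<in> carrier G" using ab derived_in_carrier[of "carrier G"] by auto
    have "a \<otimes>\<^bsub>G\<^esub> b \<otimes>\<^bsub>G\<^esub> inv\<^bsub>G\<^esub> a \<otimes>\<^bsub>G\<^esub> inv\<^bsub>G\<^esub> b \<in> kernel G B c"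
      unfolding B(3) using ab by (intro commutator_in_derived)
    then have "c a \<otimes>\<^bsub>B\<^esub> c b \<otimes>\<^bsub>B\<^esub> inv\<^bsub>B\<^esub> (c b \<otimes>\<^bsub>B\<^esub> c a) = \<one>\<^bsub>B\<^esub>"
      using ab' by (simp add: kernel_def c.H.inv_mult_group c.H.m_assoc)
    then show "x \<otimes>\<^bsub>B\<^esub> y = y \<otimes>\<^bsub>B\<^esub> x"
      using ab ab' c.H.inv_equality[of "c a \<otimes>\<^bsub>B\<^esub> c b" "inv\<^bsub>B\<^esub> (c b \<otimes>\<^bsub>B\<^esub> c a)"] by simp
  qed
  then have "EG (osucc (0 :: 'b ordinal)) B" using EG_derived[OF B(1) EG.zero_abelian] by blast
  then have "EG \<beta> B" using EG_mono assms(3) by blast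
  then show ?thesis using extension_EG[OF is_group B(2)] assms(2) B(3) by simp
qed

section \<open>Embeddings into direct sums\<close>

text \<open>
  The maps \<open>\<phi>\<close> with \<open>(\<phi>, P) \<in> \<Phi>\<close> are the coordinates of an embedding of \<open>H\<close> into the restricted
  direct sum of the groups \<open>P\<close>.
\<close>

definition coordinates :: "'h monoid \<Rightarrow> ('p monoid \<Rightarrow> bool) \<Rightarrow> (('h \<Rightarrow> 'p) \<times> 'p monoid) set \<Rightarrow> bool" where
  "coordinates H C \<Phi> \<longleftrightarrow>
     (\<forall>(\<phi>, P) \<in> \<Phi>. C P \<and> group P \<and> \<phi> \<in> hom H P) \<and>
     (\<forall>x \<in> carrier H. finite {(\<phi>, P) \<in> \<Phi>. \<phi> x \<noteq> \<one>\<^bsub>P\<^esub>}) \<and>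
     (\<forall>x \<in> carrier H. (\<forall>(\<phi>, P) \<in> \<Phi>. \<phi> x = \<one>\<^bsub>P\<^esub>) \<longrightarrow> x = \<one>\<^bsub>H\<^esub>)"

definition sum_embeds :: "'h monoid \<Rightarrow> ('p monoid \<Rightarrow> bool) \<Rightarrow> bool" where
  "sum_embeds H C \<longleftrightarrow> (\<exists>\<Phi>. coordinates H C \<Phi>)"

lemma coordinatesD:
  assumes "coordinates H C \<Phi>"
  shows "\<And>\<phi> P. (\<phi>, P) \<in> \<Phi> \<Longrightarrow> C P" "\<And>\<phi> P. (\<phi>, P) \<in> \<Phi> \<Longrightarrow> group P"
    "\<And>\<phi> P. (\<phi>, P) \<in> \<Phi> \<Longrightarrow> \<phi> \<in> hom H P"
    "\<And>x. x \<in> carrier H \<Longrightarrow> finite {(\<phi>, P) \<in> \<Phi>. \<phi> x \<noteq> \<one>\<^bsub>P\<^esub>}"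
    "\<And>x. x \<in> carrier H \<Longrightarrow> (\<And>\<phi> P. (\<phi>, P) \<in> \<Phi> \<Longrightarrow> \<phi> x = \<one>\<^bsub>P\<^esub>) \<Longrightarrow> x = \<one>\<^bsub>H\<^esub>"
  using assms unfolding coordinates_def by blast+

lemma sum_embedsI:
  assumes "\<And>\<phi> P. (\<phi>, P) \<in> \<Phi> \<Longrightarrow> C P" "\<And>\<phi> P. (\<phi>, P) \<in> \<Phi> \<Longrightarrow> group P"
    "\<And>\<phi> P. (\<phi>, P) \<in> \<Phi> \<Longrightarrow> \<phi> \<in> hom H P"
    "\<And>x. x \<in> carrier H \<Longrightarrow> finite {(\<phi>, P) \<in> \<Phi>. \<phi> x \<noteq> \<one>\<^bsub>P\<^esub>}"
    "\<And>x. x \<in> carrier H \<Longrightarrow> (\<And>\<phi> P. (\<phi>, P) \<in> \<Phi> \<Longrightarrow> \<phi> x = \<one>\<^bsub>P\<^esub>) \<Longrightarrow> x = \<one>\<^bsub>H\<^esub>"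
  shows "sum_embeds H C"
  unfolding sum_embeds_def coordinates_def
proof (intro exI[of _ \<Phi>] conjI ballI impI)
  fix x assume "x \<in> carrier H" "\<forall>(\<phi>, P) \<in> \<Phi>. \<phi> x = \<one>\<^bsub>P\<^esub>"
  then show "x = \<one>\<^bsub>H\<^esub>" using assms(5)[of x] by blast
qed (use assms in auto)

lemma sum_embeds_mon:
  assumes "group G" "group H" "C G" "h \<in> mon H G"
  shows "sum_embeds H C"
proof (rule sum_embedsI[of "{(h, G)}"])
  interpret h: group_hom H G h by (rule group_homI[OF assms(2,1) conjunct1[OF monD[OF assms(4)]]])
  fix x assume x: "x \<in> carrier H" "\<And>\<phi> P. (\<phi>, P) \<in> {(h, G)} \<Longrightarrow> \<phi> x = \<one>\<^bsub>P\<^esub>"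
  then have "h x = h \<one>\<^bsub>H\<^esub>" by simp
  then show "x = \<one>\<^bsub>H\<^esub>" using inj_onD[OF conjunct2[OF monD[OF assms(4)]]] x(1) by blast
next
  fix x show "finite {(\<phi>, P) \<in> {(h, G)}. \<phi> x \<noteq> \<one>\<^bsub>P\<^esub>}"
    by (rule finite_subset[of _ "{(h, G)}"]) auto
qed (use assms monD[OF assms(4)] in auto)

text \<open>Coordinates are composed. A composite is nontrivial at \<open>x\<close> only if its
  inner map is, which leaves finitely many inner maps, each followed by finitely many outer
  ones.\<close>

lemma sum_embeds_trans:
  assumes "sum_embeds H C" "group H" "\<And>P. C P \<Longrightarrow> group P \<Longrightarrow> sum_embeds P D"
  shows "sum_embeds H D"
proof -
  obtain \<Phi> where \<Phi>: "coordinates H C \<Phi>"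
    using assms(1) unfolding sum_embeds_def ..
  note P = coordinatesD[OF \<Phi>]
  have "\<exists>\<Psi>. coordinates P D \<Psi>" if "(\<phi>, P) \<in> \<Phi>" for \<phi> P
    using assms(3)[OF P(1,2)[OF that]] unfolding sum_embeds_def .
  then have "\<forall>P \<in> snd ` \<Phi>. \<exists>\<Psi>. coordinates P D \<Psi>" by auto
  from bchoice[OF this] obtain \<Psi> where "\<forall>P \<in> snd ` \<Phi>. coordinates P D (\<Psi> P)" by blast
  then have "\<And>\<phi> P. (\<phi>, P) \<in> \<Phi> \<Longrightarrow> coordinates P D (\<Psi> P)" by force
  note \<Psi> = coordinatesD[OF this]
  define \<Theta> where "\<Theta> = {(\<psi> \<circ> \<phi>, R) |\<phi> P \<psi> R. (\<phi>, P) \<in> \<Phi> \<and> (\<psi>, R) \<in> \<Psi> P}"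
  show ?thesis
  proof (rule sum_embedsI[of \<Theta>])
    fix \<theta> R assume "(\<theta>, R) \<in> \<Theta>"
    then obtain \<phi> P \<psi> where *: "\<theta> = \<psi> \<circ> \<phi>" "(\<phi>, P) \<in> \<Phi>" "(\<psi>, R) \<in> \<Psi> P"
      unfolding \<Theta>_def by blast
    note ** = \<Psi>(1-3)[OF *(2,3)]
    then show "D R" "group R" by auto
    show "\<theta> \<in> hom H R" unfolding *(1) by (rule hom_compose[OF P(3)[OF *(2)] **(3)])
  next
    fix x assume x: "x \<in> carrier H"
    let ?A = "{(\<phi>, P) \<in> \<Phi>. \<phi> x \<noteq> \<one>\<^bsub>P\<^esub>}"
    let ?B = "\<lambda>(\<phi>, P). (\<lambda>(\<psi>, R). (\<psi> \<circ> \<phi>, R)) ` {(\<psi>, R) \<in> \<Psi> P. \<psi> (\<phi> x) \<noteq> \<one>\<^bsub>R\<^esub>}"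
    have "{(\<theta>, R) \<in> \<Theta>. \<theta> x \<noteq> \<one>\<^bsub>R\<^esub>} \<subseteq> \<Union>(?B ` ?A)"
    proof clarify
      fix \<theta> R assume "(\<theta>, R) \<in> \<Theta>" and n1: "\<theta> x \<noteq> \<one>\<^bsub>R\<^esub>"
      then obtain \<phi> P \<psi> where *: "\<theta> = \<psi> \<circ> \<phi>" "(\<phi>, P) \<in> \<Phi>" "(\<psi>, R) \<in> \<Psi> P"
        unfolding \<Theta>_def by blast
      note ** = \<Psi>(2,3)[OF *(2,3)]
      have "\<psi> \<one>\<^bsub>P\<^esub> = \<one>\<^bsub>R\<^esub>" by (rule hom_one[OF **(2) P(2)[OF *(2)] **(1)])
      then have "\<phi> x \<noteq> \<one>\<^bsub>P\<^esub>" using n1 *(1) by auto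
      then have "(\<phi>, P) \<in> ?A" using *(2) by simp
      moreover have "(\<theta>, R) \<in> ?B (\<phi>, P)" using *(1,3) n1 by auto
      ultimately show "(\<theta>, R) \<in> \<Union>(?B ` ?A)" by blast
    qed
    moreover have "finite (?B u)" if "u \<in> ?A" for u
    proof -
      obtain \<phi> P where u: "u = (\<phi>, P)" by (cases u)
      then have "(\<phi>, P) \<in> \<Phi>" using that by simp
      then have "finite {(\<psi>, R) \<in> \<Psi> P. \<psi> (\<phi> x) \<noteq> \<one>\<^bsub>R\<^esub>}"
        using \<Psi>(4) hom_in_carrier[OF P(3) x] by blast
      then show ?thesis unfolding u by simp
    qed
    ultimately show "finite {(\<theta>, R) \<in> \<Theta>. \<theta> x \<noteq> \<one>\<^bsub>R\<^esub>}"
      using P(4)[OF x] by (meson finite_UN_I finite_subset)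
    assume 1: "\<And>\<theta> R. (\<theta>, R) \<in> \<Theta> \<Longrightarrow> \<theta> x = \<one>\<^bsub>R\<^esub>"
    show "x = \<one>\<^bsub>H\<^esub>"
    proof (rule P(5)[OF x])
      fix \<phi> P assume *: "(\<phi>, P) \<in> \<Phi>"
      have "\<psi> (\<phi> x) = \<one>\<^bsub>R\<^esub>" if "(\<psi>, R) \<in> \<Psi> P" for \<psi> R
        using 1[of "\<psi> \<circ> \<phi>" R] * that unfolding \<Theta>_def by auto
      moreover have "\<phi> x \<in> carrier P" using P(3)[OF *] x by (rule hom_in_carrier)
      ultimately show "\<phi> x = \<one>\<^bsub>P\<^esub>" using \<Psi>(5)[OF *] by blast
    qed
  qed
qed

lemma sum_embeds_comm:
  assumes "sum_embeds H (comm_group :: 'p monoid \<Rightarrow> bool)" "group H"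
  shows "comm_group H"
proof (rule comm_groupI_commutators[OF assms(2)])
  obtain \<Phi> :: "(_ \<times> 'p monoid) set" where \<Phi>: "coordinates H comm_group \<Phi>"
    using assms(1) unfolding sum_embeds_def ..
  note P = coordinatesD[OF \<Phi>]
  interpret group H by fact
  fix x y assume xy: "x \<in> carrier H" "y \<in> carrier H"
  show "x \<otimes>\<^bsub>H\<^esub> y \<otimes>\<^bsub>H\<^esub> inv\<^bsub>H\<^esub> x \<otimes>\<^bsub>H\<^esub> inv\<^bsub>H\<^esub> y = \<one>\<^bsub>H\<^esub>"
  proof (rule P(5))
    show "x \<otimes>\<^bsub>H\<^esub> y \<otimes>\<^bsub>H\<^esub> inv\<^bsub>H\<^esub> x \<otimes>\<^bsub>H\<^esub> inv\<^bsub>H\<^esub> y \<in> carrier H" using xy by simp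
    fix \<phi> P assume *: "(\<phi>, P) \<in> \<Phi>"
    interpret P: comm_group P by (rule P(1)[OF *])
    interpret h: group_hom H P \<phi> by (rule group_homI[OF assms(2) P(2,3)[OF *]])
    have "\<phi> x \<otimes>\<^bsub>P\<^esub> \<phi> y = \<phi> y \<otimes>\<^bsub>P\<^esub> \<phi> x" using xy by (simp add: P.m_comm)
    then show "\<phi> (x \<otimes>\<^bsub>H\<^esub> y \<otimes>\<^bsub>H\<^esub> inv\<^bsub>H\<^esub> x \<otimes>\<^bsub>H\<^esub> inv\<^bsub>H\<^esub> y) = \<one>\<^bsub>P\<^esub>"
      using xy by (simp add: P.m_assoc)
  qed
qed

text \<open>The elements supported in a finite set \<open>J\<close> of coordinates form an iterated
  extension of subgroups of members of \<open>EG \<mu>\<close>, and a limit class absorbs finitely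
  many extensions. The directed union over all finite \<open>J\<close> accounts for the one extra
  step.\<close>

lemma sum_embeds_limit:
  fixes H :: "'a monoid" and \<mu> :: "'b::infinite ordinal"
  assumes "limit_ordinal \<mu>" "group H" "sum_embeds H (\<lambda>P :: 'a monoid. EG \<mu> P)"
  shows "EG (osucc \<mu>) H"
proof -
  obtain \<Phi> :: "(('a \<Rightarrow> 'a) \<times> 'a monoid) set" where \<Phi>: "coordinates H (EG \<mu>) \<Phi>"
    using assms(3) unfolding sum_embeds_def ..
  note P = coordinatesD[OF \<Phi>]
  interpret group H by fact
  define part where "part J = {x \<in> carrier H. \<forall>(\<phi>, P) \<in> \<Phi> - J. \<phi> x = \<one>\<^bsub>P\<^esub>}" for J
  have partI: "x \<in> part J" if "x \<in> carrier H" "\<And>\<phi> P. (\<phi>, P) \<in> \<Phi> \<Longrightarrow> (\<phi>, P) \<notin> J \<Longrightarrow> \<phi> x = \<one>\<^bsub>P\<^esub>" for x J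
    using that unfolding part_def by blast
  have partD: "x \<in> carrier H" "(\<phi>, P) \<in> \<Phi> \<Longrightarrow> (\<phi>, P) \<notin> J \<Longrightarrow> \<phi> x = \<one>\<^bsub>P\<^esub>"
    if "x \<in> part J" for x J \<phi> P
    using that unfolding part_def by auto
  have gh: "group_hom H P \<phi>" if "(\<phi>, P) \<in> \<Phi>" for \<phi> P
    by (rule group_homI[OF assms(2) P(2,3)[OF that]])
  have sub: "subgroup (part J) H" for J
  proof (rule subgroupI)
    show "part J \<subseteq> carrier H" using partD by blast
    have "\<one>\<^bsub>H\<^esub> \<in> part J" by (rule partI) (auto dest: gh group_hom.hom_one)
    then show "part J \<noteq> {}" by blast
    fix x assume x: "x \<in> part J"
    show "inv\<^bsub>H\<^esub> x \<in> part J"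
    proof (rule partI)
      fix \<phi> P assume *: "(\<phi>, P) \<in> \<Phi>" "(\<phi>, P) \<notin> J"
      interpret h: group_hom H P \<phi> by (rule gh[OF *(1)])
      show "\<phi> (inv\<^bsub>H\<^esub> x) = \<one>\<^bsub>P\<^esub>" using partD(2)[OF x *] partD(1)[OF x] by simp
    qed (use partD(1)[OF x] in simp)
    fix y assume y: "y \<in> part J"
    show "x \<otimes>\<^bsub>H\<^esub> y \<in> part J"
    proof (rule partI)
      fix \<phi> P assume *: "(\<phi>, P) \<in> \<Phi>" "(\<phi>, P) \<notin> J"
      interpret h: group_hom H P \<phi> by (rule gh[OF *(1)])
      show "\<phi> (x \<otimes>\<^bsub>H\<^esub> y) = \<one>\<^bsub>P\<^esub>" using partD(2)[OF x *] partD(2)[OF y *] partD(1)[OF x] partD(1)[OF y] by simp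
    qed (use partD(1)[OF x] partD(1)[OF y] in simp)
  qed
  have EG: "EG \<mu> (H\<lparr>carrier := part J\<rparr>)" if "finite J" "J \<subseteq> \<Phi>" for J
    using that
  proof (induction J rule: finite_induct)
    case empty
    have "part {} \<subseteq> {\<one>\<^bsub>H\<^esub>}" using P(5) partD by blast
    then have "finite (part {})" by (rule finite_subset) simp
    then have "EG (0 :: 'b ordinal) (H\<lparr>carrier := part {}\<rparr>)"
      using subgroup.subgroup_is_group[OF sub is_group] by (intro EG.zero_finite) simp_all
    then show ?case using EG_mono ordinal_zero_le by blast
  next
    case (insert u J)
    obtain \<phi> P where u: "u = (\<phi>, P)" by (cases u)
    have PP: "(\<phi>, P) \<in> \<Phi>" using insert.prems u by simp
    interpret h: group_hom H P \<phi> by (rule gh[OF PP])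
    let ?H = "H\<lparr>carrier := part (insert u J)\<rparr>" and ?P = "P\<lparr>carrier := \<phi> ` part (insert u J)\<rparr>"
    have gH: "group ?H" by (rule subgroup.subgroup_is_group[OF sub is_group])
    have sP: "subgroup (\<phi> ` part (insert u J)) P" by (rule h.subgroup_img_is_subgroup[OF sub])
    have EP: "EG \<mu> ?P" by (rule EG_subgroup[OF P(1)[OF PP] sP])
    have ep: "\<phi> \<in> epi ?H ?P" by (rule epi_restrict_image[OF h.homh subgroup.subset[OF sub]])
    have k: "kernel ?H ?P \<phi> = part J"
    proof
      show "kernel ?H ?P \<phi> \<subseteq> part J"
      proof
        fix x assume "x \<in> kernel ?H ?P \<phi>"
        then have x: "x \<in> part (insert u J)" "\<phi> x = \<one>\<^bsub>P\<^esub>" by (simp_all add: kernel_def)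
        show "x \<in> part J"
        proof (rule partI[OF partD(1)[OF x(1)]])
          fix \<psi> R assume "(\<psi>, R) \<in> \<Phi>" "(\<psi>, R) \<notin> J"
          then show "\<psi> x = \<one>\<^bsub>R\<^esub>"
            using partD(2)[OF x(1), of \<psi> R] x(2) u by (cases "(\<psi>, R) = u") auto
        qed
      qed
      show "part J \<subseteq> kernel ?H ?P \<phi>"
      proof
        fix x assume x: "x \<in> part J"
        then have "x \<in> part (insert u J)" by (intro partI) (use partD in auto)
        moreover have "\<phi> x = \<one>\<^bsub>P\<^esub>" using partD(2)[OF x PP] insert.hyps(2) u by simp
        ultimately show "x \<in> kernel ?H ?P \<phi>" by (simp add: kernel_def)
      qed
    qed
    have "extension_of ?H (H\<lparr>carrier := part J\<rparr>) ?P"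
      using extension_ofI[OF gH EG_group[OF EP] ep] k by simp
    then show ?case
      using extension_EG_limit[OF assms(1) _ EP] insert.IH insert.prems by blast
  qed
  show ?thesis
  proof (rule EG.succ_directed_union)
    show "EG \<mu> (H\<lparr>carrier := K\<rparr>)" if "K \<in> {part J |J. finite J \<and> J \<subseteq> \<Phi>}" for K
      using that EG by blast
    show "directed_union_of H {part J |J. finite J \<and> J \<subseteq> \<Phi>}"
      unfolding directed_union_of_def
    proof (intro conjI ballI)
      fix A B assume "A \<in> {part J |J. finite J \<and> J \<subseteq> \<Phi>}" "B \<in> {part J |J. finite J \<and> J \<subseteq> \<Phi>}"
      then obtain J K where JK: "A = part J" "B = part K" "finite J" "finite K" "J \<subseteq> \<Phi>" "K \<subseteq> \<Phi>"
        by blast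
      have "part J \<subseteq> part (J \<union> K)" "part K \<subseteq> part (J \<union> K)"
        unfolding part_def by blast+
      moreover have "part (J \<union> K) \<in> {part J |J. finite J \<and> J \<subseteq> \<Phi>}" using JK by blast
      ultimately show "\<exists>L\<in>{part J |J. finite J \<and> J \<subseteq> \<Phi>}. A \<subseteq> L \<and> B \<subseteq> L" using JK(1,2) by blast
    next
      have "x \<in> part {(\<phi>, P) \<in> \<Phi>. \<phi> x \<noteq> \<one>\<^bsub>P\<^esub>}" if "x \<in> carrier H" for x
        by (rule partI[OF that]) blast
      then show "carrier H = \<Union> {part J |J. finite J \<and> J \<subseteq> \<Phi>}"
        using P(4) partD(1) by blast
    qed (use is_group sub in auto)
  qed
qed

text \<open>A restricted power of an extension is an extension of restricted powers, namely of the
  power of the kernel by the power of \<open>Q\<close>. Infinitely many copies therefore cost one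
  step, just as a single copy does.\<close>

lemma sum_embeds_extension:
  fixes H :: "'a monoid" and \<beta> :: "'b::infinite ordinal"
  assumes "group H" "group F" "group Q" "\<pi> \<in> hom F Q" "sum_embeds H ((=) F)"
    and ker: "\<And>N :: 'a monoid. group N \<Longrightarrow> sum_embeds N ((=) (F\<lparr>carrier := kernel F Q \<pi>\<rparr>)) \<Longrightarrow> EG \<beta> N"
    and quo: "\<And>B :: 'a monoid. group B \<Longrightarrow> sum_embeds B ((=) Q) \<Longrightarrow> EG \<beta> B"
  shows "EG (osucc \<beta>) H"
proof -
  obtain \<Phi> where \<Phi>: "coordinates H ((=) F) \<Phi>"
    using assms(5) unfolding sum_embeds_def ..
  note P = coordinatesD[OF \<Phi>]
  define \<Psi> where "\<Psi> = fst ` \<Phi>"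
  have \<Psi>: "(\<phi>, F) \<in> \<Phi>" if "\<phi> \<in> \<Psi>" for \<phi>
    using that P(1) by (auto simp: \<Psi>_def)
  have \<Psi>I: "\<phi> \<in> \<Psi>" if "(\<phi>, P) \<in> \<Phi>" for \<phi> P
    using that by (force simp: \<Psi>_def)
  have hom: "\<phi> \<in> hom H F" if "\<phi> \<in> \<Psi>" for \<phi> using \<Psi> P that by blast
  have fin: "finite {\<phi> \<in> \<Psi>. \<phi> x \<noteq> \<one>\<^bsub>F\<^esub>}" if "x \<in> carrier H" for x
  proof -
    have "{\<phi> \<in> \<Psi>. \<phi> x \<noteq> \<one>\<^bsub>F\<^esub>} \<subseteq> fst ` {(\<phi>, P) \<in> \<Phi>. \<phi> x \<noteq> \<one>\<^bsub>P\<^esub>}"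
      using \<Psi> by force
    then show ?thesis using P(4)[OF that] finite_subset by blast
  qed
  interpret group H by fact
  interpret pi: group_hom F Q \<pi> by (rule group_homI[OF assms(2-4)])
  \<comment> \<open>The part of \<open>H\<close> that falls into the power of the kernel of
    \<open>\<pi>\<close>.\<close>
  define N where "N = {x \<in> carrier H. \<forall>\<phi>\<in>\<Psi>. \<pi> (\<phi> x) = \<one>\<^bsub>Q\<^esub>}"
  have gh: "group_hom H F \<phi>" if "\<phi> \<in> \<Psi>" for \<phi> by (rule group_homI[OF assms(1,2) hom[OF that]])
  have ghc: "group_hom H Q (\<pi> \<circ> \<phi>)" if "\<phi> \<in> \<Psi>" for \<phi>
    by (rule group_homI[OF assms(1,3) Group.hom_compose[OF hom[OF that] assms(4)]])
  have "subgroup N H"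
  proof (rule subgroupI)
    show "N \<subseteq> carrier H" by (auto simp: N_def)
    have "\<one>\<^bsub>H\<^esub> \<in> N" using group_hom.hom_one[OF ghc] by (simp add: N_def)
    then show "N \<noteq> {}" by blast
    fix x assume x: "x \<in> N"
    show "inv\<^bsub>H\<^esub> x \<in> N"
      using x group_hom.hom_inv[OF ghc, of _ x] pi.H.inv_one by (simp add: N_def)
    fix y assume "y \<in> N"
    then show "x \<otimes>\<^bsub>H\<^esub> y \<in> N"
      using x group_hom.hom_mult[OF ghc, of _ x y] by (simp add: N_def)
  qed
  moreover have "x \<otimes>\<^bsub>H\<^esub> y \<otimes>\<^bsub>H\<^esub> inv\<^bsub>H\<^esub> x \<in> N" if "x \<in> carrier H" "y \<in> N" for x y
  proof -
    have "\<pi> (\<phi> (x \<otimes>\<^bsub>H\<^esub> y \<otimes>\<^bsub>H\<^esub> inv\<^bsub>H\<^esub> x)) = \<one>\<^bsub>Q\<^esub>" if "\<phi> \<in> \<Psi>" for \<phi>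
    proof -
      interpret h: group_hom H F \<phi> by (rule gh[OF that])
      have "y \<in> carrier H" "\<pi> (\<phi> y) = \<one>\<^bsub>Q\<^esub>" using \<open>y \<in> N\<close> that by (auto simp: N_def)
      then show ?thesis using \<open>x \<in> carrier H\<close> by simp
    qed
    then show ?thesis using that by (auto simp: N_def)
  qed
  ultimately have N: "N \<lhd> H" "subgroup N H" by (auto simp: normal_inv_iff)
  have gN: "group (H\<lparr>carrier := N\<rparr>)" by (rule subgroup.subgroup_is_group[OF N(2) is_group])
  let ?K = "F\<lparr>carrier := kernel F Q \<pi>\<rparr>"
  have "sum_embeds (H\<lparr>carrier := N\<rparr>) ((=) ?K)"
  proof (rule sum_embedsI[of "(\<lambda>\<phi>. (\<phi>, ?K)) ` \<Psi>"])
    fix \<phi> P assume "(\<phi>, P) \<in> (\<lambda>\<phi>. (\<phi>, ?K)) ` \<Psi>"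
    then have *: "P = ?K" "\<phi> \<in> \<Psi>" by auto
    then show "?K = P" by simp
    show "group P" unfolding * by (rule subgroup.subgroup_is_group[OF pi.subgroup_kernel assms(2)])
    show "\<phi> \<in> hom (H\<lparr>carrier := N\<rparr>) P"
      unfolding *(1) by (rule hom_carrier_update[OF hom[OF *(2)]])
        (use hom_in_carrier[OF hom[OF *(2)]] *(2) in \<open>auto simp: N_def kernel_def\<close>)
  next
    fix x assume x: "x \<in> carrier (H\<lparr>carrier := N\<rparr>)"
    then have xH: "x \<in> carrier H" by (simp add: N_def)
    have "{(\<phi>, P) \<in> (\<lambda>\<phi>. (\<phi>, ?K)) ` \<Psi>. \<phi> x \<noteq> \<one>\<^bsub>P\<^esub>} \<subseteq> (\<lambda>\<phi>. (\<phi>, ?K)) ` {\<phi> \<in> \<Psi>. \<phi> x \<noteq> \<one>\<^bsub>F\<^esub>}"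
      by auto
    then show "finite {(\<phi>, P) \<in> (\<lambda>\<phi>. (\<phi>, ?K)) ` \<Psi>. \<phi> x \<noteq> \<one>\<^bsub>P\<^esub>}"
      using fin[OF xH] finite_subset by blast
    assume 1: "\<And>\<phi> P. (\<phi>, P) \<in> (\<lambda>\<phi>. (\<phi>, ?K)) ` \<Psi> \<Longrightarrow> \<phi> x = \<one>\<^bsub>P\<^esub>"
    have "x = \<one>\<^bsub>H\<^esub>"
    proof (rule P(5)[OF xH])
      fix \<phi> P assume "(\<phi>, P) \<in> \<Phi>"
      then show "\<phi> x = \<one>\<^bsub>P\<^esub>" using 1[of \<phi> ?K] P(1) \<Psi>I by fastforce
    qed
    then show "x = \<one>\<^bsub>H\<lparr>carrier := N\<rparr>\<^esub>" by simp
  qed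
  then have EN: "EG \<beta> (H\<lparr>carrier := N\<rparr>)" by (rule ker[OF gN])
  obtain B :: "'a monoid" and c where B: "group B" "c \<in> epi H B" "kernel H B c = N"
    using quotient_copy[OF N(1)] by metis
  \<comment> \<open>Each \<open>\<pi> \<circ> \<phi>\<close> kills \<open>N\<close> and so descends
    to \<open>B\<close>. The descended maps serve as coordinates of \<open>B\<close>, jointly
    injective because \<open>N\<close> is the full kernel of \<open>c\<close>.\<close>
  have "\<exists>s \<in> hom B Q. \<forall>x \<in> carrier H. s (c x) = \<pi> (\<phi> x)" if "\<phi> \<in> \<Psi>" for \<phi>
  proof -
    have "kernel H B c \<subseteq> kernel H Q (\<pi> \<circ> \<phi>)" unfolding B(3) using that by (auto simp: N_def kernel_def)
    from hom_factor[OF assms(1) B(1) assms(3) B(2) group_hom.homh[OF ghc[OF that]] this]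
    show ?thesis by (metis comp_apply)
  qed
  then obtain s where s: "\<And>\<phi>. \<phi> \<in> \<Psi> \<Longrightarrow> s \<phi> \<in> hom B Q"
    "\<And>\<phi> x. \<phi> \<in> \<Psi> \<Longrightarrow> x \<in> carrier H \<Longrightarrow> s \<phi> (c x) = \<pi> (\<phi> x)" by metis
  have cs: "carrier B = c ` carrier H" using epiD[OF B(2)] by simp
  have "sum_embeds B ((=) Q)"
  proof (rule sum_embedsI[of "(\<lambda>\<phi>. (s \<phi>, Q)) ` \<Psi>"])
    fix \<phi> P assume "(\<phi>, P) \<in> (\<lambda>\<phi>. (s \<phi>, Q)) ` \<Psi>"
    then show "Q = P" "group P" "\<phi> \<in> hom B P" using s(1) assms(3) by auto
  next
    fix y assume "y \<in> carrier B"
    then obtain x where x: "x \<in> carrier H" "y = c x" unfolding cs by blast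
    have "{(\<phi>, P) \<in> (\<lambda>\<phi>. (s \<phi>, Q)) ` \<Psi>. \<phi> y \<noteq> \<one>\<^bsub>P\<^esub>} \<subseteq> (\<lambda>\<phi>. (s \<phi>, Q)) ` {\<phi> \<in> \<Psi>. \<phi> x \<noteq> \<one>\<^bsub>F\<^esub>}"
      using s(2) x pi.hom_one by fastforce
    then show "finite {(\<phi>, P) \<in> (\<lambda>\<phi>. (s \<phi>, Q)) ` \<Psi>. \<phi> y \<noteq> \<one>\<^bsub>P\<^esub>}"
      using fin[OF x(1)] finite_subset by blast
    assume 1: "\<And>\<phi> P. (\<phi>, P) \<in> (\<lambda>\<phi>. (s \<phi>, Q)) ` \<Psi> \<Longrightarrow> \<phi> y = \<one>\<^bsub>P\<^esub>"
    have "x \<in> N" using 1 s(2) x by (fastforce simp: N_def)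
    then show "y = \<one>\<^bsub>B\<^esub>" using x B(3) by (auto simp: kernel_def)
  qed
  then have "EG \<beta> B" by (rule quo[OF B(1)])
  then show ?thesis using extension_EG[OF is_group B(2)] EN B(3) by simp
qed

text \<open>Meant for the second derived subgroup, whose image can be controlled under all
  homomorphisms at once. This avoids naming the coordinate maps.\<close>

lemma sum_embeds_subgroup:
  assumes "group H" "group F" "A \<subseteq> carrier H" "\<And>\<phi>. \<phi> \<in> hom H F \<Longrightarrow> \<phi> ` A \<subseteq> B"
    "subgroup A H" "subgroup B F" "sum_embeds H ((=) F)"
  shows "sum_embeds (H\<lparr>carrier := A\<rparr>) ((=) (F\<lparr>carrier := B\<rparr>))"
proof -
  obtain \<Phi> where \<Phi>: "coordinates H ((=) F) \<Phi>"
    using assms(7) unfolding sum_embeds_def ..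
  note P = coordinatesD[OF \<Phi>]
  let ?F = "F\<lparr>carrier := B\<rparr>"
  show ?thesis
  proof (rule sum_embedsI[of "(\<lambda>(\<phi>, P). (\<phi>, ?F)) ` \<Phi>"])
    fix \<phi> P assume "(\<phi>, P) \<in> (\<lambda>(\<phi>, P). (\<phi>, ?F)) ` \<Phi>"
    then obtain P' where "P = ?F" "(\<phi>, P') \<in> \<Phi>" by auto
    then have *: "P = ?F" "\<phi> \<in> hom H F" using P(1,3)[of \<phi> P'] by auto
    then show "?F = P" by simp
    show "group P" unfolding * by (rule subgroup.subgroup_is_group[OF assms(6,2)])
    show "\<phi> \<in> hom (H\<lparr>carrier := A\<rparr>) P"
      unfolding *(1) by (rule hom_carrier_update[OF *(2) assms(3) assms(4)[OF *(2)]])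
  next
    fix x assume "x \<in> carrier (H\<lparr>carrier := A\<rparr>)"
    then have x: "x \<in> carrier H" using assms(3) by auto
    have "{(\<phi>, P) \<in> (\<lambda>(\<phi>, P). (\<phi>, ?F)) ` \<Phi>. \<phi> x \<noteq> \<one>\<^bsub>P\<^esub>}
      \<subseteq> (\<lambda>(\<phi>, P). (\<phi>, ?F)) ` {(\<phi>, P) \<in> \<Phi>. \<phi> x \<noteq> \<one>\<^bsub>P\<^esub>}"
      using P(1) by fastforce
    then show "finite {(\<phi>, P) \<in> (\<lambda>(\<phi>, P). (\<phi>, ?F)) ` \<Phi>. \<phi> x \<noteq> \<one>\<^bsub>P\<^esub>}"
      using P(4)[OF x] finite_subset by blast
    assume 1: "\<And>\<phi> P. (\<phi>, P) \<in> (\<lambda>(\<phi>, P). (\<phi>, ?F)) ` \<Phi> \<Longrightarrow> \<phi> x = \<one>\<^bsub>P\<^esub>"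
    have "x = \<one>\<^bsub>H\<^esub>"
    proof (rule P(5)[OF x])
      fix \<phi> P assume "(\<phi>, P) \<in> \<Phi>"
      then show "\<phi> x = \<one>\<^bsub>P\<^esub>" using 1[of \<phi> ?F] P(1) by force
    qed
    then show "x = \<one>\<^bsub>H\<lparr>carrier := A\<rparr>\<^esub>" by simp
  qed
qed

section \<open>Unrestricted wreath products\<close>

text \<open>
  The function \<open>g\<close> in \<open>(f, q) (g, r)\<close> is translated by \<open>q\<close> on the right of its argument, which
  avoids inverses in the multiplication.
\<close>

definition wreath :: "'k monoid \<Rightarrow> 'q monoid \<Rightarrow> (('q \<Rightarrow> 'k) \<times> 'q) monoid" where
  "wreath K Q = \<lparr>carrier = (carrier Q \<rightarrow>\<^sub>E carrier K) \<times> carrier Q,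
     monoid.mult = \<lambda>(f, q) (g, r). (\<lambda>x\<in>carrier Q. f x \<otimes>\<^bsub>K\<^esub> g (x \<otimes>\<^bsub>Q\<^esub> q), q \<otimes>\<^bsub>Q\<^esub> r),
     one = (\<lambda>x\<in>carrier Q. \<one>\<^bsub>K\<^esub>, \<one>\<^bsub>Q\<^esub>)\<rparr>"

locale wreath_product =
  fixes K :: "'k monoid" and Q :: "'q monoid"
  assumes K: "group K" and Q: "group Q"
begin

sublocale K: group K by (rule K)
sublocale Q: group Q by (rule Q)

abbreviation W where "W \<equiv> wreath K Q"

lemma W_carrier: "(f, q) \<in> carrier W \<longleftrightarrow> f \<in> carrier Q \<rightarrow>\<^sub>E carrier K \<and> q \<in> carrier Q"
  by (simp add: wreath_def)

lemma W_mult: "(f, q) \<otimes>\<^bsub>W\<^esub> (g, r) = (\<lambda>x\<in>carrier Q. f x \<otimes>\<^bsub>K\<^esub> g (x \<otimes>\<^bsub>Q\<^esub> q), q \<otimes>\<^bsub>Q\<^esub> r)"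
  by (simp add: wreath_def)

lemma W_one: "\<one>\<^bsub>W\<^esub> = (\<lambda>x\<in>carrier Q. \<one>\<^bsub>K\<^esub>, \<one>\<^bsub>Q\<^esub>)"
  by (simp add: wreath_def)

lemma fst_closed [simp]: "u \<in> carrier W \<Longrightarrow> x \<in> carrier Q \<Longrightarrow> fst u x \<in> carrier K"
  by (cases u) (auto simp: W_carrier)

lemma snd_closed [simp]: "u \<in> carrier W \<Longrightarrow> snd u \<in> carrier Q"
  by (cases u) (auto simp: W_carrier)

lemma fst_mult [simp]: "x \<in> carrier Q \<Longrightarrow> fst (u \<otimes>\<^bsub>W\<^esub> v) x = fst u x \<otimes>\<^bsub>K\<^esub> fst v (x \<otimes>\<^bsub>Q\<^esub> snd u)"
  by (cases u; cases v) (simp add: W_mult)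

lemma snd_mult [simp]: "snd (u \<otimes>\<^bsub>W\<^esub> v) = snd u \<otimes>\<^bsub>Q\<^esub> snd v"
  by (cases u; cases v) (simp add: W_mult)

lemma fst_one [simp]: "x \<in> carrier Q \<Longrightarrow> fst \<one>\<^bsub>W\<^esub> x = \<one>\<^bsub>K\<^esub>"
  and snd_one [simp]: "snd \<one>\<^bsub>W\<^esub> = \<one>\<^bsub>Q\<^esub>"
  by (simp_all add: W_one)

lemma W_eqI:
  assumes "u \<in> carrier W" "v \<in> carrier W" "snd u = snd v"
    "\<And>x. x \<in> carrier Q \<Longrightarrow> fst u x = fst v x"
  shows "u = v"
proof -
  have "fst u = fst v"
    using assms by (intro PiE_ext[of _ "carrier Q" "\<lambda>_. carrier K"])
      (auto simp: wreath_def)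
  then show ?thesis using assms(3) by (simp add: prod_eq_iff)
qed

lemma W_mult_closed: "u \<in> carrier W \<Longrightarrow> v \<in> carrier W \<Longrightarrow> u \<otimes>\<^bsub>W\<^esub> v \<in> carrier W"
  by (cases u; cases v) (auto simp: W_mult W_carrier)

lemma W_one_closed: "\<one>\<^bsub>W\<^esub> \<in> carrier W"
  by (auto simp: W_one W_carrier)

lemma W_inv_aux:
  assumes "u \<in> carrier W"
  defines "v \<equiv> (\<lambda>x\<in>carrier Q. inv\<^bsub>K\<^esub> (fst u (x \<otimes>\<^bsub>Q\<^esub> inv\<^bsub>Q\<^esub> snd u)), inv\<^bsub>Q\<^esub> snd u)"
  shows "v \<in> carrier W" "v \<otimes>\<^bsub>W\<^esub> u = \<one>\<^bsub>W\<^esub>"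
proof -
  show v: "v \<in> carrier W" using assms by (auto simp: W_carrier)
  show "v \<otimes>\<^bsub>W\<^esub> u = \<one>\<^bsub>W\<^esub>"
  proof (rule W_eqI[OF W_mult_closed[OF v assms(1)] W_one_closed])
    show "snd (v \<otimes>\<^bsub>W\<^esub> u) = snd \<one>\<^bsub>W\<^esub>" using assms by simp
    fix x assume x: "x \<in> carrier Q"
    have "fst u (x \<otimes>\<^bsub>Q\<^esub> inv\<^bsub>Q\<^esub> snd u) \<in> carrier K" using assms(1) x by simp
    then show "fst (v \<otimes>\<^bsub>W\<^esub> u) x = fst \<one>\<^bsub>W\<^esub> x" using x by (simp add: v_def)
  qed
qed

lemma W_group: "group W"
proof (rule groupI)
  fix u v w assume uvw: "u \<in> carrier W" "v \<in> carrier W" "w \<in> carrier W"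
  show "u \<otimes>\<^bsub>W\<^esub> v \<otimes>\<^bsub>W\<^esub> w = u \<otimes>\<^bsub>W\<^esub> (v \<otimes>\<^bsub>W\<^esub> w)"
    by (rule W_eqI) (use uvw in \<open>simp_all add: W_mult_closed Q.m_assoc K.m_assoc\<close>)
next
  fix u assume u: "u \<in> carrier W"
  show "\<one>\<^bsub>W\<^esub> \<otimes>\<^bsub>W\<^esub> u = u"
    by (rule W_eqI) (use u in \<open>simp_all add: W_mult_closed W_one_closed\<close>)
  show "\<exists>v\<in>carrier W. v \<otimes>\<^bsub>W\<^esub> u = \<one>\<^bsub>W\<^esub>"
    using W_inv_aux[OF u] by blast
qed (auto intro: W_mult_closed W_one_closed)

sublocale W: group W by (rule W_group)

lemma W_inv:
  assumes "u \<in> carrier W"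
  shows "inv\<^bsub>W\<^esub> u = (\<lambda>x\<in>carrier Q. inv\<^bsub>K\<^esub> (fst u (x \<otimes>\<^bsub>Q\<^esub> inv\<^bsub>Q\<^esub> snd u)), inv\<^bsub>Q\<^esub> snd u)"
  using W.inv_equality[OF W_inv_aux(2)[OF assms] assms W_inv_aux(1)[OF assms]] .

lemma fst_inv [simp]: "u \<in> carrier W \<Longrightarrow> x \<in> carrier Q \<Longrightarrow>
    fst (inv\<^bsub>W\<^esub> u) x = inv\<^bsub>K\<^esub> (fst u (x \<otimes>\<^bsub>Q\<^esub> inv\<^bsub>Q\<^esub> snd u))"
  and snd_inv [simp]: "u \<in> carrier W \<Longrightarrow> snd (inv\<^bsub>W\<^esub> u) = inv\<^bsub>Q\<^esub> snd u"
  by (simp_all add: W_inv)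

lemma snd_hom: "snd \<in> hom W Q"
  by (rule homI) simp_all

definition delta :: "'q \<Rightarrow> 'k \<Rightarrow> ('q \<Rightarrow> 'k) \<times> 'q" where
  "delta q k = (\<lambda>x\<in>carrier Q. if x = q then k else \<one>\<^bsub>K\<^esub>, \<one>\<^bsub>Q\<^esub>)"

definition lift :: "'q \<Rightarrow> ('q \<Rightarrow> 'k) \<times> 'q" where
  "lift q = (\<lambda>x\<in>carrier Q. \<one>\<^bsub>K\<^esub>, q)"

lemma delta_simps [simp]:
  "snd (delta q k) = \<one>\<^bsub>Q\<^esub>"
  "x \<in> carrier Q \<Longrightarrow> fst (delta q k) x = (if x = q then k else \<one>\<^bsub>K\<^esub>)"
  "k \<in> carrier K \<Longrightarrow> delta q k \<in> carrier W"
  by (auto simp: delta_def W_carrier)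

lemma lift_simps [simp]:
  "snd (lift q) = q" "x \<in> carrier Q \<Longrightarrow> fst (lift q) x = \<one>\<^bsub>K\<^esub>"
  "q \<in> carrier Q \<Longrightarrow> lift q \<in> carrier W"
  by (auto simp: lift_def W_carrier)

lemma delta_mon: "q \<in> carrier Q \<Longrightarrow> delta q \<in> mon K W"
proof -
  assume q: "q \<in> carrier Q"
  have "delta q \<in> hom K W"
    by (rule homI, simp, rule W_eqI) (use q in auto)
  moreover have "inj_on (delta q) (carrier K)"
  proof (rule inj_onI)
    fix x y assume "delta q x = delta q y"
    then have "fst (delta q x) q = fst (delta q y) q" by simp
    then show "x = y" using q by simp
  qed
  ultimately show ?thesis by (simp add: mon_def)
qed

lemma lift_mon: "lift \<in> mon Q W"
proof -
  have "lift \<in> hom Q W"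
    by (rule homI, simp, rule W_eqI) auto
  moreover have "inj_on lift (carrier Q)" by (rule inj_onI) (metis lift_simps(1))
  ultimately show ?thesis by (simp add: mon_def)
qed

text \<open>The restricted wreath product inside the unrestricted one: only the function is
  constrained, the top component is free.\<close>

definition finsupp :: "(('q \<Rightarrow> 'k) \<times> 'q) set" where
  "finsupp = {u \<in> carrier W. finite {x \<in> carrier Q. fst u x \<noteq> \<one>\<^bsub>K\<^esub>}}"

lemma finite_translate:
  assumes "finite A" "q \<in> carrier Q"
  shows "finite {x \<in> carrier Q. x \<otimes>\<^bsub>Q\<^esub> q \<in> A}"
proof (rule finite_subset)
  show "{x \<in> carrier Q. x \<otimes>\<^bsub>Q\<^esub> q \<in> A} \<subseteq> (\<lambda>y. y \<otimes>\<^bsub>Q\<^esub> inv\<^bsub>Q\<^esub> q) ` A"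
    using assms(2) by (auto intro!: image_eqI simp: Q.m_assoc)
qed (use assms in simp)

lemma finsupp_subgroup: "subgroup finsupp W"
proof (rule W.subgroupI)
  show "finsupp \<subseteq> carrier W" by (auto simp: finsupp_def)
  have "\<one>\<^bsub>W\<^esub> \<in> finsupp" by (simp add: finsupp_def cong: conj_cong)
  then show "finsupp \<noteq> {}" by blast
  fix u assume u: "u \<in> finsupp"
  then have uW: "u \<in> carrier W" and fu: "finite {x \<in> carrier Q. fst u x \<noteq> \<one>\<^bsub>K\<^esub>}"
    by (auto simp: finsupp_def)
  have "{x \<in> carrier Q. fst (inv\<^bsub>W\<^esub> u) x \<noteq> \<one>\<^bsub>K\<^esub>}
    \<subseteq> {x \<in> carrier Q. x \<otimes>\<^bsub>Q\<^esub> inv\<^bsub>Q\<^esub> snd u \<in> {x \<in> carrier Q. fst u x \<noteq> \<one>\<^bsub>K\<^esub>}}"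
    using uW by auto
  then show "inv\<^bsub>W\<^esub> u \<in> finsupp"
    using uW finite_translate[OF fu, of "inv\<^bsub>Q\<^esub> snd u"] by (auto simp: finsupp_def intro: finite_subset)
  fix v assume v: "v \<in> finsupp"
  then have vW: "v \<in> carrier W" and fv: "finite {x \<in> carrier Q. fst v x \<noteq> \<one>\<^bsub>K\<^esub>}"
    by (auto simp: finsupp_def)
  have "{x \<in> carrier Q. fst (u \<otimes>\<^bsub>W\<^esub> v) x \<noteq> \<one>\<^bsub>K\<^esub>}
    \<subseteq> {x \<in> carrier Q. fst u x \<noteq> \<one>\<^bsub>K\<^esub>} \<union>
      {x \<in> carrier Q. x \<otimes>\<^bsub>Q\<^esub> snd u \<in> {x \<in> carrier Q. fst v x \<noteq> \<one>\<^bsub>K\<^esub>}}"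
    using uW vW by auto
  then have "finite {x \<in> carrier Q. fst (u \<otimes>\<^bsub>W\<^esub> v) x \<noteq> \<one>\<^bsub>K\<^esub>}"
    using fu finite_translate[OF fv, of "snd u"] uW by (meson finite_Un finite_subset snd_closed)
  then show "u \<otimes>\<^bsub>W\<^esub> v \<in> finsupp"
    using uW vW by (simp add: finsupp_def)
qed

text \<open>Elements with trivial top component multiply pointwise, so evaluation at each position
  is a homomorphism; finite support turns the evaluations into coordinates of a restricted
  sum.\<close>

lemma sum_embeds_base:
  assumes "subgroup A W" "A \<subseteq> finsupp" "\<And>u. u \<in> A \<Longrightarrow> snd u = \<one>\<^bsub>Q\<^esub>"
  shows "sum_embeds (W\<lparr>carrier := A\<rparr>) ((=) K)"
proof (rule sum_embedsI[of "(\<lambda>q. (\<lambda>u. fst u q, K)) ` carrier Q"])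
  have AW: "A \<subseteq> carrier W" using assms(1) subgroup.subset by blast
  fix \<phi> :: "('q \<Rightarrow> 'k) \<times> 'q \<Rightarrow> 'k" and P assume "(\<phi>, P) \<in> (\<lambda>q. (\<lambda>u. fst u q, K)) ` carrier Q"
  then obtain q where q: "P = K" "q \<in> carrier Q" "\<phi> = (\<lambda>u. fst u q)" by auto
  then show "K = P" "group P" using K by auto
  show "\<phi> \<in> hom (W\<lparr>carrier := A\<rparr>) P"
    unfolding q(1,3) by (rule homI) (use subsetD[OF AW] assms(3) q(2) in simp_all)
next
  fix u assume u: "u \<in> carrier (W\<lparr>carrier := A\<rparr>)"
  then have uW: "u \<in> carrier W" and fu: "finite {x \<in> carrier Q. fst u x \<noteq> \<one>\<^bsub>K\<^esub>}"
    using assms(2) by (auto simp: finsupp_def)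
  have "{(\<phi>, P) \<in> (\<lambda>q. (\<lambda>u. fst u q, K)) ` carrier Q. \<phi> u \<noteq> \<one>\<^bsub>P\<^esub>}
    \<subseteq> (\<lambda>q. (\<lambda>u. fst u q, K)) ` {x \<in> carrier Q. fst u x \<noteq> \<one>\<^bsub>K\<^esub>}"
    by auto
  then show "finite {(\<phi>, P) \<in> (\<lambda>q. (\<lambda>u. fst u q, K)) ` carrier Q. \<phi> u \<noteq> \<one>\<^bsub>P\<^esub>}"
    using fu finite_subset by blast
  assume 1: "\<And>\<phi> P. (\<phi> :: ('q \<Rightarrow> 'k) \<times> 'q \<Rightarrow> 'k, P) \<in> (\<lambda>q. (\<lambda>u. fst u q, K)) ` carrier Q \<Longrightarrow> \<phi> u = \<one>\<^bsub>P\<^esub>"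
  have "u = \<one>\<^bsub>W\<^esub>"
  proof (rule W_eqI[OF uW W_one_closed])
    show "snd u = snd \<one>\<^bsub>W\<^esub>" using assms(3) u by simp
    fix x assume "x \<in> carrier Q"
    then show "fst u x = fst \<one>\<^bsub>W\<^esub> x" using 1[of "\<lambda>u. fst u x" K] by auto
  qed
  then show "u = \<one>\<^bsub>W\<lparr>carrier := A\<rparr>\<^esub>" by simp
qed

end

section \<open>Finitely generated groups of successor class\<close>

text \<open>
  The condition on direct sums carries the induction: unlike mere membership of \<open>P\<close> in
  \<open>EG\<^sub>\<alpha>\<^sub>+\<^sub>1\<close>, it bounds the base group of a wreath product with \<open>P\<close>.
\<close>

definition seed :: "'a set ordinal \<Rightarrow> 'a monoid \<Rightarrow> bool" where
  "seed \<alpha> P \<longleftrightarrow> group P \<and> finitely_generated P \<and> \<not> EG \<alpha> P \<and>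
     (\<forall>H :: 'a monoid. group H \<longrightarrow> sum_embeds H ((=) P) \<longrightarrow> EG (osucc \<alpha>) H)"

lemma seed_EG: "seed \<alpha> P \<Longrightarrow> EG (osucc \<alpha>) P"
  unfolding seed_def using sum_embeds_mon[of P P _ "\<lambda>x. x"] iso_mon[OF iso_set_refl] by blast

text \<open>A finitely generated group is countable and therefore has a copy on any infinite type.
  This returns wreath products from their function type to \<open>'a\<close>.\<close>

lemma fg_copy:
  fixes W :: "'w monoid"
  assumes "group W" "finite S" "S \<subseteq> carrier W"
  obtains P :: "'a::infinite monoid" and i where "group P" "finitely_generated P"
    "i \<in> iso P (W\<lparr>carrier := generate W S\<rparr>)"
proof -
  interpret W: group W by fact
  let ?F = "W\<lparr>carrier := generate W S\<rparr>"
  have sub: "subgroup (generate W S) W" by (rule W.generate_is_subgroup[OF assms(3)])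
  have gF: "group ?F" by (rule subgroup.subgroup_is_group[OF sub assms(1)])
  have "countable (generate W S)" by (intro countable_generate countable_finite assms(2))
  then obtain g :: "'w \<Rightarrow> nat" where g: "inj_on g (generate W S)" by (auto simp: countable_def)
  obtain h :: "nat \<Rightarrow> 'a" where h: "inj h"
    using infinite_countable_subset[OF infinite_UNIV[where 'a='a]] by blast
  have "inj_on (h \<circ> g) (carrier ?F)" using g h by (auto simp: inj_on_def)
  then obtain P :: "'a monoid" where P: "group P" "h \<circ> g \<in> iso ?F P"
    by (rule group_copy[OF gF])
  interpret f: group_hom ?F P "h \<circ> g" by (rule group_homI[OF gF P(1)]) (use P(2) in \<open>simp add: iso_def\<close>)
  have "S \<subseteq> generate W S" by (auto intro: generate.incl)
  then have "generate P ((h \<circ> g) ` S) = (h \<circ> g) ` generate ?F S"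
    using f.generate_img[of S] by simp
  also have "\<dots> = (h \<circ> g) ` carrier ?F"
    using W.generate_consistent[OF \<open>S \<subseteq> generate W S\<close> sub] by simp
  also have "\<dots> = carrier P" using epiD[OF iso_epi[OF P(2)]] by blast
  finally have "finitely_generated P"
    unfolding finitely_generated_def using assms(2) \<open>S \<subseteq> generate W S\<close>
    by (intro exI[of _ "(h \<circ> g) ` S"]) (use f.hom_closed in auto)
  moreover obtain i where "i \<in> iso P ?F" by (rule iso_inverse[OF gF P(2)])
  ultimately show ?thesis using that P(1) by blast
qed

lemma sum_embeds_iso:
  assumes "sum_embeds H ((=) P)" "group H" "group P" "group F" "i \<in> iso P F"
  shows "sum_embeds H ((=) F)"
proof (rule sum_embeds_trans[OF assms(1,2)])
  have "sum_embeds P ((=) F)"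
    by (rule sum_embeds_mon[where C = "(=) F", OF assms(4,3) refl iso_mon[OF assms(5)]])
  then show "sum_embeds R ((=) F)" if "P = R" for R using that by simp
qed

section \<open>Finitely generated wreath products\<close>

context wreath_product
begin

text \<open>When the two sets generate \<open>K\<close> and \<open>Q\<close>, this is the restricted
  wreath product: conjugation by the top group moves the copy of \<open>K\<close> at the unit to
  every position. The form by generators makes finite generation evident for finite sets.\<close>

definition wgen :: "'k set \<Rightarrow> 'q set \<Rightarrow> (('q \<Rightarrow> 'k) \<times> 'q) set" where
  "wgen SK SQ = generate W (delta \<one>\<^bsub>Q\<^esub> ` SK \<union> lift ` SQ)"

context
  fixes SK SQ
  assumes SK: "SK \<subseteq> carrier K" "generate K SK = carrier K"
    and SQ: "SQ \<subseteq> carrier Q" "generate Q SQ = carrier Q"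
begin

interpretation d: group_hom K W "delta \<one>\<^bsub>Q\<^esub>"
  by (rule group_homI[OF K W_group conjunct1[OF monD[OF delta_mon]]]) simp

interpretation t: group_hom Q W lift
  by (rule group_homI[OF Q W_group conjunct1[OF monD[OF lift_mon]]])

lemma gens_closed: "delta \<one>\<^bsub>Q\<^esub> ` SK \<union> lift ` SQ \<subseteq> carrier W"
  using SK(1) SQ(1) by auto

lemma wgen_subgroup: "subgroup (wgen SK SQ) W"
  unfolding wgen_def by (rule W.generate_is_subgroup[OF gens_closed])

lemma delta_in_wgen: "k \<in> carrier K \<Longrightarrow> delta \<one>\<^bsub>Q\<^esub> k \<in> wgen SK SQ"
proof -
  assume "k \<in> carrier K"
  then have "delta \<one>\<^bsub>Q\<^esub> k \<in> generate W (delta \<one>\<^bsub>Q\<^esub> ` SK)"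
    using d.generate_img[OF SK(1)] SK(2) by auto
  then show ?thesis unfolding wgen_def using W.mono_generate[of "delta \<one>\<^bsub>Q\<^esub> ` SK"] by blast
qed

lemma lift_in_wgen: "q \<in> carrier Q \<Longrightarrow> lift q \<in> wgen SK SQ"
proof -
  assume "q \<in> carrier Q"
  then have "lift q \<in> generate W (lift ` SQ)"
    using t.generate_img[OF SQ(1)] SQ(2) by auto
  then show ?thesis unfolding wgen_def using W.mono_generate[of "lift ` SQ"] by blast
qed

lemma wgen_finsupp: "wgen SK SQ \<subseteq> finsupp"
proof -
  have "delta \<one>\<^bsub>Q\<^esub> k \<in> finsupp" if "k \<in> carrier K" for k
  proof -
    have "{x \<in> carrier Q. fst (delta \<one>\<^bsub>Q\<^esub> k) x \<noteq> \<one>\<^bsub>K\<^esub>} \<subseteq> {\<one>\<^bsub>Q\<^esub>}" by (auto split: if_splits)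
    then show ?thesis using that finite_subset by (auto simp: finsupp_def)
  qed
  moreover have "lift q \<in> finsupp" if "q \<in> carrier Q" for q
    using that by (simp add: finsupp_def cong: conj_cong)
  ultimately show ?thesis
    unfolding wgen_def using SK(1) SQ(1)
    by (intro W.generate_subgroup_incl finsupp_subgroup) auto
qed

text \<open>The kernel of the projection to \<open>Q\<close> lies in a restricted power of
  \<open>K\<close>, so \<open>sum_embeds_extension\<close> bounds all restricted powers of the
  wreath product together.\<close>

lemma wgen_EG:
  fixes H :: "'a monoid" and \<beta> :: "'b::infinite ordinal"
  assumes "group H" "sum_embeds H ((=) (W\<lparr>carrier := wgen SK SQ\<rparr>))"
    and UK: "\<And>N :: 'a monoid. group N \<Longrightarrow> sum_embeds N ((=) K) \<Longrightarrow> EG \<beta> N"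
    and UQ: "\<And>N :: 'a monoid. group N \<Longrightarrow> sum_embeds N ((=) Q) \<Longrightarrow> EG \<beta> N"
  shows "EG (osucc \<beta>) H"
proof -
  let ?F = "W\<lparr>carrier := wgen SK SQ\<rparr>"
  have gF: "group ?F" by (rule subgroup.subgroup_is_group[OF wgen_subgroup W_group])
  have hom: "snd \<in> hom ?F Q"
    by (rule hom_restrict_domain[OF snd_hom subgroup.subset[OF wgen_subgroup]])
  interpret s: group_hom ?F Q snd by (rule group_homI[OF gF Q hom])
  show ?thesis
  proof (rule sum_embeds_extension[OF assms(1) gF Q hom assms(2) _ UQ])
    fix N :: "'a monoid" assume N: "group N" "sum_embeds N ((=) (?F\<lparr>carrier := kernel ?F Q snd\<rparr>))"
    let ?A = "kernel ?F Q snd"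
    have A: "subgroup ?A W"
      using W.incl_subgroup[OF wgen_subgroup s.subgroup_kernel] .
    have "sum_embeds (W\<lparr>carrier := ?A\<rparr>) ((=) K)"
      by (rule sum_embeds_base[OF A]) (use wgen_finsupp in \<open>auto simp: kernel_def\<close>)
    \<comment> \<open>A power of a subgroup of a power of \<open>K\<close> is again inside a power
      of \<open>K\<close>.\<close>
    then have "sum_embeds N ((=) K)"
      using sum_embeds_trans[OF N(2,1), of "(=) K"] by simp
    then show "EG \<beta> N" by (rule UK[OF N(1)])
  qed
qed

end

text \<open>Only an extension could put the finitely generated \<open>P\<close> into the next class.
  The case split asks whether its kernel moves positions: an element that does can rebuild a full
  coordinate from commutators, since conjugation by it carries the copy of \<open>K\<close> at the
  unit elsewhere.\<close>

lemma wgen_not_EG: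
  fixes P K' Q' :: "'a monoid" and \<alpha> :: "'b::infinite ordinal"
  assumes SK: "SK \<subseteq> carrier K" "generate K SK = carrier K"
    and SQ: "SQ \<subseteq> carrier Q" "generate Q SQ = carrier Q"
    and P: "group P" "finitely_generated P" "i \<in> iso P (W\<lparr>carrier := wgen SK SQ\<rparr>)"
    and K': "group K'" "\<not> EG \<alpha> K'" "k \<in> iso K K'"
    and Q': "group Q'" "\<not> EG \<alpha> Q'" "l \<in> iso Q Q'"
  shows "\<not> EG (osucc \<alpha>) P"
proof
  assume E: "EG (osucc \<alpha>) P"
  interpret P: group P by fact
  let ?T = "wgen SK SQ"
  have Ts: "subgroup ?T W" by (rule wgen_subgroup[OF SK SQ])
  have TW: "?T \<subseteq> carrier W" by (rule subgroup.subset[OF Ts])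
  have iT: "i ` carrier P = ?T" using epiD[OF iso_epi[OF P(3)]] by simp
  have iW: "i \<in> hom P W"
    using conjunct1[OF epiD[OF iso_epi[OF P(3)]]] TW by (auto simp: hom_def)
  interpret i: group_hom P W i by (rule group_homI[OF P(1) W_group iW])
  define lift_map where "lift_map = l \<circ> (snd \<circ> i)"
  have si: "snd \<circ> i \<in> hom P Q" by (rule Group.hom_compose[OF iW snd_hom])
  have "(snd \<circ> i) ` carrier P = carrier Q"
  proof
    show "(snd \<circ> i) ` carrier P \<subseteq> carrier Q" using si by (auto simp: hom_def)
    show "carrier Q \<subseteq> (snd \<circ> i) ` carrier P"
    proof
      fix q assume "q \<in> carrier Q"
      then have "lift q \<in> i ` carrier P" unfolding iT by (rule lift_in_wgen[OF SK SQ])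
      then show "q \<in> (snd \<circ> i) ` carrier P" by (metis comp_apply image_iff lift_simps(1))
    qed
  qed
  with si have "snd \<circ> i \<in> epi P Q" by (simp add: epi_def)
  then have tm: "lift_map \<in> epi P Q'" unfolding lift_map_def by (rule epi_compose[OF _ iso_epi[OF Q'(3)]])
  \<comment> \<open>As \<open>P\<close> maps onto \<open>Q'\<close>, it is outside
    \<open>EG \<alpha>\<close>, and the extension alternative of \<open>EG_osucc_fg\<close>
    remains.\<close>
  have notP: "\<not> EG \<alpha> P" using EG_epi[OF _ Q'(1) tm] Q'(2) by blast
  then obtain A B where AB: "EG \<alpha> A" "EG \<alpha> B" "extension_of P A B"
    using EG_osucc_fg[OF E P(2)] by blast
  have gB: "group B" by (rule EG_group[OF AB(2)])
  obtain p j where p: "p \<in> epi P B" and j: "j \<in> iso (P\<lparr>carrier := kernel P B p\<rparr>) A"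
    using extension_ofE[OF AB(3) gB] by metis
  interpret p: group_hom P B p by (rule group_homI[OF P(1) gB conjunct1[OF epiD[OF p]]])
  define N where "N = kernel P B p"
  have N: "subgroup N P" unfolding N_def by (rule p.subgroup_kernel)
  have Nnormal: "N \<lhd> P" unfolding N_def by (rule p.normal_kernel)
  have NEG: "EG \<alpha> (P\<lparr>carrier := N\<rparr>)"
    unfolding N_def
    by (rule EG_mon[OF AB(1) _ iso_mon[OF j]]) (rule subgroup.subgroup_is_group[OF p.subgroup_kernel P(1)])
  show False
  proof (cases "N \<subseteq> kernel P Q' lift_map")
    case True
    obtain s where s: "s \<in> hom B Q'" "\<And>x. x \<in> carrier P \<Longrightarrow> s (p x) = lift_map x"
      using hom_factor[OF P(1) gB Q'(1) p conjunct1[OF epiD[OF tm]] True[unfolded N_def]] by metis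
    have "s ` carrier B = s ` p ` carrier P" using epiD[OF p] by simp
    also have "\<dots> = lift_map ` carrier P" using s(2) by (auto simp: image_iff)
    finally have "s \<in> epi B Q'" using s(1) epiD[OF tm] by (simp add: epi_def)
    then show False using EG_epi[OF AB(2) Q'(1)] Q'(2) by blast
  next
    case False
    then obtain n where n: "n \<in> N" "lift_map n \<noteq> \<one>\<^bsub>Q'\<^esub>"
      using subgroup.subset[OF N] by (auto simp: kernel_def)
    have nP: "n \<in> carrier P" using n(1) subgroup.subset[OF N] by blast
    have "l \<one>\<^bsub>Q\<^esub> = \<one>\<^bsub>Q'\<^esub>"
      by (rule hom_one[OF _ Q Q'(1)]) (use Q'(3) in \<open>simp add: iso_def\<close>)
    then have nq: "snd (i n) \<noteq> \<one>\<^bsub>Q\<^esub>" using n(2) by (auto simp: lift_map_def)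
    \<comment> \<open>On the part of \<open>N\<close> inside the base, evaluation at the unit
      position is a homomorphism; on \<open>N\<close> itself it need not be.\<close>
    define N0 where "N0 = {x \<in> N. snd (i x) = \<one>\<^bsub>Q\<^esub>}"
    define e where "e x = fst (i x) \<one>\<^bsub>Q\<^esub>" for x
    have N0P: "N0 \<subseteq> carrier P" using subgroup.subset[OF N] by (auto simp: N0_def)
    have sN0: "subgroup N0 P"
    proof (rule P.subgroupI[OF N0P])
      have "\<one>\<^bsub>P\<^esub> \<in> N0" using subgroup.one_closed[OF N] by (simp add: N0_def)
      then show "N0 \<noteq> {}" by blast
      fix x assume x: "x \<in> N0"
      then have xP: "x \<in> carrier P" using N0P by blast
      show "inv\<^bsub>P\<^esub> x \<in> N0"
        using x xP subgroup.m_inv_closed[OF N, of x] by (simp add: N0_def)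
      fix y assume y: "y \<in> N0"
      then have yP: "y \<in> carrier P" using N0P by blast
      show "x \<otimes>\<^bsub>P\<^esub> y \<in> N0"
        using x y xP yP subgroup.m_closed[OF N, of x y] by (simp add: N0_def)
    qed
    have e: "e \<in> hom (P\<lparr>carrier := N0\<rparr>) K"
    proof (rule homI)
      fix x y assume "x \<in> carrier (P\<lparr>carrier := N0\<rparr>)" "y \<in> carrier (P\<lparr>carrier := N0\<rparr>)"
      then have "x \<in> carrier P" "y \<in> carrier P" "snd (i x) = \<one>\<^bsub>Q\<^esub>"
        using N0P by (auto simp: N0_def)
      then show "e x \<in> carrier K"
        "e (x \<otimes>\<^bsub>P\<lparr>carrier := N0\<rparr>\<^esub> y) = e x \<otimes>\<^bsub>K\<^esub> e y" by (simp_all add: e_def)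
    qed
    have "carrier K \<subseteq> e ` N0"
    proof
      fix k assume k: "k \<in> carrier K"
      \<comment> \<open>In \<open>n d n^-1 d^-1\<close> the first \<open>d\<close> is read at
        position \<open>snd (i n)\<close>, away from its support, and the contributions of
        \<open>n\<close> and \<open>n^-1\<close> cancel. At the unit only \<open>d^-1\<close>
        remains, with value \<open>k\<close>; hence the inverse in the choice of
        \<open>d\<close>.\<close>
      have "delta \<one>\<^bsub>Q\<^esub> (inv\<^bsub>K\<^esub> k) \<in> i ` carrier P"
        unfolding iT using k by (intro delta_in_wgen[OF SK SQ]) simp
      then obtain d where d: "d \<in> carrier P" "i d = delta \<one>\<^bsub>Q\<^esub> (inv\<^bsub>K\<^esub> k)" by force
      let ?c = "n \<otimes>\<^bsub>P\<^esub> (d \<otimes>\<^bsub>P\<^esub> inv\<^bsub>P\<^esub> n \<otimes>\<^bsub>P\<^esub> inv\<^bsub>P\<^esub> d)"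
      have "d \<otimes>\<^bsub>P\<^esub> inv\<^bsub>P\<^esub> n \<otimes>\<^bsub>P\<^esub> inv\<^bsub>P\<^esub> d \<in> N"
        using Nnormal d(1) subgroup.m_inv_closed[OF N n(1)] by (simp add: P.normal_inv_iff)
      then have cN: "?c \<in> N" by (rule subgroup.m_closed[OF N n(1)])
      have iP: "i n \<in> carrier W" using nP by simp
      have snd0: "snd (i ?c) = \<one>\<^bsub>Q\<^esub>" using nP d k by simp
      have "fst (i ?c) \<one>\<^bsub>Q\<^esub> = k" using nP d k nq fst_closed[OF iP Q.one_closed] by (simp add: K.m_assoc[symmetric])
      then have "k = e ?c" by (simp add: e_def)
      moreover have "?c \<in> N0" using cN snd0 by (simp add: N0_def)
      ultimately show "k \<in> e ` N0" by (rule image_eqI)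
    qed
    then have "e \<in> epi (P\<lparr>carrier := N0\<rparr>) K" using e by (auto simp: epi_def hom_def)
    then have "k \<circ> e \<in> epi (P\<lparr>carrier := N0\<rparr>) K'" by (rule epi_compose[OF _ iso_epi[OF K'(3)]])
    moreover have "(\<lambda>x. x) \<in> mon (P\<lparr>carrier := N0\<rparr>) (P\<lparr>carrier := N\<rparr>)"
      by (auto simp: mon_def hom_def N0_def)
    then have "EG \<alpha> (P\<lparr>carrier := N0\<rparr>)"
      using EG_mon[OF NEG subgroup.subgroup_is_group[OF sN0 P(1)]] by blast
    ultimately show False using EG_epi[OF _ K'(1)] K'(2) by blast
  qed
qed

end

lemma seed_osucc:
  fixes P :: "'a::infinite monoid"
  assumes "seed \<alpha> P"
  shows "\<exists>P'. seed (osucc \<alpha>) (P' :: 'a monoid)"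
proof -
  have P: "group P" "\<not> EG \<alpha> P"
    "\<And>H :: 'a monoid. group H \<Longrightarrow> sum_embeds H ((=) P) \<Longrightarrow> EG (osucc \<alpha>) H"
    using assms by (auto simp: seed_def)
  obtain S where S: "finite S" "S \<subseteq> carrier P" "generate P S = carrier P"
    using assms by (auto simp: seed_def finitely_generated_def)
  interpret wreath_product P P by (rule wreath_product.intro[OF P(1) P(1)])
  let ?F = "W\<lparr>carrier := wgen S S\<rparr>"
  have gF: "group ?F" by (rule subgroup.subgroup_is_group[OF wgen_subgroup[OF S(2,3,2,3)] W_group])
  obtain P' :: "'a monoid" and i where P': "group P'" "finitely_generated P'" "i \<in> iso P' ?F"
    using fg_copy[OF W_group, of "delta \<one>\<^bsub>P\<^esub> ` S \<union> lift ` S"] S(1) gens_closed[OF S(2,3,2,3)]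
    unfolding wgen_def[symmetric] by blast
  have "\<not> EG (osucc \<alpha>) P'"
    by (rule wgen_not_EG[OF S(2,3,2,3) P' P(1,2) iso_set_refl P(1,2) iso_set_refl])
  moreover have "EG (osucc (osucc \<alpha>)) H" if H: "group H" "sum_embeds H ((=) P')" for H :: "'a monoid"
    using wgen_EG[OF S(2,3,2,3) H(1) sum_embeds_iso[OF H(2,1) P'(1) gF P'(3)] P(3) P(3)] .
  ultimately show ?thesis using P' by (auto simp: seed_def)
qed

text \<open>Restricted powers of the integers are abelian, so base and top both have class 0 and one
  extension suffices. The wreath product is infinite and not commutative, hence outside
  \<open>EG 0\<close>.\<close>

lemma seed_zero: "\<exists>P. seed 0 (P :: 'a::infinite monoid)"
proof -
  interpret wreath_product integer_group integer_group by (rule wreath_product.intro) simp_all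
  have S: "{1} \<subseteq> carrier integer_group" "generate integer_group {1} = carrier integer_group"
    using group.generate_pow[OF group_integer_group, of 1] by auto
  let ?F = "W\<lparr>carrier := wgen {1} {1}\<rparr>"
  have sF: "subgroup (wgen {1} {1}) W" by (rule wgen_subgroup[OF S S])
  have gF: "group ?F" by (rule subgroup.subgroup_is_group[OF sF W_group])
  obtain P :: "'a monoid" and i where P: "group P" "finitely_generated P" "i \<in> iso P ?F"
    using fg_copy[OF W_group, of "delta \<one>\<^bsub>integer_group\<^esub> ` {1} \<union> lift ` {1}"] gens_closed[OF S S]
    unfolding wgen_def[symmetric] by blast
  obtain j where j: "j \<in> iso ?F P" by (rule iso_inverse[OF P(1,3)])
  have "\<not> EG (0 :: 'a set ordinal) P"
  proof
    assume "EG (0 :: 'a set ordinal) P"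
    then consider "finite (carrier P)" | "comm_group P" by (auto simp: EG_zero_iff)
    then show False
    proof cases
      case 1
      have "i ` carrier P = wgen {1} {1}" using epiD[OF iso_epi[OF P(3)]] by simp
      then have "finite (wgen {1} {1})" using 1 by (metis finite_imageI)
      moreover have "lift ` UNIV \<subseteq> wgen {1} {1}" using lift_in_wgen[OF S S] by auto
      ultimately have "finite (lift ` UNIV)" by (rule finite_subset[rotated])
      then show False using monD[OF lift_mon] finite_imageD by fastforce
    next
      case 2
      then interpret F: comm_group ?F by (rule mon_comm_group[OF gF _ iso_mon[OF j]])
      have "delta 0 1 \<in> carrier ?F" using delta_in_wgen[OF S S, of 1] by simp
      moreover have "lift 1 \<in> carrier ?F" using lift_in_wgen[OF S S, of 1] by simp
      ultimately have "delta 0 1 \<otimes>\<^bsub>W\<^esub> lift 1 = lift 1 \<otimes>\<^bsub>W\<^esub> delta 0 1"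
        using F.m_comm by fastforce
      \<comment> \<open>The shift by \<open>lift 1\<close> moves the support away from 0, so the two
        products take the values 1 and 0 there.\<close>
      then have "fst (delta 0 1 \<otimes>\<^bsub>W\<^esub> lift 1) 0 = fst (lift 1 \<otimes>\<^bsub>W\<^esub> delta 0 1) 0" by simp
      then show False by simp
    qed
  qed
  moreover have "EG (osucc (0 :: 'a set ordinal)) H" if H: "group H" "sum_embeds H ((=) P)" for H :: "'a monoid"
  proof (rule wgen_EG[OF S S H(1) sum_embeds_iso[OF H(2,1) P(1) gF P(3)]])
    have "EG (0 :: 'a set ordinal) N" if N: "group N" "sum_embeds N ((=) integer_group)" for N :: "'a monoid"
    proof (rule EG.zero_abelian, rule sum_embeds_comm[OF _ N(1)], rule sum_embeds_trans[OF N(2,1)])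
      have "sum_embeds integer_group (comm_group :: int monoid \<Rightarrow> bool)"
        by (rule sum_embeds_mon[where C = comm_group, OF group_integer_group group_integer_group abelian_integer_group
          iso_mon[OF iso_set_refl]])
      then show "sum_embeds R (comm_group :: int monoid \<Rightarrow> bool)" if "integer_group = R" for R
        using that by simp
    qed
    then show "EG (0 :: 'a set ordinal) N" "EG (0 :: 'a set ordinal) N"
      if "group N" "sum_embeds N ((=) integer_group)" for N :: "'a monoid" using that by blast+
  qed
  ultimately show ?thesis using P by (auto simp: seed_def)
qed

section \<open>Limit ordinals\<close>

text \<open>If \<open>b < d\<close>, the left side is at most \<open>2 ^ Suc b\<close>, hence at
  most \<open>2 ^ d\<close>, which is strictly below the right side. So the larger exponents
  agree.\<close>

lemma power2_sum_unique:
  assumes "(2::int) ^ a + 2 ^ b = 2 ^ c + 2 ^ d" "a \<le> b" "c \<le> d"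
  shows "a = c \<and> b = d"
proof -
  have *: "\<not> b < d" if "(2::int) ^ a + 2 ^ b = 2 ^ c + 2 ^ d" "a \<le> b" for a b c d :: nat
  proof
    assume "b < d"
    then have "(2::int) ^ Suc b \<le> 2 ^ d" by (intro power_increasing) auto
    moreover have "(2::int) ^ a \<le> 2 ^ b" using that(2) by (intro power_increasing) auto
    moreover have "(0::int) < 2 ^ c" by simp
    ultimately show False using that(1) by simp
  qed
  have "b = d" using *[OF assms(1,2)] *[OF assms(1)[symmetric] assms(3)] by simp
  then show ?thesis using assms(1) by simp
qed

text \<open>Moving terms across gives two equal sums of two powers. Besides the claimed match only
  \<open>i = j\<close> with \<open>l = m\<close> would be possible, and \<open>i \<noteq> j\<close>
  excludes it.\<close>

lemma power2_diff_unique: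
  assumes "(2::int) ^ i - 2 ^ j = 2 ^ m - 2 ^ l" "i \<noteq> j"
  shows "i = m" "j = l"
proof -
  have "(2::int) ^ min i l + 2 ^ max i l = 2 ^ min m j + 2 ^ max m j"
    using assms(1) by (auto simp: min_def max_def)
  then have "min i l = min m j \<and> max i l = max m j" by (rule power2_sum_unique) auto
  then show "i = m" "j = l" using assms(2) by (auto simp: min_def max_def split: if_splits)
qed

lemma (in group) cyclic_commutator:
  assumes "k \<in> carrier G" "x \<in> generate G {k}" "y \<in> generate G {k}"
  shows "x \<otimes> y \<otimes> inv x \<otimes> inv y = \<one>"
proof -
  obtain m n :: int where mn: "x = k [^] m" "y = k [^] n" using assms generate_pow by blast
  then have "x \<otimes> y = y \<otimes> x" using assms(1) by (simp add: int_pow_mult[symmetric] add.commute)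
  then have "x \<otimes> y \<otimes> inv x \<otimes> inv y = y \<otimes> x \<otimes> inv x \<otimes> inv y" by simp
  also have "\<dots> = \<one>" using mn assms(1) by (simp add: m_assoc)
  finally show ?thesis .
qed

lemma (in group_hom) derived_subset_kernel:
  assumes "comm_group H"
  shows "derived G (carrier G) \<subseteq> kernel G H h"
proof -
  interpret C: comm_group H by fact
  have "h (x \<otimes> y \<otimes> inv x \<otimes> inv y) = \<one>\<^bsub>H\<^esub>" if "x \<in> carrier G" "y \<in> carrier G" for x y
  proof -
    have "h x \<otimes>\<^bsub>H\<^esub> h y = h y \<otimes>\<^bsub>H\<^esub> h x" using that by (simp add: C.m_comm)
    then show ?thesis using that by (simp add: H.m_assoc)
  qed
  then show ?thesis
    unfolding derived_def by (intro G.generate_subgroup_incl subgroup_kernel) (auto simp: kernel_def)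
qed

text \<open>
  The generator \<open>b\<close> places the elements \<open>\<kappa> n\<close> at the Sidon set of powers of two, so that the
  supports of two different translates of \<open>b\<close> have at most one point in common.
\<close>

locale sparse_wreath =
  fixes K :: "'k monoid" and \<kappa> :: "nat \<Rightarrow> 'k"
  assumes K_group: "group K" and \<kappa>: "\<kappa> n \<in> carrier K"
begin

sublocale wreath_product K integer_group
  by (rule wreath_product.intro[OF K_group group_integer_group])

definition \<sigma> :: "int \<Rightarrow> 'k" where
  "\<sigma> x = (if \<exists>n. x = 2 ^ n then \<kappa> (THE n. x = 2 ^ n) else \<one>\<^bsub>K\<^esub>)"

lemma \<sigma>_power [simp]: "\<sigma> (2 ^ n) = \<kappa> n"
  by (auto simp: \<sigma>_def)

lemma \<sigma>_neq_one: "\<sigma> x \<noteq> \<one>\<^bsub>K\<^esub> \<Longrightarrow> \<exists>n. x = 2 ^ n"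
  by (auto simp: \<sigma>_def split: if_splits)

lemma \<sigma>_closed [simp]: "\<sigma> x \<in> carrier K"
  using \<kappa> by (simp add: \<sigma>_def)

text \<open>At such a point \<open>c - d\<close> is a difference of two distinct powers of two. It
  determines the powers, and thereby the point.\<close>

lemma \<sigma>_sparse:
  assumes "\<sigma> (x + c) \<noteq> \<one>\<^bsub>K\<^esub>" "\<sigma> (x + d) \<noteq> \<one>\<^bsub>K\<^esub>" "\<sigma> (y + c) \<noteq> \<one>\<^bsub>K\<^esub>" "\<sigma> (y + d) \<noteq> \<one>\<^bsub>K\<^esub>" "c \<noteq> d"
  shows "x = y"
proof -
  obtain i j m l where *: "x + c = 2 ^ i" "x + d = 2 ^ j" "y + c = 2 ^ m" "y + d = 2 ^ l"
    using assms(1-4) \<sigma>_neq_one by metis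
  have "i \<noteq> j" using * assms(5) by auto
  moreover have "(2::int) ^ i - 2 ^ j = 2 ^ m - 2 ^ l" using * by linarith
  ultimately have "i = m" by (rule power2_diff_unique(1)[rotated])
  then show ?thesis using * by simp
qed

text \<open>This element of the unrestricted base may have infinite support; that is how one
  generator carries all values of \<open>\<kappa>\<close>.\<close>

definition b :: "(int \<Rightarrow> 'k) \<times> int" where "b = (\<sigma>, 0)"

lemma b_simps [simp]: "fst b = \<sigma>" "snd b = 0" "b \<in> carrier W"
  by (auto simp: b_def W_carrier)

definition T :: "((int \<Rightarrow> 'k) \<times> int) set" where "T = generate W {b, lift 1}"

lemma gens: "{b, lift 1} \<subseteq> carrier W" by simp

lemma T_subgroup: "subgroup T W"
  unfolding T_def by (rule W.generate_is_subgroup[OF gens])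

lemma T_closed: "u \<in> T \<Longrightarrow> u \<in> carrier W"
  using subgroup.subset[OF T_subgroup] by blast

lemma lift_T: "lift c \<in> T"
proof -
  interpret t: group_hom integer_group W lift
    by (rule group_homI[OF group_integer_group W_group conjunct1[OF monD[OF lift_mon]]])
  have "generate integer_group {1} = UNIV" using Q.generate_pow[of 1] by auto
  then have "lift c \<in> generate W (lift ` {1})" using t.generate_img[of "{1}"] by auto
  then show ?thesis unfolding T_def using W.mono_generate[of "lift ` {1}" "{b, lift 1}"] by auto
qed

lemma b_T: "b \<in> T" unfolding T_def by (rule generate.incl) simp

definition translate :: "int \<Rightarrow> (int \<Rightarrow> 'k) \<times> int" where
  "translate c = lift c \<otimes>\<^bsub>W\<^esub> b \<otimes>\<^bsub>W\<^esub> inv\<^bsub>W\<^esub> lift c"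

lemma translate_T: "translate c \<in> T"
  unfolding translate_def
  by (intro subgroup.m_closed[OF T_subgroup] subgroup.m_inv_closed[OF T_subgroup] b_T lift_T)

lemma translate_simps [simp]: "fst (translate c) x = \<sigma> (x + c)" "snd (translate c) = 0"
  "translate c \<in> carrier W"
  by (simp_all add: translate_def)

lemma fst_commutator:
  assumes "u \<in> carrier W" "v \<in> carrier W" "snd u = 0" "snd v = 0"
  shows "fst (u \<otimes>\<^bsub>W\<^esub> v \<otimes>\<^bsub>W\<^esub> inv\<^bsub>W\<^esub> u \<otimes>\<^bsub>W\<^esub> inv\<^bsub>W\<^esub> v) x =
    fst u x \<otimes>\<^bsub>K\<^esub> fst v x \<otimes>\<^bsub>K\<^esub> inv\<^bsub>K\<^esub> fst u x \<otimes>\<^bsub>K\<^esub> inv\<^bsub>K\<^esub> fst v x"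
  using assms by simp

text \<open>Translation by \<open>2 ^ i\<close> brings the value \<open>\<kappa> i\<close> to
  position 0. For distinct exponents the two translates are both nontrivial at no other position, so
  their commutator is concentrated at 0.\<close>

lemma delta_commutator_T:
  "delta 0 (\<kappa> i \<otimes>\<^bsub>K\<^esub> \<kappa> j \<otimes>\<^bsub>K\<^esub> inv\<^bsub>K\<^esub> \<kappa> i \<otimes>\<^bsub>K\<^esub> inv\<^bsub>K\<^esub> \<kappa> j) \<in> T"
proof (cases "i = j")
  case True
  have "delta 0 \<one>\<^bsub>K\<^esub> = \<one>\<^bsub>W\<^esub>" by (rule W_eqI) auto
  then show ?thesis using True \<kappa> subgroup.one_closed[OF T_subgroup] by (simp add: K.m_assoc)
next
  case False
  let ?u = "translate (2 ^ i)" and ?v = "translate (2 ^ j)"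
  let ?c = "?u \<otimes>\<^bsub>W\<^esub> ?v \<otimes>\<^bsub>W\<^esub> inv\<^bsub>W\<^esub> ?u \<otimes>\<^bsub>W\<^esub> inv\<^bsub>W\<^esub> ?v"
  have "?c \<in> T"
    by (intro subgroup.m_closed[OF T_subgroup] subgroup.m_inv_closed[OF T_subgroup] translate_T)
  moreover have "?c = delta 0 (\<kappa> i \<otimes>\<^bsub>K\<^esub> \<kappa> j \<otimes>\<^bsub>K\<^esub> inv\<^bsub>K\<^esub> \<kappa> i \<otimes>\<^bsub>K\<^esub> inv\<^bsub>K\<^esub> \<kappa> j)"
  proof (rule W_eqI)
    fix x :: int
    have fc: "fst ?c x = \<sigma> (x + 2 ^ i) \<otimes>\<^bsub>K\<^esub> \<sigma> (x + 2 ^ j) \<otimes>\<^bsub>K\<^esub>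
        inv\<^bsub>K\<^esub> \<sigma> (x + 2 ^ i) \<otimes>\<^bsub>K\<^esub> inv\<^bsub>K\<^esub> \<sigma> (x + 2 ^ j)"
      by (subst fst_commutator) auto
    show "fst ?c x = fst (delta 0 (\<kappa> i \<otimes>\<^bsub>K\<^esub> \<kappa> j \<otimes>\<^bsub>K\<^esub> inv\<^bsub>K\<^esub> \<kappa> i \<otimes>\<^bsub>K\<^esub> inv\<^bsub>K\<^esub> \<kappa> j)) x"
    proof (cases "x = 0")
      case True
      then show ?thesis using fc by simp
    next
      case x0: False
      have "\<sigma> (x + 2 ^ i) = \<one>\<^bsub>K\<^esub> \<or> \<sigma> (x + 2 ^ j) = \<one>\<^bsub>K\<^esub>"
      proof (rule ccontr)
        assume "\<not> ?thesis"
        then obtain m l where *: "x + 2 ^ i = 2 ^ m" "x + 2 ^ j = 2 ^ l" using \<sigma>_neq_one by metis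
        then have "(2::int) ^ i - 2 ^ j = 2 ^ m - 2 ^ l" by linarith
        then have "i = m" using False by (rule power2_diff_unique(1))
        then show False using * x0 by simp
      qed
      then show ?thesis unfolding fc using x0 by auto
    qed
  qed (use \<kappa> in auto)
  ultimately show ?thesis by simp
qed

text \<open>A word in the generators reads \<open>\<sigma>\<close> at finitely many offsets, and
  these depend on the word but not on the position \<open>x\<close>. The uniformity in
  \<open>x\<close> is what later confines the exceptional positions to a finite set.\<close>

lemma T_values:
  assumes "u \<in> T"
  shows "\<exists>E. finite E \<and> (\<forall>x. fst u x \<in> generate K ((\<lambda>e. \<sigma> (x + e)) ` E))"
  using assms[unfolded T_def]
proof induction
  case one
  show ?case by (rule exI[of _ "{}"]) (auto intro: generate.one)
next
  case (incl h)
  then consider "h = b" | "h = lift 1" by blast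
  then show ?case
  proof cases
    case 1
    then show ?thesis by (intro exI[of _ "{0}"]) (auto intro: generate.incl)
  next
    case 2
    then show ?thesis by (intro exI[of _ "{}"]) (auto intro: generate.one)
  qed
next
  case (inv h)
  then consider "h = b" | "h = lift 1" by blast
  then show ?case
  proof cases
    case 1
    then show ?thesis by (intro exI[of _ "{0}"]) (auto intro: generate.inv)
  next
    case 2
    then show ?thesis by (intro exI[of _ "{}"]) (auto intro: generate.one)
  qed
next
  case (eng u v)
  obtain E F where E: "finite E" "\<And>x. fst u x \<in> generate K ((\<lambda>e. \<sigma> (x + e)) ` E)"
    and F: "finite F" "\<And>x. fst v x \<in> generate K ((\<lambda>e. \<sigma> (x + e)) ` F)" using eng.IH by blast
  \<comment> \<open>In a product the second factor is read at \<open>x + snd u\<close>, so its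
    offsets are shifted by \<open>snd u\<close>.\<close>
  have "fst (u \<otimes>\<^bsub>W\<^esub> v) x \<in> generate K ((\<lambda>e. \<sigma> (x + e)) ` (E \<union> (+) (snd u) ` F))" for x
  proof -
    let ?G = "generate K ((\<lambda>e. \<sigma> (x + e)) ` (E \<union> (+) (snd u) ` F))"
    have "fst u x \<in> ?G" by (rule subsetD[OF K.mono_generate E(2)]) auto
    moreover have "(\<lambda>e. \<sigma> (x + snd u + e)) ` F \<subseteq> (\<lambda>e. \<sigma> (x + e)) ` (E \<union> (+) (snd u) ` F)"
      by (auto simp: add.assoc)
    then have "fst v (x + snd u) \<in> ?G" by (rule subsetD[OF K.mono_generate F(2)])
    ultimately show ?thesis by (simp add: generate.eng)
  qed
  then show ?case using E(1) F(1) by (intro exI[of _ "E \<union> (+) (snd u) ` F"]) auto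
qed

text \<open>Outside finitely many positions at most one offset meets a nontrivial value of
  \<open>\<sigma>\<close>. There both \<open>u\<close> and \<open>v\<close> take values in one
  cyclic subgroup, so the commutator is trivial.\<close>

lemma commutator_finsupp:
  assumes "u \<in> T" "v \<in> T" "snd u = 0" "snd v = 0"
  shows "u \<otimes>\<^bsub>W\<^esub> v \<otimes>\<^bsub>W\<^esub> inv\<^bsub>W\<^esub> u \<otimes>\<^bsub>W\<^esub> inv\<^bsub>W\<^esub> v \<in> finsupp"
proof -
  obtain E F where E: "finite E" "\<And>x. fst u x \<in> generate K ((\<lambda>e. \<sigma> (x + e)) ` E)"
    and F: "finite F" "\<And>x. fst v x \<in> generate K ((\<lambda>e. \<sigma> (x + e)) ` F)"
    using T_values[OF assms(1)] T_values[OF assms(2)] by blast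
  let ?E = "E \<union> F"
  define bad where "bad c d = {x. \<sigma> (x + c) \<noteq> \<one>\<^bsub>K\<^esub> \<and> \<sigma> (x + d) \<noteq> \<one>\<^bsub>K\<^esub>}" for c d
  have "finite (bad c d)" if "c \<noteq> d" for c d
  proof (cases "bad c d = {}")
    case False
    then obtain y where "y \<in> bad c d" by blast
    then have "bad c d \<subseteq> {y}" using \<sigma>_sparse[OF _ _ _ _ that] by (auto simp: bad_def)
    then show ?thesis using finite_subset by blast
  qed simp
  then have fin: "finite (\<Union>c\<in>?E. \<Union>d\<in>?E - {c}. bad c d)" using E(1) F(1) by auto
  let ?c = "u \<otimes>\<^bsub>W\<^esub> v \<otimes>\<^bsub>W\<^esub> inv\<^bsub>W\<^esub> u \<otimes>\<^bsub>W\<^esub> inv\<^bsub>W\<^esub> v"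
  have "fst ?c x = \<one>\<^bsub>K\<^esub>" if x: "x \<notin> (\<Union>c\<in>?E. \<Union>d\<in>?E - {c}. bad c d)" for x
  proof -
    have "\<exists>k \<in> carrier K. (\<lambda>e. \<sigma> (x + e)) ` ?E \<subseteq> {\<one>\<^bsub>K\<^esub>, k}"
    proof (cases "\<exists>c\<in>?E. \<sigma> (x + c) \<noteq> \<one>\<^bsub>K\<^esub>")
      case True
      then obtain c where c: "c \<in> ?E" "\<sigma> (x + c) \<noteq> \<one>\<^bsub>K\<^esub>" by blast
      then have "\<sigma> (x + d) \<in> {\<one>\<^bsub>K\<^esub>, \<sigma> (x + c)}" if "d \<in> ?E" for d
        using x that by (cases "c = d") (auto simp: bad_def)
      then show ?thesis by (intro bexI[of _ "\<sigma> (x + c)"]) auto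
    next
      case False
      then show ?thesis by (intro bexI[of _ "\<one>\<^bsub>K\<^esub>"]) auto
    qed
    then obtain k where k: "k \<in> carrier K" "(\<lambda>e. \<sigma> (x + e)) ` ?E \<subseteq> {\<one>\<^bsub>K\<^esub>, k}" by blast
    have gk: "subgroup (generate K {k}) K" using k(1) by (intro K.generate_is_subgroup) simp
    have "{\<one>\<^bsub>K\<^esub>, k} \<subseteq> generate K {k}" by (auto intro: generate.one generate.incl)
    then have *: "generate K ((\<lambda>e. \<sigma> (x + e)) ` A) \<subseteq> generate K {k}" if "A \<subseteq> ?E" for A
      using that k(2) by (intro K.generate_subgroup_incl gk) blast
    have "fst u x \<in> generate K {k}" "fst v x \<in> generate K {k}"
      using E(2)[of x] F(2)[of x] *[of E] *[of F] by blast+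
    then show ?thesis
      unfolding fst_commutator[OF T_closed[OF assms(1)] T_closed[OF assms(2)] assms(3,4)]
      by (rule K.cyclic_commutator[OF k(1)])
  qed
  then have "{x. fst ?c x \<noteq> \<one>\<^bsub>K\<^esub>} \<subseteq> (\<Union>c\<in>?E. \<Union>d\<in>?E - {c}. bad c d)" by blast
  then have "finite {x. fst ?c x \<noteq> \<one>\<^bsub>K\<^esub>}" using fin by (rule finite_subset)
  then show ?thesis using T_closed[OF assms(1)] T_closed[OF assms(2)] by (simp add: finsupp_def)
qed

text \<open>Every homomorphism into \<open>T\<close> sends the derived subgroup into the base,
  because the integers are abelian, and then the second derived subgroup into finitely supported
  elements. Arguing for all homomorphisms covers restricted powers of \<open>T\<close>, as
  \<open>seed\<close> demands.\<close>

lemma sum_embeds_derived2: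
  assumes "group H" "sum_embeds H ((=) (W\<lparr>carrier := T\<rparr>))"
  shows "sum_embeds (H\<lparr>carrier := derived H (derived H (carrier H))\<rparr>) ((=) K)"
proof -
  interpret H: group H by fact
  let ?F = "W\<lparr>carrier := T\<rparr>" and ?D = "derived H (carrier H)"
  have gF: "group ?F" by (rule subgroup.subgroup_is_group[OF T_subgroup W_group])
  interpret s: group_hom W integer_group snd
    by (rule group_homI[OF W_group group_integer_group snd_hom])
  define Z where "Z = T \<inter> finsupp \<inter> kernel W integer_group snd"
  have Z: "subgroup Z W" unfolding Z_def by (intro subgroup_Int T_subgroup finsupp_subgroup s.subgroup_kernel)
  have ZF: "subgroup Z ?F" by (rule W.subgroup_incl[OF Z T_subgroup]) (auto simp: Z_def)
  have D: "?D \<subseteq> carrier H" by (rule H.derived_in_carrier) simp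
  have D2: "subgroup (derived H ?D) H" by (rule H.derived_is_subgroup[OF D])
  have img: "\<phi> ` derived H ?D \<subseteq> Z" if \<phi>: "\<phi> \<in> hom H ?F" for \<phi>
  proof -
    have \<phi>T: "\<phi> x \<in> T" if "x \<in> carrier H" for x using hom_in_carrier[OF \<phi> that] by simp
    have "\<phi> \<in> hom H W"
      by (rule homI) (use T_closed[OF \<phi>T] hom_mult[OF \<phi>] in simp_all)
    then interpret h: group_hom H W \<phi> by (rule group_homI[OF assms(1) W_group])
    interpret sh: group_hom H integer_group "snd \<circ> \<phi>"
      by (rule group_homI[OF assms(1) group_integer_group Group.hom_compose[OF h.homh snd_hom]])
    have s0: "snd (\<phi> x) = 0" if "x \<in> ?D" for x
      using that sh.derived_subset_kernel[OF abelian_integer_group] by (auto simp: kernel_def)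
    have "x \<otimes>\<^bsub>H\<^esub> y \<otimes>\<^bsub>H\<^esub> inv\<^bsub>H\<^esub> x \<otimes>\<^bsub>H\<^esub> inv\<^bsub>H\<^esub> y \<in> {x \<in> carrier H. \<phi> x \<in> Z}"
      if "x \<in> ?D" "y \<in> ?D" for x y
    proof -
      have xy: "x \<in> carrier H" "y \<in> carrier H" using that D by auto
      let ?c = "x \<otimes>\<^bsub>H\<^esub> y \<otimes>\<^bsub>H\<^esub> inv\<^bsub>H\<^esub> x \<otimes>\<^bsub>H\<^esub> inv\<^bsub>H\<^esub> y"
      have c: "?c \<in> carrier H" using xy by simp
      have "\<phi> ?c \<in> finsupp"
        using commutator_finsupp[OF \<phi>T[OF xy(1)] \<phi>T[OF xy(2)] s0[OF that(1)] s0[OF that(2)]] xy by simp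
      moreover have "snd (\<phi> ?c) = 0" using xy s0[OF that(1)] s0[OF that(2)] by simp
      ultimately show ?thesis using c \<phi>T[OF c] by (simp add: Z_def kernel_def)
    qed
    then have "derived H ?D \<subseteq> {x \<in> carrier H. \<phi> x \<in> Z}"
      unfolding derived_def[of H ?D] by (intro H.generate_subgroup_incl h.subgroup_preimage[OF Z]) blast
    then show ?thesis by blast
  qed
  have "sum_embeds (H\<lparr>carrier := derived H ?D\<rparr>) ((=) (?F\<lparr>carrier := Z\<rparr>))"
    by (rule sum_embeds_subgroup[OF assms(1) gF subgroup.subset[OF D2] img D2 ZF assms(2)])
  moreover have "sum_embeds (W\<lparr>carrier := Z\<rparr>) ((=) K)"
    by (rule sum_embeds_base[OF Z]) (auto simp: Z_def kernel_def)
  ultimately show ?thesis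
    using sum_embeds_trans[of "H\<lparr>carrier := derived H ?D\<rparr>" "(=) (?F\<lparr>carrier := Z\<rparr>)" "(=) K"]
      subgroup.subgroup_is_group[OF D2 assms(1)] by simp
qed

end

lemma seed_limit:
  fixes \<mu> :: "'a::infinite set ordinal" and R :: "'a set ordinal \<Rightarrow> 'a monoid"
  assumes \<mu>: "limit_ordinal \<mu>" "\<mu> < omega1"
    and R: "\<And>\<beta>. \<beta> < \<mu> \<Longrightarrow> seed (osucc \<beta>) (R \<beta>)"
  shows "\<exists>P. seed (osucc \<mu>) (P :: 'a monoid)"
proof -
  let ?I = "{\<beta>. \<beta> < \<mu>}"
  have I: "countable ?I" using \<mu>(2) less_omega1_iff by blast
  have gR: "group (R \<beta>)" if "\<beta> \<in> ?I" for \<beta> using R that by (simp add: seed_def)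
  have ER: "EG \<mu> (R \<beta>)" if "\<beta> < \<mu>" for \<beta>
    using EG.limit[OF \<mu>(1) _ seed_EG[OF R[OF that]]] limit_osucc_less[OF \<mu>(1)] that by blast
  define K where "K = sum_group ?I R"
  have gK: "group K" unfolding K_def by (rule sum_group[OF gR])
  have cK: "carrier K = {x \<in> \<Pi>\<^sub>E i\<in>?I. carrier (R i). finite {i \<in> ?I. x i \<noteq> \<one>\<^bsub>R i\<^esub>}}"
    unfolding K_def by (rule carrier_sum_group[OF gR])
  define single where "single \<beta> a = (\<lambda>\<gamma>\<in>?I. if \<gamma> = \<beta> then a else \<one>\<^bsub>R \<gamma>\<^esub>)" for \<beta> a
  have oneR: "\<one>\<^bsub>R \<gamma>\<^esub> \<in> carrier (R \<gamma>)" if "\<gamma> \<in> ?I" for \<gamma>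
    using gR[OF that] by (simp add: group.is_monoid monoid.one_closed)
  have single_closed: "single \<beta> a \<in> carrier K" if "\<beta> \<in> ?I" "a \<in> carrier (R \<beta>)" for \<beta> a
  proof -
    have "finite {i \<in> ?I. single \<beta> a i \<noteq> \<one>\<^bsub>R i\<^esub>}"
      by (rule finite_subset[of _ "{\<beta>}"]) (auto simp: single_def)
    moreover have "single \<beta> a \<in> (\<Pi>\<^sub>E i\<in>?I. carrier (R i))"
      unfolding single_def restrict_PiE_iff using that oneR by auto
    ultimately show ?thesis unfolding cK by blast
  qed
  have single_mon: "single \<beta> \<in> mon (R \<beta>) K" if "\<beta> \<in> ?I" for \<beta>
  proof -
    have "single \<beta> \<in> hom (R \<beta>) K"
    proof (rule homI)
      fix x y assume "x \<in> carrier (R \<beta>)" "y \<in> carrier (R \<beta>)"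
      show "single \<beta> (x \<otimes>\<^bsub>R \<beta>\<^esub> y) = single \<beta> x \<otimes>\<^bsub>K\<^esub> single \<beta> y"
      proof
        fix \<gamma>
        show "single \<beta> (x \<otimes>\<^bsub>R \<beta>\<^esub> y) \<gamma> = (single \<beta> x \<otimes>\<^bsub>K\<^esub> single \<beta> y) \<gamma>"
          using gR[of \<gamma>] oneR[of \<gamma>]
          by (auto simp: single_def K_def group.is_monoid monoid.l_one)
      qed
    qed (rule single_closed[OF that])
    moreover have "inj_on (single \<beta>) (carrier (R \<beta>))"
    proof (rule inj_onI)
      fix x y assume "single \<beta> x = single \<beta> y"
      then have "single \<beta> x \<beta> = single \<beta> y \<beta>" by simp
      then show "x = y" using that by (simp add: single_def)
    qed
    ultimately show ?thesis by (simp add: mon_def)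
  qed
  \<comment> \<open>Only elements of single summands are enumerated, since commutators are later
    taken within one \<open>R \<beta>\<close>. The summands are finitely generated and
    \<open>\<mu>\<close> is countable, so \<open>D\<close> is countable.\<close>
  define D where "D = (\<Union>\<beta>\<in>?I. single \<beta> ` carrier (R \<beta>))"
  have "countable (carrier (R \<beta>))" if "\<beta> \<in> ?I" for \<beta>
    using R that by (intro finitely_generated_countable) (simp add: seed_def)
  then have cD: "countable D" unfolding D_def using I by blast
  have "0 \<in> ?I" using limit_pos[OF \<mu>(1)] by simp
  then have neD: "D \<noteq> {}" unfolding D_def using oneR by blast
  define \<kappa> where "\<kappa> = from_nat_into D"
  have range\<kappa>: "range \<kappa> = D" unfolding \<kappa>_def by (rule range_from_nat_into[OF neD cD])
  have DK: "D \<subseteq> carrier K" unfolding D_def using single_closed by blast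
  interpret sparse_wreath K \<kappa>
    by (rule sparse_wreath.intro[OF gK]) (use range\<kappa> DK in blast)
  let ?F = "W\<lparr>carrier := T\<rparr>"
  have gF: "group ?F" by (rule subgroup.subgroup_is_group[OF T_subgroup W_group])
  obtain P :: "'a monoid" and i where P: "group P" "finitely_generated P" "i \<in> iso P ?F"
    using fg_copy[OF W_group _ gens] unfolding T_def[symmetric] by blast
  obtain j where j: "j \<in> iso ?F P" by (rule iso_inverse[OF P(1,3)])
  \<comment> \<open>What is found inside \<open>T\<close> is the derived subgroup of
    \<open>R \<beta>\<close>, so \<open>EG \<beta> P\<close> bounds \<open>R \<beta>\<close> one
    class higher. This is why \<open>R \<beta>\<close> is a seed for
    \<open>osucc \<beta>\<close>.\<close>
  have lower: "EG (osucc \<beta>) (R \<beta>)" if \<beta>: "\<beta> < \<mu>" and E: "EG \<beta> P" for \<beta>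
  proof -
    have \<beta>I: "\<beta> \<in> ?I" using \<beta> by simp
    have s: "single \<beta> \<in> hom (R \<beta>) K" using monD[OF single_mon[OF \<beta>I]] by blast
    interpret s: group_hom "R \<beta>" K "single \<beta>" by (rule group_homI[OF gR[OF \<beta>I] gK s])
    have dm: "delta 0 \<in> mon K W" by (rule delta_mon) simp
    have hm: "delta 0 \<circ> single \<beta> \<in> mon (R \<beta>) W" by (rule mon_compose[OF single_mon[OF \<beta>I] dm])
    interpret h: group_hom "R \<beta>" W "delta 0 \<circ> single \<beta>"
      by (rule group_homI[OF gR[OF \<beta>I] W_group conjunct1[OF monD[OF hm]]])
    let ?D = "derived (R \<beta>) (carrier (R \<beta>))"
    have "x \<otimes>\<^bsub>R \<beta>\<^esub> y \<otimes>\<^bsub>R \<beta>\<^esub> inv\<^bsub>R \<beta>\<^esub> x \<otimes>\<^bsub>R \<beta>\<^esub> inv\<^bsub>R \<beta>\<^esub> y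
        \<in> {x \<in> carrier (R \<beta>). (delta 0 \<circ> single \<beta>) x \<in> T}"
      if xy: "x \<in> carrier (R \<beta>)" "y \<in> carrier (R \<beta>)" for x y
    proof -
      have "single \<beta> x \<in> range \<kappa>" "single \<beta> y \<in> range \<kappa>"
        unfolding range\<kappa> D_def using xy \<beta>I by blast+
      then obtain m n where "single \<beta> x = \<kappa> m" "single \<beta> y = \<kappa> n" by blast
      then have "(delta 0 \<circ> single \<beta>) (x \<otimes>\<^bsub>R \<beta>\<^esub> y \<otimes>\<^bsub>R \<beta>\<^esub> inv\<^bsub>R \<beta>\<^esub> x \<otimes>\<^bsub>R \<beta>\<^esub> inv\<^bsub>R \<beta>\<^esub> y) \<in> T"
        using delta_commutator_T[of m n] xy by simp
      then show ?thesis using xy by simp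
    qed
    then have "?D \<subseteq> {x \<in> carrier (R \<beta>). (delta 0 \<circ> single \<beta>) x \<in> T}"
      unfolding derived_def
      by (intro s.G.generate_subgroup_incl h.subgroup_preimage[OF T_subgroup]) blast
    then have "delta 0 \<circ> single \<beta> \<in> mon (R \<beta>\<lparr>carrier := ?D\<rparr>) ?F"
      by (intro mon_restrict[OF hm]) auto
    then have m: "j \<circ> (delta 0 \<circ> single \<beta>) \<in> mon (R \<beta>\<lparr>carrier := ?D\<rparr>) P"
      by (rule mon_compose[OF _ iso_mon[OF j]])
    have "subgroup ?D (R \<beta>)" by (rule s.G.derived_is_subgroup) simp
    then have "EG \<beta> (R \<beta>\<lparr>carrier := ?D\<rparr>)"
      by (intro EG_mon[OF E _ m]) (rule subgroup.subgroup_is_group[OF _ gR[OF \<beta>I]])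
    then show ?thesis by (rule EG_derived[OF gR[OF \<beta>I]])
  qed
  have "\<not> EG (osucc \<mu>) P"
  proof
    assume "EG (osucc \<mu>) P"
    \<comment> \<open>Being finitely generated, \<open>P\<close> would fall from
      \<open>osucc \<mu>\<close> to \<open>\<mu>\<close> and then to some \<open>\<beta>\<close>
      below it, against \<open>lower\<close>.\<close>
    then have "EG \<mu> P" by (rule EG_osucc_limit_fg[OF \<mu>(1) _ P(2)])
    then obtain \<beta> where "\<beta> < \<mu>" "EG \<beta> P" using EG_limitD[OF _ \<mu>(1)] by blast
    then show False using lower R by (auto simp: seed_def)
  qed
  moreover have "EG (osucc (osucc \<mu>)) H" if H: "group H" "sum_embeds H ((=) P)" for H :: "'a monoid"
  proof -
    let ?H = "H\<lparr>carrier := derived H (derived H (carrier H))\<rparr>"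
    have "subgroup (derived H (derived H (carrier H))) H"
      by (intro group.derived_is_subgroup group.derived_in_carrier H order_refl)
    then have gH: "group ?H" by (rule subgroup.subgroup_is_group[OF _ H(1)])
    have 1: "sum_embeds ?H ((=) K)"
      by (rule sum_embeds_derived2[OF H(1) sum_embeds_iso[OF H(2,1) P(1) gF P(3)]])
    have 2: "sum_embeds K (EG \<mu> :: 'a monoid \<Rightarrow> bool)"
    proof (rule sum_embedsI[of "(\<lambda>\<beta>. (\<lambda>x. x \<beta>, R \<beta>)) ` ?I"])
      fix \<phi> :: "('a set ordinal \<Rightarrow> 'a) \<Rightarrow> 'a" and Q :: "'a monoid"
      assume "(\<phi>, Q) \<in> (\<lambda>\<beta>. (\<lambda>x. x \<beta>, R \<beta>)) ` ?I"
      then obtain \<beta> where \<beta>: "\<beta> \<in> ?I" "\<phi> = (\<lambda>x. x \<beta>)" "Q = R \<beta>" by blast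
      then show "EG \<mu> Q" "group Q" using ER gR by auto
      show "\<phi> \<in> hom K Q"
        unfolding \<beta>(2,3)
      proof (rule homI)
        show "x \<beta> \<in> carrier (R \<beta>)" if "x \<in> carrier K" for x
          using that \<beta>(1) unfolding cK by (auto simp: PiE_def)
        show "(x \<otimes>\<^bsub>K\<^esub> y) \<beta> = x \<beta> \<otimes>\<^bsub>R \<beta>\<^esub> y \<beta>" for x y
          using \<beta>(1) by (simp add: K_def)
      qed
    next
      fix x assume x: "x \<in> carrier K"
      have "{(\<phi>, Q) \<in> (\<lambda>\<beta>. (\<lambda>x. x \<beta>, R \<beta>)) ` ?I. \<phi> x \<noteq> \<one>\<^bsub>Q\<^esub>}
        \<subseteq> (\<lambda>\<beta>. (\<lambda>x. x \<beta>, R \<beta>)) ` {i \<in> ?I. x i \<noteq> \<one>\<^bsub>R i\<^esub>}" by auto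
      moreover have "finite {i \<in> ?I. x i \<noteq> \<one>\<^bsub>R i\<^esub>}" using x cK by blast
      ultimately show "finite {(\<phi>, Q) \<in> (\<lambda>\<beta>. (\<lambda>x. x \<beta>, R \<beta>)) ` ?I. \<phi> x \<noteq> \<one>\<^bsub>Q\<^esub>}"
        using finite_subset by blast
      assume *: "\<And>\<phi> Q. (\<phi>, Q :: 'a monoid) \<in> (\<lambda>\<beta>. (\<lambda>x. x \<beta>, R \<beta>)) ` ?I \<Longrightarrow> \<phi> x = \<one>\<^bsub>Q\<^esub>"
      have **: "x \<beta> = \<one>\<^bsub>R \<beta>\<^esub>" if "\<beta> \<in> ?I" for \<beta>
        using *[of "\<lambda>x. x \<beta>" "R \<beta>"] that by blast
      have "x \<in> extensional ?I" using x cK by (auto simp: PiE_def)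
      then have "x = (\<lambda>\<beta>\<in>?I. \<one>\<^bsub>R \<beta>\<^esub>)"
        using ** by (intro extensionalityI[of _ ?I]) auto
      then show "x = \<one>\<^bsub>K\<^esub>" by (simp add: K_def)
    qed
    have "sum_embeds ?H (EG \<mu> :: 'a monoid \<Rightarrow> bool)"
      using sum_embeds_trans[OF 1 gH, of "EG \<mu> :: 'a monoid \<Rightarrow> bool"] 2 by blast
    \<comment> \<open>The second derived subgroup needs the directed union over finite sets of
      summands. The metabelian quotient already fits into the same class, and the extension by it
      adds the second step.\<close>
    then have "EG (osucc \<mu>) ?H" by (rule sum_embeds_limit[OF \<mu>(1) gH])
    moreover have "osucc 0 \<le> osucc \<mu>" using ordinal_zero_le by (rule osucc_mono)
    ultimately show ?thesis by (intro EG_derived2[OF H(1)])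
  qed
  ultimately show ?thesis using P by (auto simp: seed_def)
qed

section \<open>The elementary classes\<close>

lemma seed_exists:
  fixes \<alpha> :: "'a::infinite set ordinal"
  assumes "\<alpha> < omega1" "\<not> limit_ordinal \<alpha>"
  shows "\<exists>P. seed \<alpha> (P :: 'a monoid)"
  using assms
proof (induction \<alpha> rule: less_induct)
  case (less \<alpha>)
  show ?case
  proof (cases \<alpha> rule: ordinal_cases)
    case zero
    then show ?thesis using seed_zero by simp
  next
    case (succ \<beta>)
    have \<beta>: "\<beta> < \<alpha>" "\<beta> < omega1" using succ osucc_gt[of \<beta>] less.prems(1) by auto
    show ?thesis
    proof (cases "limit_ordinal \<beta>")
      case False
      then show ?thesis using less.IH[OF \<beta>] seed_osucc succ by blast
    next
      case True
      \<comment> \<open>The induction hypothesis excludes limits, so below the limit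
        \<open>\<beta>\<close> only successor indices are used; they are cofinal in it.\<close>
      have "\<exists>P :: 'a monoid. seed (osucc \<gamma>) P" if "\<gamma> < \<beta>" for \<gamma>
      proof (rule less.IH)
        have "osucc \<gamma> < \<beta>" by (rule limit_osucc_less[OF True that])
        then show "osucc \<gamma> < \<alpha>" "osucc \<gamma> < omega1" using \<beta> by auto
      qed simp
      then obtain R where "\<And>\<gamma>. \<gamma> < \<beta> \<Longrightarrow> seed (osucc \<gamma>) (R \<gamma> :: 'a monoid)" by metis
      then show ?thesis using seed_limit[OF True \<beta>(2)] succ by blast
    qed
  next
    case limit
    then show ?thesis using less.prems(2) by blast
  qed
qed

section \<open>The values of the elementary class\<close>

lemma elementary_class_eqI:
  fixes G :: "'a::infinite monoid" and \<alpha> :: "'a set ordinal"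
  assumes "EG (osucc \<alpha>) G" "\<not> EG \<alpha> G"
  shows "elementary_class G = osucc \<alpha>"
  unfolding elementary_class_def
proof (rule Least_equality)
  show "EG (osucc \<alpha>) G" by (rule assms(1))
  fix \<beta> :: "'a set ordinal" assume "EG \<beta> G"
  then have "\<not> \<beta> \<le> \<alpha>" using EG_mono assms(2) by blast
  then show "osucc \<alpha> \<le> \<beta>" by (simp add: osucc_le)
qed

text \<open>For a countable group \<open>countable_EG\<close> supplies a witness below
  \<open>omega1\<close>, so the \<open>LEAST\<close> is attained; at a limit it would already be
  attained earlier.\<close>

lemma elementary_class_cases:
  fixes G :: "'a::infinite monoid"
  assumes "elementary_amenable G" "countable (carrier G)"
  obtains "elementary_class G = 0"
  | \<alpha> where "\<alpha> < omega1" "elementary_class G = osucc \<alpha>" "EG (osucc \<alpha>) G" "\<not> EG \<alpha> G"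
proof -
  have "group G" using assms(1) by (rule elementary_amenable_group)
  then obtain \<beta> where \<beta>: "\<beta> < (omega1 :: 'a set ordinal)" "EG \<beta> G"
    using countable_EG[OF assms(1) _ assms(2) iso_mon[OF iso_set_refl]] by blast
  let ?c = "elementary_class G"
  have c: "EG ?c G" unfolding elementary_class_def using \<beta>(2) by (rule LeastI)
  have least: "?c \<le> \<gamma>" if "EG \<gamma> G" for \<gamma> unfolding elementary_class_def using that by (rule Least_le)
  have c1: "?c < omega1" using least[OF \<beta>(2)] \<beta>(1) by simp
  show thesis
  proof (cases "?c" rule: ordinal_cases)
    case zero
    then show ?thesis by (rule that(1))
  next
    case (succ \<alpha>)
    have "\<alpha> < ?c" unfolding succ by (rule osucc_gt)
    then have "\<not> EG \<alpha> G" "\<alpha> < omega1" using least c1 by force+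
    then show ?thesis using that(2) succ c by metis
  next
    case limit
    then show ?thesis using EG_limitD[OF c] least by force
  qed
qed

lemma trivial_group_class:
  fixes G :: "'a::infinite monoid"
  assumes "trivial_group G"
  shows "G \<in> EA_c" "G \<in> EA_fg" "elementary_class G = 0"
proof -
  have G: "group G" "carrier G = {\<one>\<^bsub>G\<^esub>}" using assms by (auto simp: trivial_group_def)
  have E: "elementary_amenable G" using G by (intro elementary_amenable.finite) simp_all
  show "G \<in> EA_c" using E G by (simp add: EA_c_def)
  have "generate G {\<one>\<^bsub>G\<^esub>} = carrier G" using group.generate_one[OF G(1)] G(2) by simp
  then show "G \<in> EA_fg"
    unfolding EA_fg_def finitely_generated_def using E G(2) by blast
  have "EG 0 G" using G by (intro EG.zero_finite) simp_all
  then have "elementary_class G \<le> 0" unfolding elementary_class_def by (rule Least_le)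
  then show "elementary_class G = 0" using ordinal_zero_le by (rule antisym)
qed

text \<open>When \<open>\<alpha>\<close> is a limit, no finitely generated group has class
  \<open>osucc \<alpha>\<close>. The index \<open>osucc \<alpha>\<close> is never a limit, however,
  so a finitely generated group one class higher exists and can be taken apart.\<close>

lemma countable_class_exists:
  fixes \<alpha> :: "'a::infinite set ordinal"
  assumes "\<alpha> < omega1"
  shows "\<exists>G :: 'a monoid. countable (carrier G) \<and> EG (osucc \<alpha>) G \<and> \<not> EG \<alpha> G"
proof -
  obtain P :: "'a monoid" where P: "seed (osucc \<alpha>) P"
    using seed_exists[OF osucc_less_omega1[OF assms]] by auto
  have fg: "finitely_generated P" and nP: "\<not> EG (osucc \<alpha>) P" using P by (auto simp: seed_def)
  obtain A B where AB: "EG (osucc \<alpha>) A" "EG (osucc \<alpha>) B" "extension_of P A B"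
    using EG_osucc_fg[OF seed_EG[OF P] fg] nP by blast
  obtain p i where p: "p \<in> epi P B" and i: "i \<in> iso (P\<lparr>carrier := kernel P B p\<rparr>) A"
    using extension_ofE[OF AB(3) EG_group[OF AB(2)]] by metis
  have c: "countable (carrier P)" by (rule finitely_generated_countable[OF fg])
  have "carrier B = p ` carrier P" using epiD[OF p] by simp
  then have cB: "countable (carrier B)" using c by simp
  have "countable (kernel P B p)" by (rule countable_subset[OF _ c]) (auto simp: kernel_def)
  moreover have "carrier A = i ` kernel P B p" using epiD[OF iso_epi[OF i]] by simp
  ultimately have cA: "countable (carrier A)" by simp
  \<comment> \<open>If both parts were in \<open>EG \<alpha>\<close>, the same extension would put
    \<open>P\<close> into \<open>EG (osucc \<alpha>)\<close>.\<close>
  have "\<not> EG \<alpha> A \<or> \<not> EG \<alpha> B" using EG.succ_extension[OF _ _ AB(3)] nP by blast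
  then show ?thesis using AB cA cB by blast
qed

theorem corollary1p6:
  shows "{elementary_class G | G :: 'a::infinite monoid. G \<in> EA_c}
           = {osucc \<alpha> | \<alpha> :: 'a set ordinal. \<alpha> < omega1} \<union> {0}
       \<and> {elementary_class G | G :: 'a monoid. G \<in> EA_fg}
           = {osucc (osucc \<alpha>) | \<alpha> :: 'a set ordinal. \<alpha> < omega1} \<union> {0, osucc 0}"
proof (intro conjI equalityI subsetI)
  fix x assume "x \<in> {elementary_class G | G :: 'a monoid. G \<in> EA_c}"
  then obtain G :: "'a monoid" where "x = elementary_class G" "elementary_amenable G" "countable (carrier G)"
    by (auto simp: EA_c_def)
  then show "x \<in> {osucc \<alpha> | \<alpha> :: 'a set ordinal. \<alpha> < omega1} \<union> {0}"
    by (elim elementary_class_cases) auto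
next
  fix x assume "x \<in> {osucc \<alpha> | \<alpha> :: 'a set ordinal. \<alpha> < omega1} \<union> {0}"
  then consider "x = 0" | \<alpha> :: "'a set ordinal" where "x = osucc \<alpha>" "\<alpha> < omega1" by blast
  then show "x \<in> {elementary_class G | G :: 'a monoid. G \<in> EA_c}"
  proof cases
    case 1
    then show ?thesis
      using trivial_group_class(1,3)[OF trivial_singleton_group] by (metis (mono_tags) mem_Collect_eq)
  next
    case 2
    obtain G :: "'a monoid" where G: "countable (carrier G)" "EG (osucc \<alpha>) G" "\<not> EG \<alpha> G"
      using countable_class_exists[OF 2(2)] by blast
    then have "G \<in> EA_c" by (simp add: EA_c_def EG_elementary_amenable)
    then show ?thesis
      using elementary_class_eqI[OF G(2,3)] 2(1) by (intro CollectI exI[of _ G]) simp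
  qed
next
  fix x assume "x \<in> {elementary_class G | G :: 'a monoid. G \<in> EA_fg}"
  then obtain G :: "'a monoid" where G: "x = elementary_class G" "elementary_amenable G" "finitely_generated G"
    by (auto simp: EA_fg_def)
  from G(2) finitely_generated_countable[OF G(3)]
  show "x \<in> {osucc (osucc \<alpha>) | \<alpha> :: 'a set ordinal. \<alpha> < omega1} \<union> {0, osucc 0}"
  proof (cases rule: elementary_class_cases)
    case 1
    then show ?thesis using G(1) by simp
  next
    case (2 \<alpha>)
    show ?thesis
    proof (cases \<alpha> rule: ordinal_cases)
      case zero
      then show ?thesis using 2(2) G(1) by simp
    next
      case (succ \<beta>)
      then have "\<beta> < omega1" using 2(1) osucc_gt[of \<beta>] by simp
      then show ?thesis using 2(2) G(1) succ by blast
    next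
      case limit
      then show ?thesis using EG_osucc_limit_fg[OF limit 2(3) G(3)] 2(4) by blast
    qed
  qed
next
  fix x assume "x \<in> {osucc (osucc \<alpha>) | \<alpha> :: 'a set ordinal. \<alpha> < omega1} \<union> {0, osucc 0}"
  \<comment> \<open>Both \<open>osucc 0\<close> and \<open>osucc (osucc \<alpha>)\<close> are
    successors of an ordinal that is not a limit, exactly the indices for which seeds exist.\<close>
  then consider "x = 0" | \<alpha> :: "'a set ordinal" where "x = osucc \<alpha>" "\<alpha> < omega1" "\<not> limit_ordinal \<alpha>"
    using zero_less_omega1 osucc_less_omega1 limit_ordinal_osucc by blast
  then show "x \<in> {elementary_class G | G :: 'a monoid. G \<in> EA_fg}"
  proof cases
    case 1
    then show ?thesis
      using trivial_group_class(2,3)[OF trivial_singleton_group] by (metis (mono_tags) mem_Collect_eq)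
  next
    case 2
    obtain P :: "'a monoid" where P: "seed \<alpha> P" using seed_exists[OF 2(2,3)] by blast
    then have "P \<in> EA_fg"
      using EG_elementary_amenable[OF seed_EG[OF P]] by (simp add: EA_fg_def seed_def)
    moreover have "elementary_class P = osucc \<alpha>"
      by (rule elementary_class_eqI[OF seed_EG[OF P]]) (use P in \<open>simp add: seed_def\<close>)
    ultimately show ?thesis using 2(1) by (intro CollectI exI[of _ P]) simp
  qed
qed

end
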